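(* For $\alpha\in[1,+\infty)$ let $\psi_\alpha:\mathbb{R}\mathrm{P}^1\to\mathbb{R}\mathrm{P}^1$ be the power function $$\psi_\alpha(x)=\begin{cases} x^\alpha & \text{if } x\geq 0\\ -|x|^\alpha & \text{if } x<0\end{cases},\qquad \psi_\alpha(\infty)=\infty,$$ and let $f_{\psi_\alpha}:\mathbb{H}^2\to\mathbb{H}^2$ be the minimal Lagrangian diffeomorphism which extends $\psi_\alpha$. Then $$\limsup_{\alpha\to 1^+}\frac{\log K(f_{\psi_\alpha})}{\|\psi_\alpha\|_{cr}}\leq \frac{\sqrt 2}{\log(3+2\sqrt 2)}\qquad\text{and}\qquad \lim_{\alpha\to+\infty}\frac{\log K(f_{\psi_\alpha})}{\|\psi_\alpha\|_{cr}}=0.$$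
   Context: $\mathbb{H}^2$ is the hyperbolic plane in the upper half-plane model $\{z=x+iy: y>0\}$ with metric $g_{\mathbb{H}^2}=(dx^2+dy^2)/y^2$; its boundary at infinity is $\mathbb{R}\mathrm{P}^1\cong\mathbb{R}\cup\{\infty\}$. Cross-ratio: $cr(x_1,x_2,x_3,x_4)=\frac{(x_4-x_1)(x_3-x_2)}{(x_2-x_1)(x_3-x_4)}$ for quadruples of points of $\mathbb{R}\mathrm{P}^1$ (extended to $\infty$ by continuity). For an orientation-preserving homeomorphism $\varphi$ of $\mathbb{R}\mathrm{P}^1$, the cross-ratio norm is $\|\varphi\|_{cr}=\sup_{cr(Q)=-1}|\log|cr(\varphi(Q))||$, the supremum being over quadruples $Q$ with $cr(Q)=-1$; $\varphi$ is quasisymmetric if $\|\varphi\|_{cr}<+\infty$. The maps $\psi_\alpha$ are quasisymmetric. For an orientation-preserving diffeomorphism $f:\mathbb{H}^2\to\mathbb{H}^2$, its maximal dilatation is $K(f)=\sup_{z\in\mathbb{H}^2}\frac{\text{major axis of }df_z(\mathbb{S}^1)}{\text{minor axis of }df_z(\mathbb{S}^1)}$, where $\mathbb{S}^1$ is the unit circle in $T_z\mathbb{H}^2=\mathbb{C}$; $f$ is quasiconformal if $K(f)<+\infty$. An orientation-preserving diffeomorphism $f:\mathbb{H}^2\to\mathbb{H}^2$ is minimal Lagrangian if it is area-preserving and its graph is a minimal surface in the Riemannian product $\mathbb{H}^2\times\mathbb{H}^2$. Equivalently, $f^*g_{\mathbb{H}^2}=g_{\mathbb{H}^2}(b\cdot,b\cdot)$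 for some section $b$ of $\mathrm{End}(T\mathbb{H}^2)$ which is self-adjoint for $g_{\mathbb{H}^2}$, has $\det b=1$ and satisfies $d^\nabla b=0$, where $(d^\nabla b)(v,w)=\nabla_v(b(w))-\nabla_w(b(v))-b[v,w]$ and $\nabla$ is the Levi-Civita connection of $g_{\mathbb{H}^2}$. By a theorem of Bonsante and Schlenker, every quasisymmetric homeomorphism $\varphi$ of $\mathbb{R}\mathrm{P}^1$ has a unique minimal Lagrangian diffeomorphism $f_\varphi:\mathbb{H}^2\to\mathbb{H}^2$ extending it continuously, and $f_\varphi$ is quasiconformal. *)

theory Defs
  imports "HOL-Analysis.Analysis"
begin

section \<open>The boundary at infinity and the cross-ratio norm\<close>

datatype rp1 = Fin real | Infty

text \<open>
  Represent \<open>Fin x\<close> by the homogeneous coordinates \<open>(x, 1)\<close> and \<open>Infty\<close> by \<open>(1, 0)\<close>;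
  \<open>bracket a b\<close> is the determinant of the two representatives, so that it is \<open>a - b\<close>
  at finite points.  Each point occurs once in the numerator and once in the denominator of the
  cross-ratio, so the choice of representatives is irrelevant and the single formula below
  is also the extension by continuity to quadruples containing \<open>Infty\<close>.
\<close>

fun bracket :: "rp1 \<Rightarrow> rp1 \<Rightarrow> real" where
  "bracket (Fin a) (Fin b) = a - b"
| "bracket (Fin a) Infty = - 1"
| "bracket Infty (Fin b) = 1"
| "bracket Infty Infty = 0"

definition cross_ratio :: "rp1 \<Rightarrow> rp1 \<Rightarrow> rp1 \<Rightarrow> rp1 \<Rightarrow> real" where
  "cross_ratio x1 x2 x3 x4 =
     (bracket x4 x1 * bracket x3 x2) / (bracket x2 x1 * bracket x3 x4)"

lemma cross_ratio_simps:
  "cross_ratio (Fin a) (Fin b) (Fin c) (Fin d) = ((d - a) * (c - b)) / ((b - a) * (c - d))"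
  "cross_ratio Infty (Fin b) (Fin c) (Fin d) = (c - b) / (c - d)"
  "cross_ratio (Fin a) Infty (Fin c) (Fin d) = - ((d - a) / (c - d))"
  "cross_ratio (Fin a) (Fin b) Infty (Fin d) = (d - a) / (b - a)"
  "cross_ratio (Fin a) (Fin b) (Fin c) Infty = - ((c - b) / (b - a))"
  by (auto simp: cross_ratio_def divide_simps) (simp_all add: algebra_simps)

text \<open>
  Since \<open>x / 0 = 0\<close>, a quadruple of cross-ratio \<open>-1\<close> automatically consists of four
  distinct points.  The supremum is taken in the extended reals.
\<close>

definition cr_norm :: "(rp1 \<Rightarrow> rp1) \<Rightarrow> ereal" where
  "cr_norm \<phi> =
     (SUP (x1, x2, x3, x4) \<in> {(x1, x2, x3, x4). cross_ratio x1 x2 x3 x4 = - 1}.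
        ereal \<bar>ln \<bar>cross_ratio (\<phi> x1) (\<phi> x2) (\<phi> x3) (\<phi> x4)\<bar>\<bar>)"

fun power_map :: "real \<Rightarrow> rp1 \<Rightarrow> rp1" where
  "power_map \<alpha> (Fin x) = Fin (if x \<ge> 0 then x powr \<alpha> else - (\<bar>x\<bar> powr \<alpha>))"
| "power_map \<alpha> Infty = Infty"


section \<open>The upper half-plane\<close>

definition upper_half_plane :: "complex set" where
  "upper_half_plane = {z. Im z > 0}"

definition hyp_metric :: "complex \<Rightarrow> complex \<Rightarrow> complex \<Rightarrow> real" where
  "hyp_metric z u v = (u \<bullet> v) / (Im z)\<^sup>2"

definition hyp_area_form :: "complex \<Rightarrow> complex \<Rightarrow> complex \<Rightarrow> real" where
  "hyp_area_form z u v = (Re u * Im v - Im u * Re v) / (Im z)\<^sup>2"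

text \<open>
  The Christoffel symbols of the Levi-Civita connection in the coordinates \<open>x + iy\<close>, as the
  symmetric bilinear map \<open>(u, v) \<mapsto> \<nabla>\<^sub>u v\<close> on constant vector fields: the nonzero ones are
  \<open>-1/y\<close> (for \<open>x;xy\<close> and \<open>y;yy\<close>) and \<open>1/y\<close> (for \<open>y;xx\<close>), which in complex notation is
  \<open>(i/y) u v\<close>.  It is symmetric, and compatible with the metric by the lemma below.
\<close>

definition hyp_christoffel :: "complex \<Rightarrow> complex \<Rightarrow> complex \<Rightarrow> complex" where
  "hyp_christoffel z u v = (\<i> / of_real (Im z)) * u * v"

lemma hyp_christoffel_metric:
  assumes "z \<in> upper_half_plane"
  shows "((\<lambda>z. hyp_metric z u v) has_derivative
           (\<lambda>w. hyp_metric z (hyp_christoffel z w u) v + hyp_metric z u (hyp_christoffel z w v)))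
         (at z)"
proof -
  have y: "Im z \<noteq> 0"
    using assms by (simp add: upper_half_plane_def)
  have "((\<lambda>z. (u \<bullet> v) / (Im z)\<^sup>2) has_derivative
          (\<lambda>w. - (2 * Im w * (u \<bullet> v)) / (Im z) ^ 3)) (at z)"
    using y by (auto intro!: derivative_eq_intros simp: power2_eq_square power3_eq_cube field_simps)
  moreover have "hyp_metric z (hyp_christoffel z w u) v + hyp_metric z u (hyp_christoffel z w v)
      = - (2 * Im w * (u \<bullet> v)) / (Im z) ^ 3" for w
    using y by (simp add: hyp_metric_def hyp_christoffel_def inner_complex_def
        power2_eq_square power3_eq_cube field_simps)
  ultimately show ?thesis
    by (simp add: hyp_metric_def)
qed

text \<open>
  Trace on the upper half-plane of the neighbourhoods of a boundary point, in the topology of the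
  closed disc \<open>upper_half_plane \<union> rp1\<close>.
\<close>

fun boundary_filter :: "rp1 \<Rightarrow> complex filter" where
  "boundary_filter (Fin x) = at (of_real x) within upper_half_plane"
| "boundary_filter Infty = inf at_infinity (principal upper_half_plane)"

definition extends_continuously :: "(complex \<Rightarrow> complex) \<Rightarrow> (rp1 \<Rightarrow> rp1) \<Rightarrow> bool" where
  "extends_continuously f \<phi> \<longleftrightarrow>
     (\<forall>p. filterlim f (boundary_filter (\<phi> p)) (boundary_filter p))"


section \<open>Diffeomorphisms and maximal dilatation\<close>

text \<open>For open \<open>S\<close>: being of class \<open>C\<^sup>k\<close>, respectively smooth, on \<open>S\<close>.\<close>

primrec Ck_on ::
  "nat \<Rightarrow> 'a::real_normed_vector set \<Rightarrow> ('a \<Rightarrow> 'b::real_normed_vector) \<Rightarrow> bool" where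
  "Ck_on 0 S f \<longleftrightarrow> continuous_on S f"
| "Ck_on (Suc k) S f \<longleftrightarrow>
     (\<forall>z\<in>S. f differentiable (at z)) \<and>
     (\<forall>v. Ck_on k S (\<lambda>z. frechet_derivative f (at z) v))"

definition smooth_on :: "'a::euclidean_space set \<Rightarrow> ('a \<Rightarrow> 'b::euclidean_space) \<Rightarrow> bool" where
  "smooth_on S f \<longleftrightarrow> (\<forall>k. Ck_on k S f)"

definition op_diffeo :: "(complex \<Rightarrow> complex) \<Rightarrow> bool" where
  "op_diffeo f \<longleftrightarrow>
     bij_betw f upper_half_plane upper_half_plane \<and>
     smooth_on upper_half_plane f \<and>
     smooth_on upper_half_plane (inv_into upper_half_plane f) \<and>
     (\<forall>z\<in>upper_half_plane.
        hyp_area_form (f z) (frechet_derivative f (at z) 1) (frechet_derivative f (at z) \<i>) > 0)"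

text \<open>
  The image of the unit circle under \<open>df\<^sub>z\<close> is an ellipse centred at \<open>0\<close>, with semi-axes the
  largest and the smallest norm of its points.  The metric is conformal, so the ratio may be
  computed with the Euclidean norm.
\<close>

definition dilatation_at :: "(complex \<Rightarrow> complex) \<Rightarrow> complex \<Rightarrow> real" where
  "dilatation_at f z =
     (SUP v\<in>sphere 0 1. norm (frechet_derivative f (at z) v)) /
     (INF v\<in>sphere 0 1. norm (frechet_derivative f (at z) v))"

definition max_dilatation :: "(complex \<Rightarrow> complex) \<Rightarrow> ereal" where
  "max_dilatation f = (SUP z\<in>upper_half_plane. ereal (dilatation_at f z))"

text \<open>Only applied to maximal dilatations, which are at least \<open>1\<close>.\<close>

definition ereal_ln :: "ereal \<Rightarrow> ereal" where
  "ereal_ln x = (if x = \<infinity> then \<infinity> else ereal (ln (real_of_ereal x)))"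


section \<open>Minimal surfaces in the product of two hyperbolic planes\<close>

definition prod_metric ::
  "complex \<times> complex \<Rightarrow> complex \<times> complex \<Rightarrow> complex \<times> complex \<Rightarrow> real" where
  "prod_metric p U V =
     hyp_metric (fst p) (fst U) (fst V) + hyp_metric (snd p) (snd U) (snd V)"

definition prod_christoffel ::
  "complex \<times> complex \<Rightarrow> complex \<times> complex \<Rightarrow> complex \<times> complex \<Rightarrow> complex \<times> complex" where
  "prod_christoffel p U V =
     (hyp_christoffel (fst p) (fst U) (fst V), hyp_christoffel (snd p) (snd U) (snd V))"

text \<open>
  For a parametrised surface \<open>F\<close>, the covariant derivative along \<open>F\<close>, in the coordinate direction
  \<open>u\<close>, of the tangent field \<open>dF(v)\<close> (with \<open>v\<close> constant).
\<close>

definition cov_deriv ::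
  "(complex \<Rightarrow> complex \<times> complex) \<Rightarrow> complex \<Rightarrow> complex \<Rightarrow> complex \<Rightarrow> complex \<times> complex" where
  "cov_deriv F z u v =
     frechet_derivative (\<lambda>w. frechet_derivative F (at w) v) (at z) u +
     prod_christoffel (F z) (frechet_derivative F (at z) u) (frechet_derivative F (at z) v)"

definition normal_to ::
  "(complex \<Rightarrow> complex \<times> complex) \<Rightarrow> complex \<Rightarrow> complex \<times> complex \<Rightarrow> bool" where
  "normal_to F z N \<longleftrightarrow> (\<forall>u. prod_metric (F z) (frechet_derivative F (at z) u) N = 0)"

definition second_fundamental_form ::
  "(complex \<Rightarrow> complex \<times> complex) \<Rightarrow> complex \<Rightarrow> complex \<times> complex \<Rightarrow> complex \<Rightarrow> complex \<Rightarrow> real" where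
  "second_fundamental_form F z N u v = prod_metric (F z) (cov_deriv F z u v) N"

definition induced_metric ::
  "(complex \<Rightarrow> complex \<times> complex) \<Rightarrow> complex \<Rightarrow> complex \<Rightarrow> complex \<Rightarrow> real" where
  "induced_metric F z u v =
     prod_metric (F z) (frechet_derivative F (at z) u) (frechet_derivative F (at z) v)"

text \<open>
  Vanishing of the mean curvature vector: for every normal \<open>N\<close>, the trace of the second fundamental
  form with respect to the induced metric, computed in an orthonormal basis, is zero.
\<close>

definition minimal_immersion :: "(complex \<Rightarrow> complex \<times> complex) \<Rightarrow> bool" where
  "minimal_immersion F \<longleftrightarrow>
     (\<forall>z\<in>upper_half_plane. \<forall>N e1 e2.
        normal_to F z N \<longrightarrow>
        induced_metric F z e1 e1 = 1 \<longrightarrow> induced_metric F z e2 e2 = 1 \<longrightarrow>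
        induced_metric F z e1 e2 = 0 \<longrightarrow>
        second_fundamental_form F z N e1 e1 + second_fundamental_form F z N e2 e2 = 0)"

definition area_preserving :: "(complex \<Rightarrow> complex) \<Rightarrow> bool" where
  "area_preserving f \<longleftrightarrow>
     (\<forall>z\<in>upper_half_plane. \<forall>u v.
        hyp_area_form (f z) (frechet_derivative f (at z) u) (frechet_derivative f (at z) v)
          = hyp_area_form z u v)"

definition minimal_lagrangian :: "(complex \<Rightarrow> complex) \<Rightarrow> bool" where
  "minimal_lagrangian f \<longleftrightarrow>
     op_diffeo f \<and> area_preserving f \<and> minimal_immersion (\<lambda>z. (z, f z))"

end

theory Submission
  imports Defs "HOL-Real_Asymp.Real_Asymp"
begin

text \<open>
  A minimal Lagrangian map \<open>f\<close> comes from the maximal surface in the anti-de Sitter space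
  \<open>PSL(2, \<real>)\<close> with Gauss maps \<open>z\<close> and \<open>f z\<close>: its point \<open>S z\<close> is an isometry of the half-plane that
  sends \<open>z\<close> to \<open>f z\<close>, with a rotation part whose angle \<open>\<theta>\<close> integrates half the difference of the two
  Levi-Civita connection forms. The surface is properly embedded, and its boundary is the graph of the
  boundary map of \<open>f\<close>. For two surfaces with the same boundary, a maximum principle for the pairing of
  their points (perturbed by logarithmic barriers at two boundary points) shows that they coincide, so
  that \<open>f\<close> is determined by its boundary map.

  As \<open>z \<mapsto> \<lambda>\<^sup>-\<^sup>\<alpha> f(\<lambda>z)\<close> also extends the power function, \<open>f\<close> is homogeneous of degree \<open>\<alpha>\<close>. The
  structure equations become ordinary differential equations on the unit circle; together with the
  boundary values they give \<open>|f z| = |z|\<^sup>\<alpha>\<close> and \<open>\<alpha> Re f / Im f = Re z / Im z\<close>, whence the dilatation of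
  \<open>f\<close> is at most \<open>\<alpha>\<^sup>2\<close>. On the other side a quadruple symmetric under \<open>x \<mapsto> -x\<close> and \<open>x \<mapsto> 1/x\<close> shows
  that the cross-ratio norm is at least \<open>2 log sinh (\<alpha> log (1 + \<surd>2))\<close>, and both limits follow from the
  behaviour of \<open>log \<alpha> / log sinh (\<alpha> log (1 + \<surd>2))\<close>.
\<close>

section \<open>Expanding self-maps of the half-plane\<close>

text \<open>The hypotheses provide some minimal Lagrangian extension and no estimate for it.
  Uniqueness is what turns the dilation symmetry of the power function into homogeneity, and a
  maximum principle on a noncompact surface needs a maximum to exist. Hence the weight on
  properness: each evaluation map \<open>z \<mapsto> mob (S z) z0\<close> expands hyperbolic length,
  so it is a homeomorphism of the half-plane; this yields the bound
  \<open>ads (S x) (S y) \<le> -1\<close> and its coercivity. As \<open>S\<close> is determined only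
  up to sign, the pairing of two surfaces is normalised by the sign seen at the boundary, which is
  found by comparing areas of boxes.

  The constants come from \<open>\<kappa> = ln (1 + sqrt 2)\<close>, the solution of
  \<open>sinh \<kappa> = 1\<close>, with \<open>2 * \<kappa> = ln (3 + 2 * sqrt 2)\<close>. The norm
  stands in the denominator, so a lower bound from one quadruple suffices. At 1 the function
  \<open>ln (sinh (\<alpha> * \<kappa>))\<close> has slope \<open>\<kappa> * sqrt 2\<close>, whence
  the first bound; at infinity it grows linearly and beats \<open>ln \<alpha>\<close>.\<close>

lemma lift_unique:
  fixes h :: "'a::metric_space \<Rightarrow> 'b" and k1 k2 :: "'c::metric_space \<Rightarrow> 'a"
  assumes "connected T" "continuous_on T k1" "continuous_on T k2"
    and "k1 ` T \<subseteq> U"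
    and linj: "\<And>z. z \<in> U \<Longrightarrow> \<exists>r>0. inj_on h (ball z r)"
    and eq: "\<And>t. t \<in> T \<Longrightarrow> h (k1 t) = h (k2 t)"
    and "t0 \<in> T" "k1 t0 = k2 t0" "t \<in> T"
  shows "k1 t = k2 t"
proof -
  let ?E = "{t\<in>T. k1 t = k2 t}"
  have "closedin (top_of_set T) {t\<in>T. dist (k1 t) (k2 t) \<in> {0}}"
    using continuous_closedin_preimage_constant[of T "\<lambda>t. dist (k1 t) (k2 t)" 0]
    by (auto intro!: continuous_intros assms)
  then have cl: "closedin (top_of_set T) ?E"
    by simp
  \<comment> \<open>Near a common value both lifts lie in one ball on which \<open>h\<close> is
    injective, and \<open>h\<close> takes equal values on them; so agreement is an open
    condition.\<close>
  have op: "openin (top_of_set T) ?E"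
    unfolding openin_euclidean_subtopology_iff
  proof (intro conjI ballI)
    fix t assume t: "t \<in> ?E"
    then obtain r where r: "r > 0" "inj_on h (ball (k1 t) r)"
      using linj assms(4) by blast
    obtain d1 where d1: "d1 > 0" "\<And>s. s \<in> T \<Longrightarrow> dist s t < d1 \<Longrightarrow> dist (k1 s) (k1 t) < r"
      using assms(2) t r(1) unfolding continuous_on_iff by blast
    obtain d2 where d2: "d2 > 0" "\<And>s. s \<in> T \<Longrightarrow> dist s t < d2 \<Longrightarrow> dist (k2 s) (k2 t) < r"
      using assms(3) t r(1) unfolding continuous_on_iff by blast
    have "s \<in> ?E" if "s \<in> T" "dist s t < min d1 d2" for s
      using that d1(2)[of s] d2(2)[of s] t inj_onD[OF r(2) eq[of s]] by (auto simp: dist_commute)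
    then show "\<exists>e>0. \<forall>s\<in>T. dist s t < e \<longrightarrow> s \<in> ?E"
      using d1(1) d2(1) by (intro exI[of _ "min d1 d2"]) auto
  qed auto
  have "?E = T"
    using assms(1,7,8) op cl unfolding connected_clopen by blast
  then show ?thesis using \<open>t \<in> T\<close> by blast
qed

text \<open>If injectivity failed on every neighbourhood, pairs of distinct points with equal images
  would accumulate at two points of \<open>C\<close>. These have equal images, hence coincide by
  injectivity on \<open>C\<close>, and this contradicts local injectivity there.\<close>

lemma injective_near_compact:
  fixes h :: "'a::euclidean_space \<Rightarrow> 'b::metric_space"
  assumes "open U" "compact C" "C \<subseteq> U" "inj_on h C" "continuous_on U h"
    and linj: "\<And>z. z \<in> U \<Longrightarrow> \<exists>r>0. inj_on h (ball z r)"
  obtains V where "open V" "C \<subseteq> V" "V \<subseteq> U" "inj_on h V"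
proof -
  obtain \<delta> where \<delta>: "\<delta> > 0" "(\<Union>x\<in>C. ball x \<delta>) \<subseteq> U"
    using compact_subset_open_imp_ball_epsilon_subset[OF assms(2,1,3)] by blast
  define V where "V n = (\<Union>x\<in>C. ball x (\<delta> / real (Suc n)))" for n
  have VU: "V n \<subseteq> U" for n
  proof -
    have "\<delta> / real (Suc n) \<le> \<delta>" using \<delta>(1) by (simp add: divide_le_eq)
    then have "V n \<subseteq> (\<Union>x\<in>C. ball x \<delta>)"
      unfolding V_def by (intro UN_mono subset_ball) auto
    then show ?thesis using \<delta>(2) by blast
  qed
  have "\<exists>n. inj_on h (V n)"
  proof (rule ccontr)
    assume "\<nexists>n. inj_on h (V n)"
    then have "\<forall>n. \<exists>a b. a \<in> V n \<and> b \<in> V n \<and> h a = h b \<and> a \<noteq> b"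
      unfolding inj_on_def by blast
    then obtain a b where ab: "\<And>n. a n \<in> V n" "\<And>n. b n \<in> V n" "\<And>n. h (a n) = h (b n)" "\<And>n. a n \<noteq> b n"
      by metis
    have "\<forall>n. \<exists>a' b'. a' \<in> C \<and> b' \<in> C \<and> dist a' (a n) < \<delta> / real (Suc n) \<and> dist b' (b n) < \<delta> / real (Suc n)"
      using ab(1,2) unfolding V_def by fastforce
    then obtain a' b' where ab': "\<And>n. a' n \<in> C" "\<And>n. b' n \<in> C"
      "\<And>n. dist (a' n) (a n) < \<delta> / real (Suc n)" "\<And>n. dist (b' n) (b n) < \<delta> / real (Suc n)"
      by metis
    obtain l r where r: "strict_mono r" "l \<in> C \<times> C" "((\<lambda>n. (a' n, b' n)) \<circ> r) \<longlonglongrightarrow> l"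
      using compact_Times[OF assms(2,2)] ab'(1,2) unfolding compact_def by (metis (no_types, lifting) mem_Sigma_iff)
    obtain p q where l: "l = (p, q)" by fastforce
    have z: "(\<lambda>n. \<delta> / real (Suc n)) \<longlonglongrightarrow> 0"
      using tendsto_mult_right_zero[OF LIMSEQ_inverse_real_of_nat, of \<delta>] by (simp add: divide_inverse)
    have z': "(\<lambda>n. \<delta> / real (Suc (r n))) \<longlonglongrightarrow> 0"
      using LIMSEQ_subseq_LIMSEQ[OF z r(1)] by (simp add: o_def)
    have ap: "(\<lambda>n. a' (r n)) \<longlonglongrightarrow> p" and bq: "(\<lambda>n. b' (r n)) \<longlonglongrightarrow> q"
      using tendsto_fst[OF r(3)] tendsto_snd[OF r(3)] by (simp_all add: l o_def)
    have da: "(\<lambda>n. dist (a (r n)) (a' (r n))) \<longlonglongrightarrow> 0"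
      by (rule tendsto_sandwich[OF _ _ tendsto_const z']) (use ab'(3) in \<open>auto simp: dist_commute intro!: always_eventually less_imp_le\<close>)
    have db: "(\<lambda>n. dist (b (r n)) (b' (r n))) \<longlonglongrightarrow> 0"
      by (rule tendsto_sandwich[OF _ _ tendsto_const z']) (use ab'(4) in \<open>auto simp: dist_commute intro!: always_eventually less_imp_le\<close>)
    have ap: "(\<lambda>n. a (r n)) \<longlonglongrightarrow> p" and bq: "(\<lambda>n. b (r n)) \<longlonglongrightarrow> q"
      using Lim_transform[OF ap, of "\<lambda>n. a (r n)"] Lim_transform[OF bq, of "\<lambda>n. b (r n)"] da db
      by (auto simp: dist_norm tendsto_norm_zero_iff)
    have pq: "p \<in> C" "q \<in> C" using r(2) l by auto
    have cont: "isCont h p" "isCont h q"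
      using assms(1,3,5) pq continuous_on_eq_continuous_at by blast+
    have "(\<lambda>n. h (a (r n))) \<longlonglongrightarrow> h p" "(\<lambda>n. h (b (r n))) \<longlonglongrightarrow> h q"
      using isCont_tendsto_compose[OF cont(1) ap] isCont_tendsto_compose[OF cont(2) bq] by auto
    then have "h p = h q" using ab(3) LIMSEQ_unique by simp
    then have "p = q" using assms(4) pq by (meson inj_onD)
    obtain e where e: "e > 0" "inj_on h (ball p e)" using linj pq assms(3) by blast
    have "eventually (\<lambda>n. dist (a (r n)) p < e \<and> dist (b (r n)) p < e) sequentially"
      using tendstoD[OF ap e(1)] tendstoD[OF bq e(1)] \<open>p = q\<close> eventually_conj by blast
    then obtain n where "dist (a (r n)) p < e" "dist (b (r n)) p < e"
      by (auto simp: eventually_sequentially)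
    then show False
      using inj_onD[OF e(2) ab(3)[of "r n"]] ab(4)[of "r n"] by (auto simp: dist_commute)
  qed
  then obtain n where n: "inj_on h (V n)" by blast
  show ?thesis
  proof (rule that[of "V n"])
    show "C \<subseteq> V n" unfolding V_def using \<delta>(1) by (auto intro!: bexI)
  qed (use n VU in \<open>auto simp: V_def\<close>)
qed

text \<open>Continuity method on the homothetic copies \<open>T s\<close> of \<open>K\<close> with
  centre \<open>q0\<close>. The a priori estimate \<open>bnd\<close> (values in a fixed compact set,
  a fixed Lipschitz constant) makes the set of liftable \<open>s\<close> closed; local injectivity
  and invariance of domain make it open.\<close>

lemma lift_on_convex:
  fixes h :: "'a::euclidean_space \<Rightarrow> 'a"
  assumes U: "open U" and cont: "continuous_on U h"
    and linj: "\<And>z. z \<in> U \<Longrightarrow> \<exists>r>0. inj_on h (ball z r)"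
    and K: "convex K" "compact K" "q0 \<in> K"
    and x0: "x0 \<in> U" "h x0 = q0"
    and C: "compact C" "C \<subseteq> U"
    and bnd: "\<And>T k. \<lbrakk>convex T; T \<subseteq> K; q0 \<in> T; continuous_on T k; k ` T \<subseteq> U;
       \<And>q. q \<in> T \<Longrightarrow> h (k q) = q; k q0 = x0\<rbrakk> \<Longrightarrow> k ` T \<subseteq> C \<and> M-lipschitz_on T k"
  obtains k where "continuous_on K k" "k ` K \<subseteq> U" "\<And>q. q \<in> K \<Longrightarrow> h (k q) = q" "k q0 = x0"
proof -
  define g where "g s q = q0 + s *\<^sub>R (q - q0)" for s :: real and q
  define T where "T s = g s ` K" for s
  define lift where "lift k X \<longleftrightarrow> continuous_on X k \<and> k ` X \<subseteq> U \<and> (\<forall>q\<in>X. h (k q) = q) \<and> k q0 = x0" for k X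
  have conv: "convex (T s)" for s
  proof -
    have "g s = (\<lambda>q. (q0 - s *\<^sub>R q0) + s *\<^sub>R q)"
      by (auto simp: g_def algebra_simps)
    then show ?thesis
      unfolding T_def using convex_affinity[OF K(1), of "q0 - s *\<^sub>R q0" s] by simp
  qed
  have q0T: "q0 \<in> T s" for s
    unfolding T_def g_def using K(3) by (auto intro!: image_eqI[of _ _ q0])
  have comp: "compact (T s)" for s
    unfolding T_def g_def by (intro compact_continuous_image continuous_intros K(2))
  have gK: "g s q \<in> K" if "q \<in> K" "0 \<le> s" "s \<le> 1" for s q
  proof -
    have "g s q = (1 - s) *\<^sub>R q0 + s *\<^sub>R q" by (simp add: g_def algebra_simps)
    then show ?thesis using convexD_alt[OF K(1) K(3) that(1)] that by simp
  qed
  have mono: "T s \<subseteq> T s'" if "0 \<le> s" "s \<le> s'" for s s'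
  proof (cases "s' = 0")
    case False
    show ?thesis
    proof
      fix x assume "x \<in> T s"
      then obtain q where q: "q \<in> K" "x = g s q" unfolding T_def by blast
      have "x = g s' (g (s/s') q)" using q False by (simp add: g_def)
      then show "x \<in> T s'" unfolding T_def using gK[OF q(1), of "s/s'"] that False by (auto simp: divide_le_eq)
    qed
  qed (use that in auto)
  have T1: "T 1 = K" unfolding T_def g_def by simp
  have TK: "T s \<subseteq> K" if "0 \<le> s" "s \<le> 1" for s using mono[of s 1] that T1 by simp
  have bound: "k ` X \<subseteq> C \<and> M-lipschitz_on X k" if "lift k X" "convex X" "X \<subseteq> K" "q0 \<in> X" for k X
    using bnd[of X k] that unfolding lift_def by blast
  define S where "S = {s. 0 \<le> s \<and> s \<le> 1 \<and> (\<exists>k. lift k (T s))}"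
  have down: "s \<in> S" if s: "s' \<in> S" "0 \<le> s" "s \<le> s'" for s s'
  proof -
    obtain k where k: "lift k (T s')" "s' \<le> 1" using s(1) unfolding S_def by blast
    then have "lift k (T s)" using mono[OF s(2,3)] unfolding lift_def
      by (meson continuous_on_subset image_mono subset_trans subsetD)
    then show ?thesis using s k(2) unfolding S_def by auto
  qed
  have "T 0 = {q0}" unfolding T_def g_def using K(3) by auto
  then have "lift (\<lambda>_. x0) (T 0)" using x0 by (auto simp: lift_def)
  then have S0: "0 \<in> S" unfolding S_def by auto
  have bdd: "bdd_above S" unfolding S_def by (auto intro: bdd_aboveI[of _ 1])
  define s where "s = Sup S"
  have s01: "0 \<le> s" "s \<le> 1"
    unfolding s_def using S0 by (auto intro!: cSup_upper bdd cSup_least) (auto simp: S_def)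
  have below: "s' \<in> S" if s': "0 \<le> s'" "s' < s" for s'
  proof -
    obtain r where "r \<in> S" "s' < r" using less_cSupE[of s' S] s' S0 unfolding s_def by blast
    then show ?thesis using down[of r s'] s' by auto
  qed
  have sS: "s \<in> S"
  proof (cases "s = 0")
    case False
    with s01 have spos: "s > 0" by simp
    have "\<forall>s'\<in>{0..<s}. \<exists>k. lift k (T s')" using below unfolding S_def by auto
    then obtain kk where kk: "\<And>s'. s' \<in> {0..<s} \<Longrightarrow> lift (kk s') (T s')" by metis
    define X where "X = (\<Union>s'\<in>{0..<s}. T s')"
    have consist: "kk a q = kk b q" if "a \<in> {0..<s}" "b \<in> {0..<s}" "q \<in> T a" "q \<in> T b" for a b q
    proof -
      have *: "kk a q = kk b q" if "a \<in> {0..<s}" "b \<in> {0..<s}" "q \<in> T a" "a \<le> b" for a b q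
      proof (rule lift_unique[where T="T a" and U=U and h=h and ?t0.0=q0 and ?k1.0="kk a" and ?k2.0="kk b"])
        show "connected (T a)" using conv convex_connected by blast
        show "continuous_on (T a) (kk a)" using kk[OF that(1)] unfolding lift_def by blast
        show "continuous_on (T a) (kk b)"
          using kk[OF that(2)] mono[of a b] that unfolding lift_def by (auto intro: continuous_on_subset)
      qed (use kk[OF that(1)] kk[OF that(2)] mono[of a b] that q0T linj in \<open>auto simp: lift_def\<close>)
      show ?thesis using *[of a b q] *[of b a q] that by (metis linear)
    qed
    define k where "k q = kk (SOME a. a \<in> {0..<s} \<and> q \<in> T a) q" for q
    have k: "k q = kk a q" if "a \<in> {0..<s}" "q \<in> T a" for a q
    proof -
      have "(SOME a. a \<in> {0..<s} \<and> q \<in> T a) \<in> {0..<s} \<and> q \<in> T (SOME a. a \<in> {0..<s} \<and> q \<in> T a)"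
        by (rule someI[of _ a]) (use that in auto)
      then show ?thesis unfolding k_def using consist that by blast
    qed
    have common: "\<exists>a\<in>{0..<s}. p \<in> T a \<and> q \<in> T a" if pq: "p \<in> X" "q \<in> X" for p q
    proof -
      obtain a b where "a \<in> {0..<s}" "b \<in> {0..<s}" "p \<in> T a" "q \<in> T b"
        using pq unfolding X_def by blast
      then show ?thesis using mono[of a "max a b"] mono[of b "max a b"]
        by (intro bexI[of _ "max a b"]) auto
    qed
    have bd: "kk a ` T a \<subseteq> C \<and> M-lipschitz_on (T a) (kk a)" if "a \<in> {0..<s}" for a
      using bound[OF kk[OF that] conv TK q0T] that s01 by auto
    have Mnn: "M \<ge> 0" using bd[of 0] spos lipschitz_on_nonneg by auto
    have lipX: "M-lipschitz_on X k"
    proof (rule lipschitz_onI[OF _ Mnn])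
      fix p q assume "p \<in> X" "q \<in> X"
      then obtain a where "a \<in> {0..<s}" "p \<in> T a" "q \<in> T a" using common by blast
      then show "dist (k p) (k q) \<le> M * dist p q"
        using k[of a] bd[of a] lipschitz_onD by metis
    qed
    have XP: "k q \<in> C \<and> h (k q) = q" if "q \<in> X" for q
      using that k bd kk unfolding X_def lift_def by (smt (verit, best) UN_iff image_subset_iff)
    \<comment> \<open>The uniform Lipschitz constant lets the glued lift extend to the closure, and
      compactness of \<open>C\<close> keeps the extension inside \<open>U\<close>.\<close>
    obtain G where G: "uniformly_continuous_on (closure X) G" "\<And>x. x \<in> X \<Longrightarrow> k x = G x"
      using uniformly_continuous_on_extension_on_closure[OF lipschitz_on_uniformly_continuous[OF lipX]] by metis
    have contG: "continuous_on (closure X) G" using G(1) uniformly_continuous_imp_continuous by blast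
    have GC: "G ` closure X \<subseteq> C"
      by (rule image_closure_subset[OF contG compact_imp_closed[OF C(1)]]) (use XP G(2) in force)
    have hG: "h (G q) = q" if "q \<in> closure X" for q
    proof -
      have "continuous_on (closure X) (\<lambda>q. h (G q) - q)"
        by (intro continuous_intros continuous_on_compose2[OF cont contG]) (use GC C(2) in auto)
      then have "h (G q) - q = 0"
        by (rule continuous_constant_on_closure[where S=X]) (use XP G(2) that in auto)
      then show ?thesis by simp
    qed
    have Tcl: "T s \<subseteq> closure X"
    proof
      fix x assume "x \<in> T s"
      then obtain q where q: "q \<in> K" "x = g s q" unfolding T_def by blast
      have "(\<lambda>n. g (s * (1 - inverse (real (Suc n)))) q) \<longlonglongrightarrow> g (s * (1 - 0)) q"
        unfolding g_def by (intro tendsto_intros LIMSEQ_inverse_real_of_nat)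
      moreover have "g (s * (1 - inverse (real (Suc n)))) q \<in> X" for n
        unfolding X_def T_def using q(1) spos
        by (intro UN_I[of "s * (1 - inverse (real (Suc n)))"]) (auto simp: field_simps)
      ultimately show "x \<in> closure X" unfolding closure_sequential q(2)
        by (intro exI[of _ "\<lambda>n. g (s * (1 - inverse (real (Suc n)))) q"]) auto
    qed
    have "q0 \<in> X" unfolding X_def using q0T spos by (auto intro!: bexI[of _ 0])
    have "k q0 = x0" using k[of 0 q0] q0T kk[of 0] spos unfolding lift_def by auto
    then have "G q0 = x0" using G(2) \<open>q0 \<in> X\<close> by simp
    then have "lift G (T s)" unfolding lift_def
      using Tcl GC C(2) hG contG by (auto intro: continuous_on_subset)
    then show ?thesis using s01 unfolding S_def by auto
  qed (use S0 in simp)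
  have "s = 1"
  proof (rule ccontr)
    assume "s \<noteq> 1"
    with s01 have s1: "s < 1" by simp
    obtain k where k: "lift k (T s)" using sS unfolding S_def by blast
    then have ck: "continuous_on (T s) k" and kU: "k ` T s \<subseteq> U" and hk: "\<And>q. q \<in> T s \<Longrightarrow> h (k q) = q"
      and k0: "k q0 = x0" unfolding lift_def by auto
    \<comment> \<open>A lift is a section of \<open>h\<close>, so \<open>h\<close> is injective on
      its compact image and hence on a neighbourhood \<open>V\<close>; the inverse of
      \<open>h\<close> on \<open>V\<close> lifts a slightly larger homothetic copy.\<close>
    have "inj_on h (k ` T s)" using hk by (auto simp: inj_on_def)
    then obtain V where V: "open V" "k ` T s \<subseteq> V" "V \<subseteq> U" "inj_on h V"
      using injective_near_compact[OF U compact_continuous_image[OF ck comp] kU _ cont linj] by blast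
    have cV: "continuous_on V h" using cont V(3) continuous_on_subset by blast
    obtain k' where k': "homeomorphism V (h ` V) h k'"
      using invariance_of_domain_homeomorphism[OF V(1) cV _ V(4)] by auto
    have opV: "open (h ` V)" using invariance_of_domain[OF cV V(1,4)] .
    have "T s \<subseteq> h ` V" using V(2) hk by force
    then obtain e where e: "e > 0" "(\<Union>x\<in>T s. ball x e) \<subseteq> h ` V"
      using compact_subset_open_imp_ball_epsilon_subset[OF comp opV] by blast
    obtain D where D: "D > 0" "\<And>q. q \<in> K \<Longrightarrow> norm (q - q0) \<le> D"
    proof -
      have "bounded ((\<lambda>q. q - q0) ` K)"
        using compact_imp_bounded[OF K(2)] by (rule bounded_translation_minus)
      then show ?thesis using that unfolding bounded_pos by auto
    qed
    define s' where "s' = min 1 (s + e / (2 * D))"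
    have s': "s < s'" "s' \<le> 1" "s' - s \<le> e / (2*D)" unfolding s'_def using s1 e(1) D(1) by auto
    have Ts': "T s' \<subseteq> h ` V"
    proof
      fix x assume "x \<in> T s'"
      then obtain q where q: "q \<in> K" "x = g s' q" unfolding T_def by blast
      have "dist (g s q) x = norm ((s' - s) *\<^sub>R (q - q0))"
        unfolding q g_def dist_norm by (simp add: algebra_simps norm_minus_commute)
      also have "\<dots> \<le> (e/(2*D)) * D"
        unfolding norm_scaleR using s' D(2)[OF q(1)] D(1) e(1) by (intro mult_mono) auto
      also have "\<dots> < e" using D(1) e(1) by simp
      finally have "x \<in> ball (g s q) e" by simp
      moreover have "g s q \<in> T s" using q(1) unfolding T_def by blast
      ultimately show "x \<in> h ` V" using e(2) by blast
    qed
    have "x0 \<in> V" using V(2) q0T k0 by force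
    then have "k' q0 = x0" using k' x0 by (metis homeomorphism_apply1)
    then have "lift k' (T s')" unfolding lift_def
    proof (intro conjI ballI)
      show "continuous_on (T s') k'" using homeomorphism_cont2[OF k'] Ts' continuous_on_subset by blast
      show "k' ` T s' \<subseteq> U" using homeomorphism_image2[OF k'] Ts' V(3) by blast
      show "h (k' q) = q" if "q \<in> T s'" for q using homeomorphism_apply2[OF k'] Ts' that by blast
    qed
    then have "s' \<in> S" unfolding S_def using s' s01 by auto
    then have "s' \<le> s" unfolding s_def using bdd cSup_upper by blast
    then show False using s' by simp
  qed
  then obtain k where "lift k K" using sS T1 unfolding S_def by auto
  then show ?thesis using that unfolding lift_def by blast
qed

section \<open>Length-expanding self-maps of the half-plane\<close>

lemma uhp_iff: "z \<in> upper_half_plane \<longleftrightarrow> 0 < Im z"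
  by (simp add: upper_half_plane_def)

lemma open_uhp: "open upper_half_plane"
  unfolding upper_half_plane_def by (rule open_halfspace_Im_gt)

lemma convex_uhp: "convex upper_half_plane"
  unfolding upper_half_plane_def by (rule convex_halfspace_Im_gt)

lemma inj_linear_inverse:
  fixes A :: "complex \<Rightarrow> complex"
  assumes "linear A" "\<And>v. A v = 0 \<Longrightarrow> v = 0"
  obtains B where "linear B" "B \<circ> A = id" "A \<circ> B = id"
proof -
  have "inj A" using assms linear_injective_0 by blast
  then obtain B where B: "linear B" "B \<circ> A = id"
    using linear_injective_left_inverse[OF assms(1)] by blast
  then show ?thesis using that linear_inverse_left[OF assms(1)] by blast
qed

text \<open>
  A differentiable self-map of the half-plane that does not shrink the hyperbolic length of any
  tangent vector is a homeomorphism: the lifts of a compact convex set cannot escape to infinity.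
\<close>

locale uhp_expanding =
  fixes h :: "complex \<Rightarrow> complex" and h' :: "complex \<Rightarrow> complex \<Rightarrow> complex"
  assumes maps: "z \<in> upper_half_plane \<Longrightarrow> h z \<in> upper_half_plane"
    and deriv: "z \<in> upper_half_plane \<Longrightarrow> (h has_derivative h' z) (at z)"
    and cont_deriv: "continuous_on upper_half_plane (\<lambda>z. h' z v)"
    and expand: "z \<in> upper_half_plane \<Longrightarrow> cmod v / Im z \<le> cmod (h' z v) / Im (h z)"
begin

lemma cont: "continuous_on upper_half_plane h"
  using deriv has_derivative_continuous continuous_at_imp_continuous_on by blast

lemma lin: "z \<in> upper_half_plane \<Longrightarrow> linear (h' z)"
  using deriv has_derivative_linear by blast

lemma inverse_deriv:
  assumes "z \<in> upper_half_plane"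
  obtains B where "linear B" "B \<circ> h' z = id" "h' z \<circ> B = id"
proof (rule inj_linear_inverse[OF lin[OF assms]])
  fix v assume "h' z v = 0"
  then show "v = 0" using expand[OF assms, of v] assms by (simp add: uhp_iff divide_le_0_iff)
qed (use that in blast)

text \<open>\<open>cont_deriv\<close> gives continuity one direction at a time; in the plane the
  directions \<open>1\<close> and \<open>\<i>\<close> control the operator norm.\<close>

lemma onorm_diff_small:
  assumes z: "z \<in> upper_half_plane" and e: "0 < e"
  shows "\<exists>d>0. \<forall>x\<in>upper_half_plane. dist z x < d \<longrightarrow> onorm (\<lambda>v. h' x v - h' z v) < e"
proof -
  have ex: "\<exists>d>0. \<forall>x\<in>upper_half_plane. dist z x < d \<longrightarrow> cmod (h' x v - h' z v) < e/3" for v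
    using cont_deriv[of v] z e unfolding continuous_on_iff
    by (metis dist_commute dist_norm divide_pos_pos zero_less_numeral)
  obtain d1 where d1: "d1 > 0" "\<And>x. x \<in> upper_half_plane \<Longrightarrow> dist z x < d1 \<Longrightarrow> cmod (h' x 1 - h' z 1) < e/3"
    using ex by blast
  obtain d2 where d2: "d2 > 0" "\<And>x. x \<in> upper_half_plane \<Longrightarrow> dist z x < d2 \<Longrightarrow> cmod (h' x \<i> - h' z \<i>) < e/3"
    using ex by blast
  have "onorm (\<lambda>v. h' x v - h' z v) < e" if x: "x \<in> upper_half_plane" "dist z x < min d1 d2" for x
  proof -
    have "cmod (h' x v - h' z v) \<le> (2*e/3) * cmod v" for v
    proof -
      have dec: "h' y v = Re v *\<^sub>R h' y 1 + Im v *\<^sub>R h' y \<i>" if "y \<in> upper_half_plane" for y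
      proof -
        have "v = Re v *\<^sub>R 1 + Im v *\<^sub>R \<i>" by (simp add: complex_eq_iff)
        then show ?thesis using lin[OF that] linear_add linear_scale by metis
      qed
      have "h' x v - h' z v = Re v *\<^sub>R (h' x 1 - h' z 1) + Im v *\<^sub>R (h' x \<i> - h' z \<i>)"
        using dec[OF x(1)] dec[OF z] by (simp add: algebra_simps)
      also have "cmod \<dots> \<le> \<bar>Re v\<bar> * cmod (h' x 1 - h' z 1) + \<bar>Im v\<bar> * cmod (h' x \<i> - h' z \<i>)"
        by (rule order_trans[OF norm_triangle_ineq]) simp
      also have "\<dots> \<le> cmod v * (e/3) + cmod v * (e/3)"
        using d1(2)[OF x(1)] d2(2)[OF x(1)] x(2) abs_Re_le_cmod[of v] abs_Im_le_cmod[of v]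
        by (intro add_mono mult_mono) auto
      finally show ?thesis by (simp add: algebra_simps)
    qed
    then have "onorm (\<lambda>v. h' x v - h' z v) \<le> 2*e/3" by (rule onorm_le)
    then show ?thesis using e by simp
  qed
  then show ?thesis using d1 d2 by (intro exI[of _ "min d1 d2"]) auto
qed

lemma locally_injective:
  assumes "z \<in> upper_half_plane"
  shows "\<exists>r>0. inj_on h (ball z r)"
proof -
  obtain d0 where d0: "d0 > 0" "ball z d0 \<subseteq> upper_half_plane"
    using open_uhp assms open_contains_ball by blast
  obtain B where B: "linear B" "B \<circ> h' z = id" using inverse_deriv[OF assms] .
  show ?thesis
  proof (rule has_derivative_locally_injective[of z "ball z d0" B h' h])
    show "bounded_linear B" using B(1) linear_conv_bounded_linear by blast
    show "(h has_derivative h' x) (at x)" if "x \<in> ball z d0" for x using deriv d0 that by blast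
    show "\<exists>d>0. \<forall>x. dist z x < d \<longrightarrow> onorm (\<lambda>v. h' x v - h' z v) < e" if e: "e > 0" for e
    proof -
      obtain d where "d > 0" "\<forall>x\<in>upper_half_plane. dist z x < d \<longrightarrow> onorm (\<lambda>v. h' x v - h' z v) < e"
        using onorm_diff_small[OF assms e] by blast
      then show ?thesis using d0 by (intro exI[of _ "min d d0"]) auto
    qed
  qed (use d0 B in auto)
qed

text \<open>By \<open>expand\<close> a lift does not increase hyperbolic length. Over
  \<open>K\<close>, where \<open>Im\<close> is at least \<open>m\<close>, the function
  \<open>ln (Im (k q))\<close> is therefore \<open>1/m\<close>-Lipschitz, so \<open>Im (k q)\<close>
  stays between \<open>y0 * exp (- (D/m))\<close> and \<open>y0 * exp (D/m)\<close>; the upper bound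
  divided by \<open>m\<close> then bounds the derivative of \<open>k\<close>.\<close>

lemma lift_bounds:
  assumes K: "convex K" "compact K" "K \<subseteq> upper_half_plane" "q0 \<in> K" and x0: "x0 \<in> upper_half_plane"
  obtains C M where "compact C" "C \<subseteq> upper_half_plane"
    "\<And>T k. \<lbrakk>convex T; T \<subseteq> K; q0 \<in> T; continuous_on T k; k ` T \<subseteq> upper_half_plane;
       \<And>q. q \<in> T \<Longrightarrow> h (k q) = q; k q0 = x0\<rbrakk> \<Longrightarrow> k ` T \<subseteq> C \<and> M-lipschitz_on T k"
proof -
  obtain p where p: "p \<in> K" "\<And>q. q \<in> K \<Longrightarrow> Im p \<le> Im q"
    using continuous_attains_inf[OF K(2), of Im] K(4) continuous_on_Im[OF continuous_on_id] by blast
  define m where "m = Im p"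
  have m: "m > 0" "\<And>q. q \<in> K \<Longrightarrow> m \<le> Im q" using p K(3) by (auto simp: m_def uhp_iff)
  obtain D where D: "D > 0" "\<And>q. q \<in> K \<Longrightarrow> cmod (q - q0) \<le> D"
    using compact_imp_bounded[OF K(2)] bounded_translation_minus[of K q0] unfolding bounded_pos by auto
  define y0 where "y0 = Im x0"
  have y0: "y0 > 0" using x0 by (simp add: y0_def uhp_iff)
  define M where "M = y0 * exp (D/m) / m"
  have Mpos: "M > 0" unfolding M_def using y0 m D by auto
  define C where "C = cball x0 (M * D) \<inter> {z. y0 * exp (- (D/m)) \<le> Im z}"
  have bd: "k ` T \<subseteq> C \<and> M-lipschitz_on T k"
    if T: "convex T" "T \<subseteq> K" "q0 \<in> T" and k: "continuous_on T k" "k ` T \<subseteq> upper_half_plane"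
      "\<And>q. q \<in> T \<Longrightarrow> h (k q) = q" "k q0 = x0" for T k
  proof -
    have der: "\<exists>B. (k has_derivative B) (at q within T) \<and> (\<forall>v. cmod (B v) \<le> Im (k q) / Im q * cmod v)"
      if q: "q \<in> T" for q
    proof -
      have kq: "k q \<in> upper_half_plane" using k(2) q by blast
      obtain B where B: "linear B" "B \<circ> h' (k q) = id" "h' (k q) \<circ> B = id"
        using inverse_deriv[OF kq] .
      have im: "h ` (k ` T) = T" using k(3) by force
      have "(k has_derivative B) (at (h (k q)) within h ` (k ` T))"
      proof (rule has_derivative_inverse_within[where f'="h' (k q)"])
        show "(h has_derivative h' (k q)) (at (k q) within k ` T)"
          using deriv[OF kq] has_derivative_at_withinI by blast
        show "continuous (at (h (k q)) within h ` (k ` T)) k"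
          unfolding im using k(1,3) q continuous_on_eq_continuous_within by metis
      qed (use B q k(3) in auto)
      then have kd: "(k has_derivative B) (at q within T)" using im k(3)[OF q] by simp
      have "cmod (B v) \<le> Im (k q) / Im q * cmod v" for v
      proof -
        have "h' (k q) (B v) = v" using B(3) by (metis comp_apply id_apply)
        then have "cmod (B v) / Im (k q) \<le> cmod v / Im q" using expand[OF kq, of "B v"] k(3)[OF q] by simp
        moreover have "Im (k q) > 0" "Im q > 0" using kq maps[OF kq] k(3)[OF q] by (auto simp: uhp_iff)
        ultimately show ?thesis by (simp add: field_simps)
      qed
      then show ?thesis using kd by blast
    qed
    then obtain B where B: "\<And>q. q \<in> T \<Longrightarrow> (k has_derivative B q) (at q within T)"
      "\<And>q v. q \<in> T \<Longrightarrow> cmod (B q v) \<le> Im (k q) / Im q * cmod v" by metis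
    have Impos: "Im (k q) > 0" if "q \<in> T" for q using k(2) that by (auto simp: uhp_iff)
    have lnbound: "\<bar>ln (Im (k q)) - ln (Im (k q0))\<bar> \<le> D / m" if q: "q \<in> T" for q
    proof -
      have "norm (ln (Im (k q)) - ln (Im (k q0))) \<le> (1/m) * norm (q - q0)"
      proof (rule differentiable_bound[OF T(1), where f'="\<lambda>q v. Im (B q v) / Im (k q)"])
        fix x assume x: "x \<in> T"
        show "((\<lambda>q. ln (Im (k q))) has_derivative (\<lambda>v. Im (B x v) / Im (k x))) (at x within T)"
          using Impos[OF x] by (auto intro!: derivative_eq_intros B(1)[OF x] simp: field_simps)
        show "onorm (\<lambda>v. Im (B x v) / Im (k x)) \<le> 1/m"
        proof (rule onorm_le)
          fix v
          have "norm (Im (B x v) / Im (k x)) \<le> cmod (B x v) / Im (k x)"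
            using Impos[OF x] abs_Im_le_cmod by (simp add: divide_right_mono)
          also have "\<dots> \<le> (Im (k x) / Im x * cmod v) / Im (k x)"
            using Impos[OF x] by (intro divide_right_mono B(2)[OF x]) auto
          also have "\<dots> = cmod v / Im x" using Impos[OF x] by simp
          also have "\<dots> \<le> cmod v / m" using m(1) m(2)[of x] x T(2) by (intro divide_left_mono) auto
          finally show "norm (Im (B x v) / Im (k x)) \<le> 1/m * norm v" by simp
        qed
      qed (use q T(3) in auto)
      also have "\<dots> \<le> (1/m) * D" using q T(2) m(1) by (intro mult_left_mono D(2)) auto
      finally show ?thesis by simp
    qed
    have up: "Im (k q) \<le> y0 * exp (D/m)" and low: "y0 * exp (-(D/m)) \<le> Im (k q)" if q: "q \<in> T" for q
    proof -
      have "ln (Im (k q)) \<le> ln y0 + D/m" "ln y0 + (-(D/m)) \<le> ln (Im (k q))"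
        using lnbound[OF q] k(4) by (auto simp: y0_def abs_le_iff)
      then have "exp (ln (Im (k q))) \<le> exp (ln y0 + D/m)" "exp (ln y0 + (-(D/m))) \<le> exp (ln (Im (k q)))"
        by simp_all
      then show "Im (k q) \<le> y0 * exp (D/m)" "y0 * exp (-(D/m)) \<le> Im (k q)"
        using Impos[OF q] y0 unfolding exp_add by auto
    qed
    have lip: "cmod (k p - k q) \<le> M * cmod (p - q)" if "p \<in> T" "q \<in> T" for p q
    proof (rule differentiable_bound[OF T(1) B(1) _ that])
      fix x assume x: "x \<in> T"
      show "onorm (B x) \<le> M"
      proof (rule onorm_le)
        fix v
        have "Im (k x) / Im x \<le> M" unfolding M_def
          using up[OF x] m(1) m(2)[of x] x T(2) y0 by (intro frac_le) auto
        then show "cmod (B x v) \<le> M * cmod v"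
          using B(2)[OF x, of v] by (meson mult_right_mono norm_ge_zero order_trans)
      qed
    qed
    have "k q \<in> C" if q: "q \<in> T" for q
    proof -
      have "cmod (k q - k q0) \<le> M * D"
        using lip[OF q T(3)] D(2)[of q] q T(2) Mpos by (meson mult_left_mono order_trans less_imp_le subsetD)
      then show ?thesis unfolding C_def using low[OF q] k(4) by (auto simp: dist_norm norm_minus_commute)
    qed
    moreover have "M-lipschitz_on T k"
      by (rule lipschitz_onI) (use lip Mpos in \<open>auto simp: dist_norm\<close>)
    ultimately show ?thesis by blast
  qed
  have "compact C" unfolding C_def
    by (intro compact_Int_closed compact_cball closed_halfspace_Im_ge)
  moreover have "C \<subseteq> upper_half_plane" unfolding C_def
  proof
    fix z assume "z \<in> cball x0 (M * D) \<inter> {z. y0 * exp (- (D/m)) \<le> Im z}"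
    moreover have "y0 * exp (- (D/m)) > 0" using y0 by simp
    ultimately show "z \<in> upper_half_plane" unfolding uhp_iff by auto
  qed
  ultimately show ?thesis by (rule that) (rule bd)
qed

lemma lift_exists:
  assumes K: "convex K" "compact K" "K \<subseteq> upper_half_plane" and x0: "x0 \<in> upper_half_plane" "h x0 \<in> K"
  obtains k where "continuous_on K k" "k ` K \<subseteq> upper_half_plane" "\<And>q. q \<in> K \<Longrightarrow> h (k q) = q" "k (h x0) = x0"
proof -
  obtain C M where CM: "compact C" "C \<subseteq> upper_half_plane"
    "\<And>T k. \<lbrakk>convex T; T \<subseteq> K; h x0 \<in> T; continuous_on T k; k ` T \<subseteq> upper_half_plane;
       \<And>q. q \<in> T \<Longrightarrow> h (k q) = q; k (h x0) = x0\<rbrakk> \<Longrightarrow> k ` T \<subseteq> C \<and> M-lipschitz_on T k"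
    by (rule lift_bounds[OF K x0(2,1)]) blast
  obtain k where "continuous_on K k" "k ` K \<subseteq> upper_half_plane" "\<And>q. q \<in> K \<Longrightarrow> h (k q) = q" "k (h x0) = x0"
    by (rule lift_on_convex[OF open_uhp cont locally_injective K(1,2) x0(2,1) refl CM(1,2) CM(3)]) auto
  then show ?thesis using that by blast
qed

text \<open>A segment from \<open>x1\<close> to \<open>x2\<close> is sent to a closed curve inside a
  compact convex set. The lift of that convex set through \<open>x1\<close>, restricted to the
  curve, must follow the segment by uniqueness of lifts; as the curve closes up, so does the
  segment.\<close>

lemma inj: "inj_on h upper_half_plane"
proof (rule inj_onI)
  fix x1 x2 assume x: "x1 \<in> upper_half_plane" "x2 \<in> upper_half_plane" "h x1 = h x2"
  define \<gamma> where "\<gamma> = linepath x1 x2"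
  have \<gamma>U: "\<gamma> t \<in> upper_half_plane" if "t \<in> {0..1}" for t
    using linepath_in_path[OF that, of x1 x2] closed_segment_subset[OF x(1,2) convex_uhp]
    unfolding \<gamma>_def by (rule rev_subsetD)
  have c\<gamma>: "continuous_on {0..1} \<gamma>" unfolding \<gamma>_def by (intro continuous_intros)
  have ch: "continuous_on {0..1} (\<lambda>t. h (\<gamma> t))"
    by (rule continuous_on_compose2[OF cont c\<gamma>]) (use \<gamma>U in auto)
  define K where "K = convex hull ((\<lambda>t. h (\<gamma> t)) ` {0..1})"
  have K: "convex K" "compact K" "K \<subseteq> upper_half_plane"
  proof -
    show "convex K" unfolding K_def by simp
    show "compact K" unfolding K_def by (intro compact_convex_hull compact_continuous_image ch compact_Icc)
    show "K \<subseteq> upper_half_plane" unfolding K_def by (rule hull_minimal) (use maps \<gamma>U convex_uhp in auto)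
  qed
  have hK: "h (\<gamma> t) \<in> K" if "t \<in> {0..1}" for t
    unfolding K_def using that by (intro hull_inc) auto
  have "\<gamma> 0 = x1" "\<gamma> 1 = x2" unfolding \<gamma>_def by (simp_all add: linepath_def)
  then have h1: "h x1 \<in> K" using hK[of 0] by auto
  obtain k where k: "continuous_on K k" "k ` K \<subseteq> upper_half_plane" "\<And>q. q \<in> K \<Longrightarrow> h (k q) = q" "k (h x1) = x1"
    by (rule lift_exists[OF K x(1) h1]) blast
  have "k (h (\<gamma> 1)) = \<gamma> 1"
  proof (rule lift_unique[where T="{0..1::real}" and U=upper_half_plane and h=h and ?t0.0=0 and ?k1.0="\<lambda>t. k (h (\<gamma> t))" and ?k2.0=\<gamma>])
    show "continuous_on {0..1} (\<lambda>t. k (h (\<gamma> t)))"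
      by (rule continuous_on_compose2[OF k(1) ch]) (use hK in auto)
  qed (use locally_injective c\<gamma> hK k \<open>\<gamma> 0 = x1\<close> in auto)
  then show "x1 = x2" using \<open>\<gamma> 1 = x2\<close> k(4) x(3) by simp
qed

lemma surj:
  assumes q: "q \<in> upper_half_plane"
  obtains x where "x \<in> upper_half_plane" "h x = q"
proof -
  have i: "\<i> \<in> upper_half_plane" by (simp add: uhp_iff)
  have K: "convex (closed_segment (h \<i>) q)" "compact (closed_segment (h \<i>) q)"
    "closed_segment (h \<i>) q \<subseteq> upper_half_plane"
    using convex_uhp maps[OF i] q by (auto simp: closed_segment_subset)
  obtain k where "k ` closed_segment (h \<i>) q \<subseteq> upper_half_plane" "\<And>p. p \<in> closed_segment (h \<i>) q \<Longrightarrow> h (k p) = p"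
    by (rule lift_exists[OF K i]) auto
  then show ?thesis using that[of "k q"] by auto
qed

lemma proper:
  assumes "compact K" "K \<subseteq> upper_half_plane"
  shows "compact {x\<in>upper_half_plane. h x \<in> K}"
proof -
  obtain g where g: "homeomorphism upper_half_plane (h ` upper_half_plane) h g"
    using invariance_of_domain_homeomorphism[OF open_uhp cont _ inj] by auto
  have im: "h ` upper_half_plane = upper_half_plane" using maps surj by (auto simp: image_iff) metis
  have "{x\<in>upper_half_plane. h x \<in> K} = g ` K"
  proof (intro equalityI subsetI)
    fix x assume "x \<in> {x \<in> upper_half_plane. h x \<in> K}"
    then show "x \<in> g ` K" using homeomorphism_apply1[OF g, of x] by force
  next
    fix x assume "x \<in> g ` K"
    then obtain y where y: "y \<in> K" "x = g y" by blast
    then have "y \<in> h ` upper_half_plane" using im assms(2) by blast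
    then show "x \<in> {x \<in> upper_half_plane. h x \<in> K}"
      using homeomorphism_apply2[OF g, of y] homeomorphism_image2[OF g] y by auto
  qed
  moreover have "continuous_on K g" using homeomorphism_cont2[OF g] im assms(2) continuous_on_subset by metis
  ultimately show ?thesis using assms(1) compact_continuous_image by metis
qed

end

section \<open>The maximal surface\<close>

text \<open>
  A quadruple \<open>(a, b, c, d)\<close> stands for the matrix with rows \<open>(b, -d)\<close> and \<open>(a, -c)\<close>; \<open>ads\<close> is the
  bilinear form of signature \<open>(2, 2)\<close> whose quadratic form is minus the determinant.
\<close>

definition imv :: "complex \<Rightarrow> complex \<Rightarrow> complex \<Rightarrow> real \<times> real \<times> real \<times> real" where
  "imv k w b = (Im k, Im (k * w), Im (k * b), Im (k * w * b))"

definition ads :: "real \<times> real \<times> real \<times> real \<Rightarrow> real \<times> real \<times> real \<times> real \<Rightarrow> real" where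
  "ads = (\<lambda>(a, b, c, d) (a', b', c', d'). (b * c' + c * b' - d * a' - a * d') / 2)"

lemma ads_Pair [simp]: "ads (a, b, c, d) (a', b', c', d') = (b * c' + c * b' - d * a' - a * d') / 2"
  by (simp add: ads_def)

lemma bounded_bilinear_ads: "bounded_bilinear ads"
proof (intro bilinear_conv_bounded_bilinear[THEN iffD1] bilinear_def[THEN iffD2] conjI allI)
  show "linear (ads x)" for x
    by (rule linearI; cases x) (auto simp: algebra_simps add_divide_distrib diff_divide_distrib)
  show "linear (\<lambda>x. ads x y)" for y
    by (rule linearI; cases y) (auto simp: algebra_simps add_divide_distrib diff_divide_distrib)
qed

interpretation ads: bounded_bilinear ads
  by (rule bounded_bilinear_ads)

lemma ads_commute: "ads p q = ads q p"
  by (cases p; cases q) (auto simp: algebra_simps)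

text \<open>\<open>imv k w b\<close> is the imaginary part of the vector
  \<open>k * (1, w, b, w * b)\<close>, which is null for the complexified form; two such vectors
  pair to \<open>- k * k' * (w - w') * (b - b') / 2\<close>.\<close>

lemma ads_imv:
  "ads (imv k w b) (imv k' w' b') =
     Re (k * k' * (w - w') * (b - b') - k * cnj k' * (w - cnj w') * (b - cnj b')) / 4"
  by (simp add: imv_def field_simps)

lemma imv_add: "imv (k + k') w b = imv k w b + imv k' w b"
  by (simp add: imv_def algebra_simps)

text \<open>
  The assumption \<open>form\<close> says that \<open>\<pi> - 2\<theta>\<close> is the argument of \<open>\<partial>f/\<partial>z\<close>, whose modulus is \<open>\<rho>\<close>, and
  \<open>rho_sq\<close> that \<open>f\<close> preserves the area; \<open>angle\<close> encodes that the graph of \<open>f\<close> is minimal.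
\<close>

locale conformal_ml =
  fixes f :: "complex \<Rightarrow> complex" and f' :: "complex \<Rightarrow> complex \<Rightarrow> complex"
    and \<theta> :: "complex \<Rightarrow> real" and \<rho> :: "complex \<Rightarrow> real" and c :: "complex \<Rightarrow> complex"
  assumes maps: "z \<in> upper_half_plane \<Longrightarrow> f z \<in> upper_half_plane"
    and deriv: "z \<in> upper_half_plane \<Longrightarrow> (f has_derivative f' z) (at z)"
    and deriv2: "z \<in> upper_half_plane \<Longrightarrow> (\<lambda>w. f' w v) differentiable (at z)"
    and angle: "z \<in> upper_half_plane \<Longrightarrow>
      (\<theta> has_derivative (\<lambda>v. (Re (f' z v) / Im (f z) - Re v / Im z) / 2)) (at z)"
    and form: "z \<in> upper_half_plane \<Longrightarrow> f' z v = - of_real (\<rho> z) * cis (- 2 * \<theta> z) * v + c z * cnj v"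
    and rho_pos: "z \<in> upper_half_plane \<Longrightarrow> \<rho> z > 0"
    and rho_sq: "z \<in> upper_half_plane \<Longrightarrow> (\<rho> z)\<^sup>2 = (cmod (c z))\<^sup>2 + (Im (f z) / Im z)\<^sup>2"
begin

definition E where "E z = cis (\<theta> z)"
definition n where "n z = 1 / sqrt (Im (f z) * Im z)"
text \<open>Both forms compare the differentials of \<open>f\<close> and of the identity, each
  divided by the height so as to measure hyperbolic length, after rotations by \<open>E z\<close>
  that bring them into a common frame.\<close>

definition \<beta> where "\<beta> z v = \<i>/2 * (cnj (E z) * cnj (f' z v) / Im (f z) - E z * cnj v / Im z)"
definition \<gamma> where "\<gamma> z v = \<i>/2 * (cnj (E z) * cnj (f' z v) / Im (f z) + E z * cnj v / Im z)"
text \<open>The complex quadruple \<open>k * (1, w, b, w * b)\<close> is a matrix of rank one with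
  kernel \<open>b\<close> and image \<open>w\<close>. For \<open>w = f z\<close> and
  \<open>b = cnj z\<close> the conjugate matrix kills \<open>z\<close>, so the imaginary part sends
  \<open>z\<close> to \<open>f z\<close>. The null vectors with parameters
  \<open>(f z, cnj z)\<close> and their conjugates span the plane of \<open>S z\<close> and
  \<open>N z\<close>; those with parameters \<open>(f z, z)\<close> and their conjugates span its
  orthogonal complement, the tangent plane.\<close>

definition S where "S z = imv (n z * E z) (f z) (cnj z)"
definition N where "N z = imv (\<i> * (n z * E z)) (f z) (cnj z)"

lemma Im_pos: "z \<in> upper_half_plane \<Longrightarrow> Im z > 0" "z \<in> upper_half_plane \<Longrightarrow> Im (f z) > 0"
  using maps by (auto simp: uhp_iff)

lemma E_cnj [simp]: "E z * cnj (E z) = 1" "cnj (E z) * E z = 1"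
  by (simp_all add: E_def cis_cnj cis_mult)

lemma norm_E [simp]: "cmod (E z) = 1"
  by (simp add: E_def)

lemma n_pos: "z \<in> upper_half_plane \<Longrightarrow> n z > 0"
  using Im_pos by (simp add: n_def)

lemma n_sq: "z \<in> upper_half_plane \<Longrightarrow> n z * n z * (Im (f z) * Im z) = 1"
  using Im_pos[of z] by (simp add: n_def field_simps flip: power2_eq_square)

lemma f'_lin: "z \<in> upper_half_plane \<Longrightarrow> linear (f' z)"
  using deriv has_derivative_linear by blast

lemma ads_S_S:
  assumes "z \<in> upper_half_plane"
  shows "ads (S z) (S z) = -1"
proof -
  have "(n z * E z) * cnj (n z * E z) = of_real (n z * n z)"
    using E_cnj(1)[of z] by (simp add: mult.assoc mult.left_commute)
  moreover have "(f z - cnj (f z)) * (cnj z - z) = of_real (4 * (Im (f z) * Im z))"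
    by (simp add: complex_eq_iff)
  ultimately have "n z * E z * cnj (n z * E z) * (f z - cnj (f z)) * (cnj z - z)
     = of_real (4 * (n z * n z * (Im (f z) * Im z)))"
    by (simp add: mult.assoc)
  then show ?thesis using n_sq[OF assms] by (simp add: S_def ads_imv)
qed

lemma n_deriv:
  assumes z: "z \<in> upper_half_plane"
  shows "(n has_derivative (\<lambda>v. - (n z / 2) * (Im (f' z v) / Im (f z) + Im v / Im z))) (at z)"
proof -
  have "sqrt (Im (f z) * Im z) \<noteq> 0" using Im_pos[OF z] by simp
  then show ?thesis
    unfolding n_def
    using Im_pos[OF z] z
    apply (auto intro!: derivative_eq_intros deriv has_derivative_Im ext)
    apply (simp add: field_simps)
    done
qed

lemma E_deriv:
  assumes z: "z \<in> upper_half_plane"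
  shows "(E has_derivative (\<lambda>v. ((Re (f' z v) / Im (f z) - Re v / Im z) / 2) *\<^sub>R (\<i> * E z))) (at z)"
proof -
  have "(exp has_derivative (\<lambda>t. exp (\<i> * complex_of_real (\<theta> z)) * t)) (at (\<i> * complex_of_real (\<theta> z)))"
      using DERIV_exp[of "\<i> * complex_of_real (\<theta> z)"] by (simp add: has_field_derivative_def)
  from has_derivative_compose[OF has_derivative_mult_right[OF bounded_linear.has_derivative[OF bounded_linear_of_real angle[OF z]]] this]
  show ?thesis
      unfolding E_def cis_conv_exp by (simp add: scaleR_conv_of_real mult_ac)
qed

text \<open>The factor \<open>n\<close> contributes the real part of the logarithmic derivative and
  \<open>E\<close> the imaginary part; the factor 1/2 in \<open>angle\<close> is what makes them fit
  into one complex expression.\<close>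

lemma nE_deriv:
  assumes z: "z \<in> upper_half_plane"
  shows "((\<lambda>z. n z * E z) has_derivative
     (\<lambda>v. n z * E z * (\<i>/2) * (f' z v / Im (f z) - cnj v / Im z))) (at z)"
proof -
  note E' = E_deriv[OF z]
  have n': "((\<lambda>z. complex_of_real (n z)) has_derivative (\<lambda>v. complex_of_real (- (n z / 2) * (Im (f' z v) / Im (f z) + Im v / Im z)))) (at z)"
    by (rule bounded_linear.has_derivative[OF bounded_linear_of_real n_deriv[OF z]])
  show ?thesis
  proof (rule has_derivative_eq_rhs[OF has_derivative_mult[OF n' E']], rule ext)
    fix v
    define p r where "p = f' z v / Im (f z)" and "r = cnj v / Im z"
    have *: "Im (f' z v) / Im (f z) = Im p" "Re (f' z v) / Im (f z) = Re p" "Im v / Im z = - Im r" "Re v / Im z = Re r"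
      by (simp_all add: p_def r_def)
    show "complex_of_real (n z) * (((Re (f' z v) / Im (f z) - Re v / Im z) / 2) *\<^sub>R (\<i> * E z)) +
       complex_of_real (- (n z / 2) * (Im (f' z v) / Im (f z) + Im v / Im z)) * E z =
       n z * E z * (\<i>/2) * (f' z v / Im (f z) - cnj v / Im z)"
      unfolding * p_def[symmetric] r_def[symmetric]
      by (simp add: complex_eq_iff field_simps)
  qed
qed

lemma imv_has_derivative:
  assumes k: "(k has_derivative k') (at z)"
    and kw: "((\<lambda>z. k z * w z) has_derivative kw') (at z)"
    and kb: "((\<lambda>z. k z * b z) has_derivative kb') (at z)"
    and kwb: "((\<lambda>z. k z * w z * b z) has_derivative kwb') (at z)"
  shows "((\<lambda>z. imv (k z) (w z) (b z)) has_derivative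
     (\<lambda>v. (Im (k' v), Im (kw' v), Im (kb' v), Im (kwb' v)))) (at z)"
  unfolding imv_def
  by (intro has_derivative_Pair bounded_linear.has_derivative[OF bounded_linear_Im] assms)

text \<open>Because \<open>2 * \<i> * Im (f z) = f z - cnj (f z)\<close>, and likewise for
  \<open>z\<close>, the differential of the null vector combines those with parameters
  \<open>(cnj (f z), cnj z)\<close> and \<open>(f z, z)\<close>. Under the imaginary part the first
  may be conjugated up to sign, and both merge into a tangent vector with coefficient
  \<open>\<beta>\<close>.\<close>

lemma S_deriv:
  assumes z: "z \<in> upper_half_plane"
  shows "(S has_derivative (\<lambda>v. imv (\<beta> z v * n z) (f z) z)) (at z)"
proof -
  have cn: "((\<lambda>z. cnj z) has_derivative cnj) (at z)"
    by (rule bounded_linear.has_derivative[OF bounded_linear_cnj has_derivative_ident])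
  note d1 = nE_deriv[OF z]
  note d2 = has_derivative_mult[OF d1 deriv[OF z]]
  note d3 = has_derivative_mult[OF d1 cn]
  note d4 = has_derivative_mult[OF d2 cn]
  have key: "Im (n z * E z * (\<i>/2) * (q1 * (f' z v / Im (f z)) - q2 * (cnj v / Im z))) = Im (\<beta> z v * n z * q2)"
    if "q1 = cnj q2" for q1 q2 v
    unfolding that \<beta>_def by (simp add: field_simps)
  have pos: "Im (f z) \<noteq> 0" "Im z \<noteq> 0" using Im_pos[OF z] by auto
  show ?thesis
    unfolding S_def
  proof (rule has_derivative_eq_rhs[OF imv_has_derivative[OF d1 d2 d3 d4]], rule ext)
    fix v
    define p r where "p = f' z v / Im (f z)" and "r = cnj v / Im z"
    have f'v: "f' z v = p * Im (f z)" and cv: "cnj v = r * Im z" using pos by (simp_all add: p_def r_def)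
    let ?K = "n z * E z * (\<i>/2)"
    have e2: "n z * E z * f' z v + ?K * (f' z v / Im (f z) - cnj v / Im z) * f z
       = ?K * (cnj (f z) * (f' z v / Im (f z)) - f z * (cnj v / Im z))"
      unfolding p_def[symmetric] r_def[symmetric] unfolding f'v by (simp add: complex_eq_iff field_simps)
    have e3: "n z * E z * cnj v + ?K * (f' z v / Im (f z) - cnj v / Im z) * cnj z
       = ?K * (cnj z * (f' z v / Im (f z)) - z * (cnj v / Im z))"
      unfolding p_def[symmetric] r_def[symmetric] unfolding cv by (simp add: complex_eq_iff field_simps)
    have e4: "n z * E z * f z * cnj v + (n z * E z * f' z v + ?K * (f' z v / Im (f z) - cnj v / Im z) * f z) * cnj z
       = ?K * (cnj (f z * z) * (f' z v / Im (f z)) - (f z * z) * (cnj v / Im z))"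
      unfolding e2 unfolding p_def[symmetric] r_def[symmetric] unfolding cv by (simp add: complex_eq_iff field_simps)
    show "(Im (?K * (f' z v / Im (f z) - cnj v / Im z)),
       Im (n z * E z * f' z v + ?K * (f' z v / Im (f z) - cnj v / Im z) * f z),
       Im (n z * E z * cnj v + ?K * (f' z v / Im (f z) - cnj v / Im z) * cnj z),
       Im (n z * E z * f z * cnj v + (n z * E z * f' z v + ?K * (f' z v / Im (f z) - cnj v / Im z) * f z) * cnj z))
      = imv (\<beta> z v * n z) (f z) z"
      unfolding e4 unfolding e2 e3 imv_def prod.inject
      using key[of 1 1 v, OF complex_cnj_one[symmetric], unfolded mult_1_left mult_1_right]
        key[of "cnj (f z)" "f z" v, OF refl] key[of "cnj z" z v, OF refl] key[of "cnj (f z * z)" "f z * z" v, OF refl]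
      by (simp only: mult.assoc simp_thms)
  qed
qed

section \<open>Algebra of the two forms: trace condition and nondegeneracy\<close>

lemma form_cnj:
  assumes z: "z \<in> upper_half_plane"
  shows "cnj (E z) * cnj (f' z v) = - of_real (\<rho> z) * E z * cnj v + cnj (E z) * cnj (c z) * v"
proof -
  have "cnj (E z) * cnj (cis (- 2 * \<theta> z)) = E z"
    by (simp add: E_def cis_cnj cis_mult)
  then show ?thesis
    unfolding form[OF z] by (simp add: algebra_simps)
qed

text \<open>
  The differential of \<open>S\<close> is given by \<open>\<beta>\<close> and that of the unit normal \<open>N\<close> by \<open>-i\<gamma>\<close>; the shape
  operator is therefore traceless.
\<close>

lemma \<gamma>_antilinear:
  assumes z: "z \<in> upper_half_plane"
  obtains g :: complex where "\<And>v. \<gamma> z v = g * cnj (\<beta> z v)"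
proof -
  define x where "x = 1 / Im z"
  define r where "r = \<rho> z / Im (f z)"
  define k where "k = c z / Im (f z)"
  have pos: "Im z > 0" "Im (f z) > 0" using Im_pos[OF z] by auto
  have x0: "x > 0" and r0: "r > 0" using pos rho_pos[OF z] by (simp_all add: x_def r_def)
  have "r\<^sup>2 = (cmod k)\<^sup>2 + x\<^sup>2"
    using rho_sq[OF z] pos unfolding r_def k_def x_def by (simp add: norm_divide power_divide field_simps)
  \<comment> \<open>Area preservation, in the form \<open>rho_sq\<close>, factors the squared
    modulus of the antilinear coefficient; this is the relation that makes \<open>\<gamma>\<close> a
    multiple of the conjugate of \<open>\<beta>\<close>.\<close>
  then have kk: "k * cnj k = of_real ((r + x) * (r - x))"
    by (simp add: complex_norm_square[symmetric] algebra_simps power2_eq_square del: of_real_add of_real_mult flip: of_real_power)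
  have \<beta>: "\<beta> z v = \<i>/2 * (- of_real (r + x) * E z * cnj v + cnj (E z) * cnj k * v)" for v
    unfolding \<beta>_def form_cnj[OF z] r_def k_def x_def by (simp add: algebra_simps diff_divide_distrib add_divide_distrib)
  have \<gamma>: "\<gamma> z v = \<i>/2 * (- of_real (r - x) * E z * cnj v + cnj (E z) * cnj k * v)" for v
    unfolding \<gamma>_def form_cnj[OF z] r_def k_def x_def by (simp add: algebra_simps diff_divide_distrib add_divide_distrib)
  have "\<gamma> z v = cnj k / of_real (r + x) * cnj (\<beta> z v)" for v
  proof -
    have rx: "complex_of_real (r + x) \<noteq> 0" using r0 x0 by (simp flip: of_real_add)
    have "of_real (r + x) * \<gamma> z v = cnj k * cnj (\<beta> z v)"
    proof -
      have "cnj k * cnj (\<beta> z v) = \<i>/2 * (of_real (r+x) * cnj (E z) * cnj k * v - (k * cnj k) * E z * cnj v)"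
        unfolding \<beta> by (simp add: algebra_simps)
      also have "\<dots> = of_real (r+x) * \<gamma> z v"
        unfolding \<gamma> kk by (simp add: field_simps)
      finally show ?thesis by simp
    qed
    then show ?thesis using rx by (metis nonzero_mult_div_cancel_left times_divide_eq_left)
  qed
  then show ?thesis using that by blast
qed

text \<open>In \<open>\<beta>\<close> the coefficient of \<open>cnj v\<close> has modulus
  \<open>(\<rho> / Im f + 1 / Im z) / 2\<close> and that of \<open>v\<close> at most
  \<open>\<rho> / Im f / 2\<close>; the gap survives. So the induced metric of the surface dominates
  half the hyperbolic length, which is the source of completeness.\<close>

lemma \<beta>_lower:
  assumes z: "z \<in> upper_half_plane"
  shows "cmod v / (2 * Im z) \<le> cmod (\<beta> z v)"
proof -
  have pos: "Im z > 0" "Im (f z) > 0" using Im_pos[OF z] by auto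
  have cr: "cmod (c z) \<le> \<rho> z"
    by (rule power2_le_imp_le) (simp_all add: rho_sq[OF z] less_imp_le[OF rho_pos[OF z]])
  define A where "A = of_real (\<rho> z / Im (f z) + 1 / Im z) * E z * cnj v"
  define B where "B = cnj (E z) * cnj (c z) * v / Im (f z)"
  have "\<beta> z v = \<i>/2 * (B - A)"
    unfolding \<beta>_def form_cnj[OF z] A_def B_def by (simp add: algebra_simps diff_divide_distrib add_divide_distrib)
  then have "cmod (\<beta> z v) = cmod (A - B) / 2"
    using norm_minus_commute[of A B] by (simp add: norm_mult norm_divide del: eq_divide_eq_numeral1)
  moreover have "cmod (A - B) \<ge> cmod A - cmod B" by (rule norm_triangle_ineq2)
  moreover have "cmod A = (\<rho> z / Im (f z) + 1 / Im z) * cmod v"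
    unfolding A_def norm_mult norm_of_real using pos rho_pos[OF z] by (simp add: abs_of_pos add_pos_pos)
  moreover have "cmod B = cmod (c z) / Im (f z) * cmod v"
    unfolding B_def using pos by (simp add: norm_mult norm_divide)
  moreover have "cmod (c z) / Im (f z) * cmod v \<le> \<rho> z / Im (f z) * cmod v"
    using cr pos by (intro mult_right_mono divide_right_mono) auto
  ultimately show ?thesis by (simp add: algebra_simps)
qed

lemma \<beta>_linear: "z \<in> upper_half_plane \<Longrightarrow> linear (\<beta> z)"
proof (rule linearI)
  assume z: "z \<in> upper_half_plane"
  show "\<beta> z (v + w) = \<beta> z v + \<beta> z w" for v w
    unfolding \<beta>_def linear_add[OF f'_lin[OF z]] by (simp add: algebra_simps add_divide_distrib)
  show "\<beta> z (r *\<^sub>R v) = r *\<^sub>R \<beta> z v" for r v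
    unfolding \<beta>_def linear_scale[OF f'_lin[OF z]] by (simp add: algebra_simps scaleR_conv_of_real)
qed

lemma \<beta>_surj:
  fixes \<omega> :: complex
  assumes z: "z \<in> upper_half_plane"
  obtains v where "\<beta> z v = \<omega>"
proof (rule inj_linear_inverse[OF \<beta>_linear[OF z]])
  fix v assume "\<beta> z v = 0"
  then show "v = 0" using \<beta>_lower[OF z, of v] Im_pos[OF z] by (simp add: divide_le_0_iff)
next
  fix B assume "\<beta> z \<circ> B = id"
  then show thesis using that by (metis comp_apply id_apply)
qed

text \<open>One computation for the four coordinates of the null vector: \<open>q\<close> is in turn
  \<open>1\<close>, \<open>w\<close>, \<open>b\<close> and \<open>w * b\<close>, and
  \<open>q'_eq\<close> writes its derivative with increments towards the conjugate parameters. The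
  terms with \<open>\<gamma>\<close> and \<open>\<beta>\<close> carry the part of the derivative
  that leaves the tangent plane.\<close>

lemma n_f_deriv:
  fixes q :: "complex \<Rightarrow> complex \<Rightarrow> complex" and q' :: "complex \<Rightarrow> complex"
  assumes z: "z \<in> upper_half_plane"
    and q: "((\<lambda>z. q (f z) z) has_derivative q') (at z)"
    and q'_eq: "\<And>v :: complex. q' v = \<i>/2 * ((q (cnj (f z)) z - q (f z) z) * (f' z v / Im (f z)) + (q (f z) (cnj z) - q (f z) z) * (v / Im z))"
    and qc: "q (cnj (f z)) z = cnj (q (f z) (cnj z))"
  shows "((\<lambda>z. n z * q (f z) z) has_derivative (\<lambda>v.
     - \<i>/2 * (n z * q (f z) z) * (Re (f' z v) / Im (f z) + Re v / Im z)
     - Re (n z * E z * q (f z) (cnj z)) * cnj (\<gamma> z v) + \<i> * Im (n z * E z * q (f z) (cnj z)) * cnj (\<beta> z v))) (at z)"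
proof -
  have n': "((\<lambda>z. complex_of_real (n z)) has_derivative (\<lambda>v. complex_of_real (- (n z / 2) * (Im (f' z v) / Im (f z) + Im v / Im z)))) (at z)"
    by (rule bounded_linear.has_derivative[OF bounded_linear_of_real n_deriv[OF z]])
  show ?thesis
  proof (rule has_derivative_eq_rhs[OF has_derivative_mult[OF n' q]], rule ext)
    fix v :: complex
    define p r A where "p = f' z v / Im (f z)" and "r = v / Im z" and "A = n z * E z * q (f z) (cnj z)"
    have *: "Im (f' z v) / Im (f z) = Im p" "Re (f' z v) / Im (f z) = Re p" "Im v / Im z = Im r" "Re v / Im z = Re r"
      by (simp_all add: p_def r_def)
    have "- Re A * cnj (\<gamma> z v) + \<i> * Im A * cnj (\<beta> z v) = \<i>/2 * (E z * cnj A * p + cnj (E z) * A * r)"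
    proof -
      have "cnj (\<gamma> z v) = - \<i>/2 * (E z * p + cnj (E z) * r)" "cnj (\<beta> z v) = - \<i>/2 * (E z * p - cnj (E z) * r)"
        unfolding \<gamma>_def \<beta>_def p_def r_def by simp_all
      then show ?thesis by (simp only:) (simp add: complex_eq_iff field_simps)
    qed
    also have "E z * cnj A = n z * cnj (q (f z) (cnj z))"
      unfolding A_def using E_cnj(1)[of z] by (simp add: mult.assoc mult.left_commute)
    also have "cnj (E z) * A = n z * q (f z) (cnj z)"
      unfolding A_def using E_cnj(2)[of z] by (simp add: mult.assoc mult.left_commute)
    finally have 1: "- Re A * cnj (\<gamma> z v) + \<i> * Im A * cnj (\<beta> z v) = \<i>/2 * (n z * cnj (q (f z) (cnj z)) * p + n z * q (f z) (cnj z) * r)" .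
    show "complex_of_real (n z) * q' v + complex_of_real (- (n z / 2) * (Im (f' z v) / Im (f z) + Im v / Im z)) * q (f z) z =
      - \<i>/2 * (n z * q (f z) z) * (Re (f' z v) / Im (f z) + Re v / Im z)
     - Re (n z * E z * q (f z) (cnj z)) * cnj (\<gamma> z v) + \<i> * Im (n z * E z * q (f z) (cnj z)) * cnj (\<beta> z v)"
    proof -
      have "- \<i>/2 * (n z * q (f z) z) * (Re p + Re r) - Re A * cnj (\<gamma> z v) + \<i> * Im A * cnj (\<beta> z v)
        = - \<i>/2 * (n z * q (f z) z) * (Re p + Re r) + (\<i>/2 * (n z * cnj (q (f z) (cnj z)) * p + n z * q (f z) (cnj z) * r))"
        using 1 by (simp add: algebra_simps)
      also have "\<dots> = n z * (\<i>/2 * ((cnj (q (f z) (cnj z)) - q (f z) z) * p + (q (f z) (cnj z) - q (f z) z) * r))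
          + complex_of_real (- (n z / 2) * (Im p + Im r)) * q (f z) z"
        by (simp add: complex_eq_iff field_simps)
      finally show ?thesis
        unfolding A_def[symmetric] q'_eq * p_def[symmetric] r_def[symmetric] qc by (rule sym)
    qed
  qed
qed

lemma \<beta>_deriv:
  fixes v :: complex
  assumes z: "z \<in> upper_half_plane"
  obtains D where "((\<lambda>w. \<beta> w v) has_derivative D) (at z)"
proof -
  obtain D where D: "((\<lambda>w. f' w v) has_derivative D) (at z)"
    using deriv2[OF z] unfolding differentiable_def by blast
  note cE = bounded_linear.has_derivative[OF bounded_linear_cnj E_deriv[OF z]]
  note cf = bounded_linear.has_derivative[OF bounded_linear_cnj D]
  note imf = bounded_linear.has_derivative[OF bounded_linear_of_real bounded_linear.has_derivative[OF bounded_linear_Im deriv[OF z]]]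
  note imz = bounded_linear.has_derivative[OF bounded_linear_of_real bounded_linear.has_derivative[OF bounded_linear_Im has_derivative_ident]]
  have "complex_of_real (Im (f z)) \<noteq> 0" "complex_of_real (Im z) \<noteq> 0"
    using Im_pos[OF z] by auto
  from has_derivative_mult_right[OF has_derivative_diff[OF has_derivative_divide[OF has_derivative_mult[OF cE cf] imf this(1)]
    has_derivative_divide[OF has_derivative_mult[OF E_deriv[OF z] has_derivative_const[of "cnj v"]] imz this(2)]], of "\<i>/2"]
  show ?thesis by (rule that[unfolded \<beta>_def])
qed

text \<open>This is the Gauss formula: the second derivative splits into the position vector with
  the squared length of the tangent vector, the normal with the second fundamental form, and a
  tangent vector left unspecified as \<open>\<omega>\<close>.\<close>

lemma dS_deriv:
  fixes v :: complex
  assumes z: "z \<in> upper_half_plane"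
  obtains G and \<omega> :: complex where "((\<lambda>w. imv (\<beta> w v * n w) (f w) w) has_derivative G) (at z)"
    "G v = (cmod (\<beta> z v))\<^sup>2 *\<^sub>R S z - Im (cnj (\<gamma> z v) * \<beta> z v) *\<^sub>R N z + imv (\<omega> * n z) (f z) z"
proof -
  obtain D where D: "((\<lambda>w. \<beta> w v) has_derivative D) (at z)" using \<beta>_deriv[OF z] by blast
  define \<tau> where "\<tau> w = Re (f' z w) / Im (f z) + Re w / Im z" for w
  define T' where "T' T A w = - \<i>/2 * T * \<tau> w - Re A * cnj (\<gamma> z w) + \<i> * Im A * cnj (\<beta> z w)" for T A :: complex and w
  have pos: "Im (f z) \<noteq> 0" "Im z \<noteq> 0" using Im_pos[OF z] by auto
  have fc: "2 * \<i> * complex_of_real (Im (f z)) = f z - cnj (f z)" "2 * \<i> * complex_of_real (Im z) = z - cnj z"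
    by (simp_all add: complex_eq_iff)
  have df: "f' z w = \<i>/2 * ((cnj (f z) - f z) * (f' z w / Im (f z)))" for w
  proof -
    have "\<i>/2 * ((cnj (f z) - f z) * (f' z w / Im (f z))) = \<i>/2 * (- (2 * \<i> * complex_of_real (Im (f z))) * (f' z w / Im (f z)))"
      unfolding fc by simp
    then show ?thesis using pos by simp
  qed
  have dz: "w = \<i>/2 * ((cnj z - z) * (w / Im z))" for w :: complex
  proof -
    have "\<i>/2 * ((cnj z - z) * (w / Im z)) = \<i>/2 * (- (2 * \<i> * complex_of_real (Im z)) * (w / Im z))"
      unfolding fc by simp
    then show ?thesis using pos by simp
  qed
  have d0: "((\<lambda>z. complex_of_real (n z) * 1) has_derivative T' (complex_of_real (n z) * 1) (n z * E z * 1)) (at z)"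
    unfolding T'_def \<tau>_def
    by (rule n_f_deriv[OF z, of "\<lambda>w b. 1" "\<lambda>_. 0"]) auto
  have d1: "((\<lambda>z. n z * f z) has_derivative T' (n z * f z) (n z * E z * f z)) (at z)"
    unfolding T'_def \<tau>_def
    by (rule n_f_deriv[OF z, of "\<lambda>w b. w" "f' z"]) (use deriv[OF z] df in auto)
  have d2: "((\<lambda>z. n z * z) has_derivative T' (n z * z) (n z * E z * cnj z)) (at z)"
    unfolding T'_def \<tau>_def
    by (rule n_f_deriv[OF z, of "\<lambda>w b. b" "\<lambda>v. v"]) (use dz in auto)
  have d3: "((\<lambda>z. n z * (f z * z)) has_derivative T' (n z * (f z * z)) (n z * E z * (f z * cnj z))) (at z)"
    unfolding T'_def \<tau>_def
  proof (rule n_f_deriv[OF z, of "\<lambda>w b. w * b" "\<lambda>v. f z * v + f' z v * z"])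
    show "((\<lambda>z. f z * z) has_derivative (\<lambda>v. f z * v + f' z v * z)) (at z)"
      by (rule has_derivative_mult[OF deriv[OF z] has_derivative_ident])
    show "f z * v + f' z v * z = \<i>/2 * ((cnj (f z) * z - f z * z) * (f' z v / Im (f z)) + (f z * cnj z - f z * z) * (v / Im z))" for v
    proof -
      have "\<i>/2 * ((cnj (f z) * z - f z * z) * (f' z v / Im (f z)) + (f z * cnj z - f z * z) * (v / Im z))
        = z * (\<i>/2 * ((cnj (f z) - f z) * (f' z v / Im (f z)))) + f z * (\<i>/2 * ((cnj z - z) * (v / Im z)))"
        by (simp only: algebra_simps)
      then show ?thesis unfolding df[symmetric] dz[symmetric] by simp
    qed
  qed simp
  define \<omega> where "\<omega> = D v - \<i>/2 * \<tau> v * \<beta> z v"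
  have comp: "Im (\<beta> z v * T' T A v + D v * T) = (cmod (\<beta> z v))\<^sup>2 * Im A - Im (cnj (\<gamma> z v) * \<beta> z v) * Re A + Im (\<omega> * T)" for T A
  proof -
    have "\<beta> z v * T' T A v + D v * T = \<omega> * T - Re A * (cnj (\<gamma> z v) * \<beta> z v) + \<i> * Im A * (\<beta> z v * cnj (\<beta> z v))"
      unfolding T'_def \<omega>_def by (simp add: algebra_simps)
    also have "\<beta> z v * cnj (\<beta> z v) = of_real ((cmod (\<beta> z v))\<^sup>2)"
      by (simp add: complex_norm_square[symmetric])
    finally show ?thesis by simp
  qed
  define G where "G w = (Im (\<beta> z v * T' (complex_of_real (n z) * 1) (n z * E z * 1) w + D w * (complex_of_real (n z) * 1)),
      Im (\<beta> z v * T' (n z * f z) (n z * E z * f z) w + D w * (n z * f z)),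
      Im (\<beta> z v * T' (n z * z) (n z * E z * cnj z) w + D w * (n z * z)),
      Im (\<beta> z v * T' (n z * (f z * z)) (n z * E z * (f z * cnj z)) w + D w * (n z * (f z * z))))" for w
  show ?thesis
  proof (rule that[of G \<omega>])
    have eq: "(\<lambda>w::complex. imv (\<beta> w v * n w) (f w) w) = (\<lambda>w::complex. (Im (\<beta> w v * (complex_of_real (n w) * 1)), Im (\<beta> w v * (n w * f w)),
        Im (\<beta> w v * (n w * w)), Im (\<beta> w v * (n w * (f w * w)))))"
      unfolding imv_def by (simp only: mult.assoc mult_1_right)
    show "((\<lambda>w. imv (\<beta> w v * n w) (f w) w) has_derivative G) (at z)"
      unfolding eq G_def
      by (intro has_derivative_Pair bounded_linear.has_derivative[OF bounded_linear_Im]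
          has_derivative_mult[OF D d0] has_derivative_mult[OF D d1] has_derivative_mult[OF D d2] has_derivative_mult[OF D d3])
    show "G v = (cmod (\<beta> z v))\<^sup>2 *\<^sub>R S z - Im (cnj (\<gamma> z v) * \<beta> z v) *\<^sub>R N z + imv (\<omega> * n z) (f z) z"
      unfolding G_def comp S_def N_def imv_def
      by (simp add: mult.assoc)
  qed
qed

text \<open>\<open>null\<close> and \<open>unit\<close> say that the two directions form an
  orthonormal frame of the induced metric. By \<open>\<gamma>_antilinear\<close> the normal parts
  add up to a multiple of the vanishing sum of squares: the surface is maximal, and its Laplacian is
  twice the position vector up to tangent vectors.\<close>

lemma frame_trace:
  fixes e1 e2 :: complex
  assumes z: "z \<in> upper_half_plane"
    and null: "(\<beta> z e1)\<^sup>2 + (\<beta> z e2)\<^sup>2 = 0" and unit: "(cmod (\<beta> z e1))\<^sup>2 + (cmod (\<beta> z e2))\<^sup>2 = 2"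
  obtains G1 G2 and W :: complex where "((\<lambda>w. imv (\<beta> w e1 * n w) (f w) w) has_derivative G1) (at z)"
    "((\<lambda>w. imv (\<beta> w e2 * n w) (f w) w) has_derivative G2) (at z)"
    "G1 e1 + G2 e2 = 2 *\<^sub>R S z + imv (\<beta> z W * n z) (f z) z"
proof -
  obtain g where g: "\<And>v. \<gamma> z v = g * cnj (\<beta> z v)" using \<gamma>_antilinear[OF z] by blast
  obtain G1 and \<omega>1 :: complex where G1: "((\<lambda>w. imv (\<beta> w e1 * n w) (f w) w) has_derivative G1) (at z)"
    "G1 e1 = (cmod (\<beta> z e1))\<^sup>2 *\<^sub>R S z - Im (cnj (\<gamma> z e1) * \<beta> z e1) *\<^sub>R N z + imv (\<omega>1 * n z) (f z) z"
    using dS_deriv[OF z] by blast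
  obtain G2 and \<omega>2 :: complex where G2: "((\<lambda>w. imv (\<beta> w e2 * n w) (f w) w) has_derivative G2) (at z)"
    "G2 e2 = (cmod (\<beta> z e2))\<^sup>2 *\<^sub>R S z - Im (cnj (\<gamma> z e2) * \<beta> z e2) *\<^sub>R N z + imv (\<omega>2 * n z) (f z) z"
    using dS_deriv[OF z] by blast
  obtain W where W: "\<beta> z W = \<omega>1 + \<omega>2" using \<beta>_surj[OF z] by blast
  have "cnj (\<gamma> z e1) * \<beta> z e1 + cnj (\<gamma> z e2) * \<beta> z e2 = cnj g * ((\<beta> z e1)\<^sup>2 + (\<beta> z e2)\<^sup>2)"
    unfolding g by (simp add: algebra_simps power2_eq_square)
  then have im: "Im (cnj (\<gamma> z e1) * \<beta> z e1) + Im (cnj (\<gamma> z e2) * \<beta> z e2) = 0"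
    using null by (metis mult_zero_right plus_complex.sel(2) zero_complex.sel(2))
  have "G1 e1 + G2 e2 = ((cmod (\<beta> z e1))\<^sup>2 + (cmod (\<beta> z e2))\<^sup>2) *\<^sub>R S z
     - (Im (cnj (\<gamma> z e1) * \<beta> z e1) + Im (cnj (\<gamma> z e2) * \<beta> z e2)) *\<^sub>R N z + imv ((\<omega>1 + \<omega>2) * n z) (f z) z"
    unfolding G1(2) G2(2) by (simp only: imv_add distrib_right scaleR_add_left) (simp add: algebra_simps)
  then have "G1 e1 + G2 e2 = 2 *\<^sub>R S z + imv (\<beta> z W * n z) (f z) z"
    unfolding im unit W by simp
  then show ?thesis using that G1(1) G2(1) by blast
qed

end

section \<open>The isometries \<open>S z\<close> acting on the half-plane\<close>

definition mob :: "real \<times> real \<times> real \<times> real \<Rightarrow> complex \<Rightarrow> complex" where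
  "mob = (\<lambda>(a, b, c, d) z. (b * z - d) / (a * z - c))"

lemma mob_Pair: "mob (a, b, c, d) z = (b * z - d) / (a * z - c)"
  by (simp add: mob_def)

lemma Im_mob:
  assumes "ads (a, b, c, d) (a, b, c, d) = -1" "Im z > 0"
  shows "of_real a * z - of_real c \<noteq> 0" "Im (mob (a, b, c, d) z) = Im z / (cmod (a * z - c))\<^sup>2"
    "Im (mob (a, b, c, d) z) > 0"
proof -
  have det: "a * d - b * c = 1" using assms(1) by (simp add: algebra_simps)
  have im: "Im ((b * z - d) * cnj (a * z - c)) = Im z"
  proof -
    have "Im ((b * z - d) * cnj (a * z - c)) = Im z * (a * d - b * c)" by (simp add: algebra_simps)
    then show ?thesis using det by simp
  qed
  then show nz: "of_real a * z - of_real c \<noteq> 0" using assms(2) by (metis complex_cnj_zero less_irrefl mult_zero_right zero_complex.sel(2))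
  show *: "Im (mob (a, b, c, d) z) = Im z / (cmod (a * z - c))\<^sup>2"
    unfolding mob_Pair using im by (metis Im_complex_div_eq_0 Im_divide_of_real complex_div_cnj of_real_power)
  show "Im (mob (a, b, c, d) z) > 0" unfolding * using nz assms(2) by simp
qed

context conformal_ml begin

lemma mob_S_self:
  assumes z: "z \<in> upper_half_plane"
  shows "mob (S z) z = f z"
proof -
  have nz: "n z * E z * (z - cnj z) \<noteq> 0"
  proof -
    have "E z \<noteq> 0" using norm_E[of z] by force
    moreover have "z - cnj z \<noteq> 0" using Im_pos(1)[OF z] by (simp add: complex_eq_iff)
    ultimately show ?thesis using n_pos[OF z] by simp
  qed
  have 1: "Im k * z - Im (k * cnj z) = k * (z - cnj z) / (2 * \<i>)" for k
  proof -
    have "k * (z - cnj z) = 2 * \<i> * (Im k * z - Im (k * cnj z))" by (simp add: complex_eq_iff algebra_simps)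
    then show ?thesis by simp
  qed
  have "mob (S z) z = (n z * E z * f z * (z - cnj z) / (2 * \<i>)) / (n z * E z * (z - cnj z) / (2 * \<i>))"
    unfolding S_def imv_def mob_Pair 1 by simp
  also have "\<dots> = f z" using nz by (simp add: field_simps)
  finally show ?thesis .
qed

end

text \<open>The left side is the numerator of the derivative of \<open>mob\<close> at
  \<open>z0\<close> when the matrix moves along a tangent vector. Applied to \<open>z0\<close>, both
  matrices give combinations of the columns \<open>(f, 1)\<close> and \<open>(cnj f, 1)\<close>, so
  only the determinant \<open>f - cnj f\<close> of these remains.\<close>

lemma mob_wedge:
  fixes f k \<kappa> z z0 :: complex
  defines "a \<equiv> z0 - z" and "b \<equiv> z0 - cnj z"
  shows "(Im (\<kappa> * f) * z0 - Im (\<kappa> * f * z)) * (Im k * z0 - Im (k * cnj z))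
      - (Im (k * f) * z0 - Im (k * f * cnj z)) * (Im \<kappa> * z0 - Im (\<kappa> * z))
      = - (\<i>/2) * Im f * (k * cnj \<kappa> * b\<^sup>2 - \<kappa> * cnj k * a\<^sup>2)"
proof -
  have im: "complex_of_real (Im x) = (x - cnj x) / (2 * \<i>)" for x
    by (simp add: complex_eq_iff)
  have n: "Im (k * f) * z0 - Im (k * f * cnj z) = (k * f * b - cnj k * cnj f * a) / (2 * \<i>)"
    "Im k * z0 - Im (k * cnj z) = (k * b - cnj k * a) / (2 * \<i>)"
    "Im (\<kappa> * f) * z0 - Im (\<kappa> * f * z) = (\<kappa> * f * a - cnj \<kappa> * cnj f * b) / (2 * \<i>)"
    "Im \<kappa> * z0 - Im (\<kappa> * z) = (\<kappa> * a - cnj \<kappa> * b) / (2 * \<i>)"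
    unfolding im a_def b_def by (simp_all add: algebra_simps diff_divide_distrib add_divide_distrib)
  have "(\<kappa> * f * a - cnj \<kappa> * cnj f * b) * (k * b - cnj k * a) - (k * f * b - cnj k * cnj f * a) * (\<kappa> * a - cnj \<kappa> * b)
     = (f - cnj f) * (k * cnj \<kappa> * b\<^sup>2 - \<kappa> * cnj k * a\<^sup>2)"
    by (simp add: algebra_simps power2_eq_square)
  also have "f - cnj f = 2 * \<i> * Im f" by (simp add: complex_eq_iff)
  finally have m: "(\<kappa> * f * a - cnj \<kappa> * cnj f * b) * (k * b - cnj k * a) - (k * f * b - cnj k * cnj f * a) * (\<kappa> * a - cnj \<kappa> * b)
     = 2 * \<i> * Im f * (k * cnj \<kappa> * b\<^sup>2 - \<kappa> * cnj k * a\<^sup>2)" .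
  have d: "x / (2 * \<i>) * (y / (2 * \<i>)) - x' / (2 * \<i>) * (y' / (2 * \<i>)) = - (x * y - x' * y') / 4" for x y x' y'
    by (simp add: field_simps)
  show ?thesis unfolding n d m by (simp add: field_simps)
qed

context conformal_ml begin

lemma continuous_on_f: "continuous_on upper_half_plane f"
  using deriv has_derivative_continuous continuous_at_imp_continuous_on by blast

lemma continuous_on_S: "continuous_on upper_half_plane S"
  using S_deriv has_derivative_continuous continuous_at_imp_continuous_on by blast

lemma continuous_on_n: "continuous_on upper_half_plane n"
  using n_deriv has_derivative_continuous continuous_at_imp_continuous_on by blast

lemma continuous_on_\<beta>: "continuous_on upper_half_plane (\<lambda>w. \<beta> w v)"
  using \<beta>_deriv has_derivative_continuous continuous_at_imp_continuous_on by metis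

definition mS' :: "complex \<Rightarrow> complex \<Rightarrow> complex \<Rightarrow> complex" where "mS' z0 z v =
   (case S z of (a, b, c, d) \<Rightarrow> case imv (\<beta> z v * n z) (f z) z of (a', b', c', d') \<Rightarrow>
     ((of_real b' * z0 - of_real d') * (of_real a * z0 - of_real c) -
      (of_real b * z0 - of_real d) * (of_real a' * z0 - of_real c')) / (of_real a * z0 - of_real c)\<^sup>2)"

text \<open>Its purpose is that exactly one isometry of the surface takes \<open>z0\<close> to a
  given point. Expansion holds because the moduli of the two terms in \<open>mob_wedge\<close>
  differ by a multiple of \<open>|z0 - cnj z|^2 - |z0 - z|^2 = 4 * Im z * Im z0\<close>, after which
  \<open>\<beta>_lower\<close> applies.\<close>

lemma mob_S_expanding:
  fixes z0 :: complex
  assumes z0: "z0 \<in> upper_half_plane"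
  shows "uhp_expanding (\<lambda>z. mob (S z) z0) (mS' z0)"
proof
  fix z :: complex and v :: complex assume z: "z \<in> upper_half_plane"
  obtain a b c d where S: "S z = (a, b, c, d)" by (cases "S z")
  obtain a' b' c' d' where S': "imv (\<beta> z v * n z) (f z) z = (a', b', c', d')" by (cases "imv (\<beta> z v * n z) (f z) z")
  have one: "ads (a, b, c, d) (a, b, c, d) = -1" using ads_S_S[OF z] S by simp
  have y0: "Im z0 > 0" using z0 by (simp add: uhp_iff)
  note I = Im_mob[OF one y0]
  show "mob (S z) z0 \<in> upper_half_plane" using I(3) by (simp add: S uhp_iff)
  have num: "(b' * z0 - d') * (a * z0 - c) - (b * z0 - d) * (a' * z0 - c') =
     - (\<i>/2) * Im (f z) * ((n z * E z) * cnj (\<beta> z v * n z) * (z0 - cnj z)\<^sup>2 - (\<beta> z v * n z) * cnj (n z * E z) * (z0 - z)\<^sup>2)"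
    using S S' unfolding S_def imv_def prod.inject
    by (metis mob_wedge)
  show "cmod v / Im z \<le> cmod (mS' z0 z v) / Im (mob (S z) z0)"
  proof -
    have sq: "(cmod (z0 - cnj z))\<^sup>2 - (cmod (z0 - z))\<^sup>2 = 4 * Im z * Im z0"
      unfolding cmod_power2 by (simp add: power2_eq_square algebra_simps)
    have "2 * cmod (\<beta> z v) * Im z0 = Im (f z) / 2 * (n z * n z * cmod (\<beta> z v) * ((cmod (z0 - cnj z))\<^sup>2 - (cmod (z0 - z))\<^sup>2))"
    proof -
      have "Im (f z) / 2 * (n z * n z * cmod (\<beta> z v) * (4 * Im z * Im z0)) = (n z * n z * (Im (f z) * Im z)) * (2 * cmod (\<beta> z v) * Im z0)"
        by (simp add: algebra_simps)
      then show ?thesis unfolding sq by (simp only: n_sq[OF z] mult_1_left)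
    qed
    also have "\<dots> = Im (f z) / 2 * (cmod ((n z * E z) * cnj (\<beta> z v * n z) * (z0 - cnj z)\<^sup>2) - cmod ((\<beta> z v * n z) * cnj (n z * E z) * (z0 - z)\<^sup>2))"
      using n_pos[OF z] by (simp add: norm_mult norm_power algebra_simps)
    also have "\<dots> \<le> Im (f z) / 2 * cmod ((n z * E z) * cnj (\<beta> z v * n z) * (z0 - cnj z)\<^sup>2 - (\<beta> z v * n z) * cnj (n z * E z) * (z0 - z)\<^sup>2)"
      using Im_pos[OF z] by (intro mult_left_mono norm_triangle_ineq2) auto
    also have "\<dots> = cmod ((b' * z0 - d') * (a * z0 - c) - (b * z0 - d) * (a' * z0 - c'))"
      unfolding num using Im_pos[OF z] by (simp add: norm_mult norm_divide)
    finally have *: "2 * cmod (\<beta> z v) * Im z0 \<le> cmod ((b' * z0 - d') * (a * z0 - c) - (b * z0 - d) * (a' * z0 - c'))" .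
    have "cmod v / Im z \<le> 2 * cmod (\<beta> z v)"
      using \<beta>_lower[OF z, of v] by simp
    also have "\<dots> \<le> cmod ((b' * z0 - d') * (a * z0 - c) - (b * z0 - d) * (a' * z0 - c')) / Im z0"
      using * y0 by (simp add: pos_le_divide_eq)
    also have "\<dots> = cmod (mS' z0 z v) / Im (mob (S z) z0)"
      unfolding mS'_def S S' using I(1,2) by (simp add: norm_divide norm_power)
    finally show ?thesis .
  qed
next
  fix z :: complex assume z: "z \<in> upper_half_plane"
  obtain a b c d where S: "S z = (a, b, c, d)" by (cases "S z")
  have one: "ads (a, b, c, d) (a, b, c, d) = -1" using ads_S_S[OF z] S by simp
  have y0: "Im z0 > 0" using z0 by (simp add: uhp_iff)
  have nz: "of_real (fst (S z)) * z0 - of_real (fst (snd (snd (S z)))) \<noteq> 0"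
    using Im_mob(1)[OF one y0] S by simp
  note d0 = has_derivative_fst[OF S_deriv[OF z]]
  note ds = has_derivative_snd[OF S_deriv[OF z]]
  note d1 = has_derivative_fst[OF ds]
  note dss = has_derivative_snd[OF ds]
  note d2 = has_derivative_fst[OF dss]
  note d3 = has_derivative_snd[OF dss]
  note c = bounded_linear.has_derivative[OF bounded_linear_of_real]
  note num = has_derivative_diff[OF has_derivative_mult_left[OF c[OF d1], of z0] c[OF d3]]
  note den = has_derivative_diff[OF has_derivative_mult_left[OF c[OF d0], of z0] c[OF d2]]
  have mobc: "mob p w = (of_real (fst (snd p)) * w - of_real (snd (snd (snd p)))) / (of_real (fst p) * w - of_real (fst (snd (snd p))))" for p w
    by (cases p) (simp add: mob_Pair)
  show "((\<lambda>z. mob (S z) z0) has_derivative mS' z0 z) (at z)"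
    unfolding mobc
  proof (rule has_derivative_eq_rhs[OF has_derivative_divide'[OF num den nz]], rule ext)
    fix v :: complex
    obtain a' b' c' d' where S': "imv (\<beta> z v * n z) (f z) z = (a', b', c', d')" by (cases "imv (\<beta> z v * n z) (f z) z")
    show "((of_real (fst (snd (imv (\<beta> z v * n z) (f z) z))) * z0 - of_real (snd (snd (snd (imv (\<beta> z v * n z) (f z) z))))) *
        (of_real (fst (S z)) * z0 - of_real (fst (snd (snd (S z))))) -
       (of_real (fst (snd (S z))) * z0 - of_real (snd (snd (snd (S z))))) *
        (of_real (fst (imv (\<beta> z v * n z) (f z) z)) * z0 - of_real (fst (snd (snd (imv (\<beta> z v * n z) (f z) z)))))) /
      ((of_real (fst (S z)) * z0 - of_real (fst (snd (snd (S z))))) * (of_real (fst (S z)) * z0 - of_real (fst (snd (snd (S z)))))) = mS' z0 z v"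
      unfolding S S' mS'_def by (simp add: power2_eq_square)
  qed
next
  fix v :: complex
  have nz: "of_real (fst (S z)) * z0 - of_real (fst (snd (snd (S z)))) \<noteq> 0" if "z \<in> upper_half_plane" for z
  proof -
    obtain a b c d where S: "S z = (a, b, c, d)" by (cases "S z")
    show ?thesis using Im_mob(1)[of a b c d z0] ads_S_S[OF that] S z0 by (simp add: uhp_iff)
  qed
  have eq: "mS' z0 z v =
      ((of_real (Im (\<beta> z v * n z * f z)) * z0 - of_real (Im (\<beta> z v * n z * f z * z))) *
        (of_real (fst (S z)) * z0 - of_real (fst (snd (snd (S z))))) -
       (of_real (fst (snd (S z))) * z0 - of_real (snd (snd (snd (S z))))) *
        (of_real (Im (\<beta> z v * n z)) * z0 - of_real (Im (\<beta> z v * n z * z)))) /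
      (of_real (fst (S z)) * z0 - of_real (fst (snd (snd (S z)))))\<^sup>2" for z :: complex
    by (simp add: mS'_def imv_def split: prod.split)
  show "continuous_on upper_half_plane (\<lambda>z. mS' z0 z v)"
    unfolding eq
    by (intro continuous_intros continuous_on_\<beta> continuous_on_n continuous_on_f continuous_on_S)
       (use nz in auto)
qed

end

section \<open>Pairing with the points of the surface\<close>

lemma ads_imv_right:
  "ads (a, b, c, d) (imv k w z) = Im (k * (b * z + c * w - d - a * w * z)) / 2"
  by (simp add: imv_def algebra_simps)

text \<open>A nonzero real matrix of determinant zero cannot send \<open>z\<close> to a point
  \<open>w\<close> off the real line. In terms of the form: the linear condition puts
  \<open>(a, b, c, d)\<close> in the negative definite normal plane at a point of the surface, which
  contains no nonzero null vector.\<close>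

lemma null_kernel:
  fixes z w :: complex and a b c d :: real
  assumes "0 < Im z" "0 < Im w" "b * c = a * d" "b * z + c * w - d - a * w * z = 0"
  shows "a = 0 \<and> b = 0 \<and> c = 0 \<and> d = 0"
proof -
  have eq: "b * z - d = w * (a * z - c)" using assms(4) by (simp add: algebra_simps)
  have "Im ((b * z - d) * cnj (a * z - c)) = Im z * (a * d - b * c)" by (simp add: algebra_simps)
  then have "Im (w * ((a * z - c) * cnj (a * z - c))) = 0"
    unfolding eq using assms(3) by (simp add: mult.assoc)
  moreover have "(a * z - c) * cnj (a * z - c) = of_real ((cmod (a * z - c))\<^sup>2)"
    by (simp only: complex_norm_square)
  ultimately have "Im (w * of_real ((cmod (a * z - c))\<^sup>2)) = 0" by (simp only:)
  then have "Im w * (cmod (a * z - c))\<^sup>2 = 0" by simp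
  then have az: "a * z - c = 0" using assms(2) by simp
  then have "Im (a * z - c) = 0" "Re (a * z - c) = 0" by simp_all
  then have ac: "a = 0" "c = 0" using assms(1) by auto
  then have "b * z - d = 0" using eq by simp
  then have "Im (b * z - d) = 0" "Re (b * z - d) = 0" by simp_all
  then show ?thesis using ac assms(1) by auto
qed

text \<open>The points where the two isometries agree are the roots of
  \<open>A * z\<^sup>2 + B * z + C\<close>, with discriminant \<open>4 * (t\<^sup>2 - 1)\<close>. Up
  to sign \<open>t\<close> is half the trace of the quotient isometry, and the condition says that
  the quotient is elliptic.\<close>

lemma mob_coincide:
  assumes p: "ads (a, b, c, d) (a, b, c, d) = -1" and p': "ads (a', b', c', d') (a', b', c', d') = -1"
    and less: "\<bar>ads (a, b, c, d) (a', b', c', d')\<bar> < 1"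
  obtains z where "z \<in> upper_half_plane" "mob (a, b, c, d) z = mob (a', b', c', d') z"
proof -
  define A where "A = b * a' - b' * a"
  define B where "B = b' * c + d' * a - b * c' - d * a'"
  define C where "C = d * c' - d' * c"
  define t where "t = ads (a, b, c, d) (a', b', c', d')"
  have det: "b * c - a * d = -1" "b' * c' - a' * d' = -1" using p p' by (simp_all add: algebra_simps)
  have "4 * A * C - B\<^sup>2 = 4 * ((b * c - a * d) * (b' * c' - a' * d')) - (2 * t)\<^sup>2"
    unfolding A_def B_def C_def t_def by (simp add: power2_eq_square field_simps)
  then have disc: "4 * A * C - B\<^sup>2 = 4 - 4 * t\<^sup>2" unfolding det by (simp add: power_mult_distrib)
  have "t\<^sup>2 < 1" using less unfolding t_def by (simp add: abs_square_less_1)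
  then have D: "4 * A * C - B\<^sup>2 > 0" using disc by simp
  then have A: "A \<noteq> 0" using not_sum_power2_lt_zero by (metis add.right_neutral diff_0 less_irrefl mult_zero_left mult_zero_right neg_0_less_iff_less not_less zero_le_power2)
  define s where "s = sqrt (4 * A * C - B\<^sup>2)"
  have s: "s > 0" "s\<^sup>2 = 4 * A * C - B\<^sup>2" using D by (simp_all add: s_def)
  define z where "z = Complex (- B / (2 * A)) (s / (2 * \<bar>A\<bar>))"
  have zU: "z \<in> upper_half_plane" using s A by (simp add: z_def uhp_iff)
  have root: "A * z\<^sup>2 + B * z + C = 0"
  proof -
    have "A * ((Re z)\<^sup>2 - (Im z)\<^sup>2) + B * Re z + C = 0"
    proof -
      have "(Im z)\<^sup>2 = (4 * A * C - B\<^sup>2) / (4 * A\<^sup>2)"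
        using s(2) by (simp add: z_def power_divide power_mult_distrib)
      moreover have "Re z = - B / (2 * A)" by (simp add: z_def)
      ultimately show ?thesis using A by (simp only:) (simp add: power2_eq_square field_simps)
    qed
    moreover have "A * (2 * Re z * Im z) + B * Im z = 0" using A by (simp add: z_def field_simps)
    ultimately show ?thesis by (simp add: complex_eq_iff power2_eq_square algebra_simps)
  qed
  have "Im z > 0" using zU by (simp add: uhp_iff)
  note nz = Im_mob(1)[OF p this] Im_mob(1)[OF p' this]
  have "(b * z - d) * (a' * z - c') - (b' * z - d') * (a * z - c) = A * z\<^sup>2 + B * z + C"
    unfolding A_def B_def C_def by (simp add: power2_eq_square algebra_simps)
  then have "mob (a, b, c, d) z = mob (a', b', c', d') z"
    unfolding mob_Pair using nz root by (simp add: frac_eq_eq)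
  then show ?thesis using that zU by blast
qed

context conformal_ml begin

lemma mob_S_inj:
  assumes "z0 \<in> upper_half_plane" "x \<in> upper_half_plane" "y \<in> upper_half_plane" "mob (S x) z0 = mob (S y) z0"
  shows "x = y"
  using uhp_expanding.inj[OF mob_S_expanding[OF assms(1)]] assms by (auto dest: inj_onD)

lemma mob_S_surj:
  assumes "z0 \<in> upper_half_plane" "q \<in> upper_half_plane"
  obtains x where "x \<in> upper_half_plane" "mob (S x) z0 = q"
  using uhp_expanding.surj[OF mob_S_expanding[OF assms(1)] assms(2)] .

text \<open>If the pairing were strictly between -1 and 1, the two isometries would agree at some
  point, against the injectivity of the evaluation maps. The pairing is -1 on the diagonal, so by
  connectedness it never reaches the other side of the gap.\<close>

lemma ads_S_le:
  assumes x: "x \<in> upper_half_plane" and y: "y \<in> upper_half_plane"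
  shows "ads (S x) (S y) \<le> -1"
proof -
  have out: "1 \<le> \<bar>ads (S x) (S y)\<bar>" if y: "y \<in> upper_half_plane" for y
  proof (rule ccontr)
    assume less: "\<not> 1 \<le> \<bar>ads (S x) (S y)\<bar>"
    obtain a b c d a' b' c' d' where S: "S x = (a, b, c, d)" "S y = (a', b', c', d')"
      by (metis prod.exhaust)
    obtain z0 where "z0 \<in> upper_half_plane" "mob (S x) z0 = mob (S y) z0"
      using mob_coincide[of a b c d a' b' c' d'] ads_S_S[OF x] ads_S_S[OF y] less S by (metis not_le)
    then have "x = y" using mob_S_inj x y by blast
    then show False using less ads_S_S[OF x] by simp
  qed
  have "connected ((\<lambda>y. ads (S x) (S y)) ` upper_half_plane)"
    by (intro connected_continuous_image convex_connected[OF convex_uhp]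
        continuous_on_S bounded_linear.continuous_on[OF ads.bounded_linear_right])
  then have "0 \<in> (\<lambda>y. ads (S x) (S y)) ` upper_half_plane" if "ads (S x) (S y) > 0"
    by (rule connectedD_interval[where x="ads (S x) (S x)" and y="ads (S x) (S y)"])
       (use that x y ads_S_S[OF x] in \<open>auto intro: image_eqI[of _ _ x]\<close>)
  then have "\<not> ads (S x) (S y) > 0" using out by force
  then show ?thesis using out[OF y] by auto
qed

text \<open>A matrix of determinant one and bounded norm moves \<open>\<i>\<close> into a bounded
  hyperbolic region, and the evaluation map at \<open>\<i>\<close> is proper.\<close>

lemma S_bounded_compact:
  obtains K where "compact K" "K \<subseteq> upper_half_plane" "\<And>z. z \<in> upper_half_plane \<Longrightarrow> norm (S z) \<le> R \<Longrightarrow> z \<in> K"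
proof -
  define r where "r = max R 1"
  have r: "r \<ge> 1" "R \<le> r" by (auto simp: r_def)
  define K0 where "K0 = cball (0::complex) (4 * r\<^sup>2) \<inter> {w. 1 / (2 * r\<^sup>2) \<le> Im w}"
  have i: "\<i> \<in> upper_half_plane" by (simp add: uhp_iff)
  have "compact K0" unfolding K0_def
    by (intro compact_Int_closed compact_cball closed_halfspace_Im_ge)
  moreover have "K0 \<subseteq> upper_half_plane"
  proof
    fix w assume "w \<in> K0"
    then have "1 / (2 * r\<^sup>2) \<le> Im w" by (simp add: K0_def)
    moreover have "1 / (2 * r\<^sup>2) > 0" using r by simp
    ultimately show "w \<in> upper_half_plane" unfolding uhp_iff by linarith
  qed
  ultimately have K: "compact {z \<in> upper_half_plane. mob (S z) \<i> \<in> K0}"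
    using uhp_expanding.proper[OF mob_S_expanding[OF i]] by blast
  have "mob (S z) \<i> \<in> K0" if z: "z \<in> upper_half_plane" and R: "norm (S z) \<le> R" for z
  proof -
    obtain a b c d where S: "S z = (a, b, c, d)" by (cases "S z")
    have one: "ads (a, b, c, d) (a, b, c, d) = -1" using ads_S_S[OF z] S by simp
    have "norm (S z) \<le> r" using R r by simp
    then have n: "norm (a, b, c, d) \<le> r" unfolding S .
    have "norm b \<le> norm (b, c, d)" "norm c \<le> norm (c, d)" "norm d \<le> norm (c, d)"
       "norm (b, c, d) \<le> norm (a, b, c, d)" "norm (c, d) \<le> norm (b, c, d)" "norm a \<le> norm (a, b, c, d)"
      using norm_fst_le[of b "(c, d)"] norm_fst_le[of c d] norm_snd_le[of d c] norm_snd_le[of "(b, c, d)" a]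
        norm_snd_le[of "(c, d)" b] norm_fst_le[of a "(b, c, d)"] by auto
    then have abcd: "\<bar>a\<bar> \<le> r" "\<bar>b\<bar> \<le> r" "\<bar>c\<bar> \<le> r" "\<bar>d\<bar> \<le> r" using n by auto
    have y: "Im \<i> > 0" by simp
    note I = Im_mob[OF one y]
    let ?den = "of_real a * \<i> - of_real c" and ?num = "of_real b * \<i> - of_real d"
    have den2: "(cmod ?den)\<^sup>2 \<le> 2 * r\<^sup>2"
      using abs_le_square_iff[of a r] abs_le_square_iff[of c r] abcd r by (simp add: cmod_power2)
    have denp: "cmod ?den > 0" using I(1) by simp
    have num: "cmod ?num \<le> 2 * r"
      using abcd norm_triangle_ineq4[of "of_real b * \<i>" "complex_of_real d"] by (simp add: norm_mult)
    have Im: "Im (mob (S z) \<i>) = 1 / (cmod ?den)\<^sup>2" using I(2) S by simp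
    have "1 / (2 * r\<^sup>2) \<le> Im (mob (S z) \<i>)"
      unfolding Im using den2 denp by (intro frac_le) auto
    moreover have "cmod (mob (S z) \<i>) \<le> 4 * r\<^sup>2"
    proof -
      have m: "cmod (mob (S z) \<i>) = cmod ?num / cmod ?den" unfolding S mob_Pair by (simp add: norm_divide)
      \<comment> \<open>The lower bound on the denominator comes from the numerator, since the
        imaginary part of the image is at most its modulus.\<close>
      have "1 / (cmod ?den)\<^sup>2 \<le> cmod ?num / cmod ?den"
        using abs_Im_le_cmod[of "mob (S z) \<i>"] Im m by auto
      then have "1 \<le> cmod ?num * cmod ?den" using denp by (simp add: field_simps power2_eq_square)
      then have "1 / cmod ?den \<le> cmod ?num" using denp by (simp add: field_simps)
      then have "1 / cmod ?den \<le> 2 * r" using num by simp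
      then have "cmod ?num * (1 / cmod ?den) \<le> (2 * r) * (2 * r)"
        using num r denp by (intro mult_mono) auto
      then show ?thesis unfolding m by (simp add: power2_eq_square)
    qed
    ultimately show ?thesis unfolding K0_def by simp
  qed
  then show ?thesis using that[OF K] by auto
qed

text \<open>At a maximum the differential of the pairing vanishes in all tangent directions, and
  these fill the tangent plane because \<open>\<beta> x\<close> is onto. The complex equation says
  that \<open>(a, b, e, d)\<close> is normal to the surface at \<open>S x\<close>.\<close>

lemma ads_S_critical:
  fixes a b e d :: real and x :: complex
  assumes x: "x \<in> upper_half_plane"
    and max: "\<And>y. y \<in> upper_half_plane \<Longrightarrow> ads (a, b, e, d) (S y) \<le> ads (a, b, e, d) (S x)"
  shows "b * x + e * f x - d - a * f x * x = 0"
proof -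
  let ?q = "b * x + e * f x - d - a * f x * x"
  have "((\<lambda>y. ads (a, b, e, d) (S y)) has_derivative (\<lambda>v. ads (a, b, e, d) (imv (\<beta> x v * n x) (f x) x))) (at x)"
    by (rule bounded_linear.has_derivative[OF ads.bounded_linear_right S_deriv[OF x]])
  then have "(\<lambda>v. ads (a, b, e, d) (imv (\<beta> x v * n x) (f x) x)) = (\<lambda>v. 0)"
    by (rule differential_zero_maxmin[OF x open_uhp]) (use max in blast)
  then have z: "Im (\<beta> x v * n x * ?q) = 0" for v
    unfolding ads_imv_right fun_eq_iff by simp
  define Q where "Q = ?q"
  obtain v where v: "\<beta> x v = \<i> * cnj Q" using \<beta>_surj[OF x] by blast
  have "\<i> * cnj Q * n x * Q = \<i> * of_real (n x * (cmod Q)\<^sup>2)"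
    by (simp only: of_real_mult complex_norm_square) (simp only: mult_ac)
  then have "Im (\<i> * of_real (n x * (cmod Q)\<^sup>2)) = 0" using z[of v, folded Q_def] unfolding v by (simp only:)
  then have "n x * (cmod Q)\<^sup>2 = 0" by simp
  then show ?thesis using n_pos[OF x] unfolding Q_def by simp
qed

text \<open>A failing sequence, rescaled to norm 1, has a limit \<open>l\<close> that is null, pairs
  nonpositively with the whole surface and pairs to zero with \<open>S x0\<close>. So
  \<open>S x0\<close> maximises the pairing with \<open>l\<close>, hence \<open>l\<close> is normal
  there, and \<open>null_kernel\<close> gives \<open>l = 0\<close>.\<close>

lemma ads_S_coercive:
  fixes x0 :: complex
  assumes x0: "x0 \<in> upper_half_plane"
  obtains k where "k > 0" "\<And>z. z \<in> upper_half_plane \<Longrightarrow> k * norm (S z) \<le> - ads (S x0) (S z)"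
proof -
  have "\<exists>k>0. \<forall>z\<in>upper_half_plane. k * norm (S z) \<le> - ads (S x0) (S z)"
  proof (rule ccontr)
    assume "\<not> ?thesis"
    then have "\<forall>m. \<exists>z\<in>upper_half_plane. inverse (real (Suc m)) * norm (S z) > - ads (S x0) (S z)"
      by (metis inverse_positive_iff_positive not_le of_nat_0_less_iff zero_less_Suc)
    then obtain z where z: "\<And>m. z m \<in> upper_half_plane"
      "\<And>m. inverse (real (Suc m)) * norm (S (z m)) > - ads (S x0) (S (z m))" by metis
    have big: "norm (S (z m)) > real (Suc m)" for m
    proof -
      have "1 < inverse (real (Suc m)) * norm (S (z m))" using z(2)[of m] ads_S_le[OF x0 z(1)[of m]] by linarith
      then show ?thesis by (simp add: field_simps)
    qed
    define \<eta> where "\<eta> m = S (z m) /\<^sub>R norm (S (z m))" for m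
    have pos: "norm (S (z m)) > 0" for m using big[of m] of_nat_0_le_iff[of "Suc m"] by linarith
    have "\<eta> m \<in> sphere 0 1" for m using pos[of m] unfolding \<eta>_def by simp
    then obtain l r where r: "l \<in> sphere 0 1" "strict_mono r" "(\<eta> \<circ> r) \<longlonglongrightarrow> l"
      using compact_sphere[of "0 :: real \<times> real \<times> real \<times> real" 1] unfolding compact_def by blast
    obtain a b c d where l: "l = (a, b, c, d)" by (cases l)
    have inv: "(\<lambda>m. inverse (real (Suc (r m)))) \<longlonglongrightarrow> 0"
      using LIMSEQ_subseq_LIMSEQ[OF LIMSEQ_inverse_real_of_nat r(2)] by (simp add: o_def)
    have le: "ads l (S x) \<le> 0" if x: "x \<in> upper_half_plane" for x
    proof (rule LIMSEQ_le_const2)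
      show "(\<lambda>m. ads (\<eta> (r m)) (S x)) \<longlonglongrightarrow> ads l (S x)"
        using r(3) by (intro ads.tendsto tendsto_const) (simp add: o_def)
      have "ads (\<eta> m) (S x) \<le> 0" for m
      proof -
        have "ads (\<eta> m) (S x) = ads (S x) (S (z m)) / norm (S (z m))"
          unfolding \<eta>_def ads.scaleR_left by (simp add: ads_commute divide_inverse mult.commute)
        then show ?thesis using ads_S_le[OF x z(1)[of m]] pos[of m] by (simp add: divide_le_0_iff)
      qed
      then show "\<exists>N. \<forall>m\<ge>N. ads (\<eta> (r m)) (S x) \<le> 0" by blast
    qed
    have "0 \<le> ads l (S x0)"
    proof (rule tendsto_le[OF sequentially_bot])
      show "(\<lambda>m. ads (\<eta> (r m)) (S x0)) \<longlonglongrightarrow> ads l (S x0)"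
        using r(3) by (intro ads.tendsto tendsto_const) (simp add: o_def)
      show "(\<lambda>m. - inverse (real (Suc (r m)))) \<longlonglongrightarrow> 0" using tendsto_minus[OF inv] by simp
      have "- inverse (real (Suc m)) \<le> ads (\<eta> m) (S x0)" for m
      proof -
        have "ads (\<eta> m) (S x0) = ads (S x0) (S (z m)) / norm (S (z m))"
          unfolding \<eta>_def ads.scaleR_left by (simp add: ads_commute divide_inverse mult.commute)
        then show ?thesis using z(2)[of m] pos[of m] by (simp add: pos_le_divide_eq)
      qed
      then show "\<forall>\<^sub>F m in sequentially. - inverse (real (Suc (r m))) \<le> ads (\<eta> (r m)) (S x0)" by simp
    qed
    then have "b * x0 + c * f x0 - d - a * f x0 * x0 = 0"
      using ads_S_critical[OF x0, of a b c d] le unfolding l by (meson order_trans)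
    moreover have "ads l l = 0"
    proof (rule LIMSEQ_unique)
      show "(\<lambda>m. ads (\<eta> (r m)) (\<eta> (r m))) \<longlonglongrightarrow> ads l l"
        using r(3) by (intro ads.tendsto) (simp_all add: o_def)
      show "(\<lambda>m. ads (\<eta> (r m)) (\<eta> (r m))) \<longlonglongrightarrow> 0"
      proof (rule tendsto_sandwich[OF _ _ _ tendsto_const])
        show "(\<lambda>m. - inverse (real (Suc (r m)))) \<longlonglongrightarrow> 0" using tendsto_minus[OF inv] by simp
        have "- inverse (real (Suc m)) \<le> ads (\<eta> m) (\<eta> m) \<and> ads (\<eta> m) (\<eta> m) \<le> 0" for m
        proof -
          have "ads (\<eta> m) (\<eta> m) = - inverse (norm (S (z m))) * inverse (norm (S (z m)))"
            unfolding \<eta>_def ads.scaleR_left ads.scaleR_right ads_S_S[OF z(1)] by simp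
          moreover have "inverse (norm (S (z m))) * inverse (norm (S (z m))) \<le> inverse (real (Suc m)) * 1"
            using big[of m] pos[of m] by (intro mult_mono) (auto simp: field_simps)
          ultimately show ?thesis using pos[of m] by simp
        qed
        then show "\<forall>\<^sub>F m in sequentially. - inverse (real (Suc (r m))) \<le> ads (\<eta> (r m)) (\<eta> (r m))"
          "\<forall>\<^sub>F m in sequentially. ads (\<eta> (r m)) (\<eta> (r m)) \<le> 0" by simp_all
      qed
    qed
    then have "b * c = a * d" unfolding l by (simp add: algebra_simps)
    ultimately have "a = 0 \<and> b = 0 \<and> c = 0 \<and> d = 0" using null_kernel Im_pos[OF x0] by blast
    then show False using r(1) l by simp
  qed
  then show ?thesis using that by blast
qed

end

section \<open>The boundary of the surface\<close>

locale boundary_ml = conformal_ml +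
  fixes \<phi> :: "real \<Rightarrow> real"
  assumes bij: "bij_betw f upper_half_plane upper_half_plane"
    and \<phi>_mono: "strict_mono \<phi>" and \<phi>_cont: "continuous_on UNIV \<phi>" and \<phi>_surj: "surj \<phi>"
    and extends_real: "(f \<longlongrightarrow> of_real (\<phi> b)) (at (of_real b) within upper_half_plane)"
    and extends_infty: "filterlim f at_infinity (inf at_infinity (principal upper_half_plane))"
begin

section \<open>Preservation of area in flat coordinates\<close>

lemma jacobian:
  assumes z: "z \<in> upper_half_plane"
  shows "Re (f' z 1) * Im (f' z \<i>) - Re (f' z \<i>) * Im (f' z 1) = (Im (f z) / Im z)\<^sup>2"
proof -
  define C D where "C = cos (2 * \<theta> z)" and "D = sin (2 * \<theta> z)"
  have cis: "cis (- 2 * \<theta> z) = Complex C (- D)" and one: "C\<^sup>2 + D\<^sup>2 = 1"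
    unfolding C_def D_def by (simp_all add: complex_eq_iff)
  have "Re (f' z 1) * Im (f' z \<i>) - Re (f' z \<i>) * Im (f' z 1) =
     (\<rho> z)\<^sup>2 * (C\<^sup>2 + D\<^sup>2) - ((Re (c z))\<^sup>2 + (Im (c z))\<^sup>2)"
    unfolding form[OF z] cis by (simp add: power2_eq_square algebra_simps)
  then show ?thesis using rho_sq[OF z] one by (simp add: cmod_power2)
qed

text \<open>In the coordinates \<open>Re z\<close> and \<open>1 / Im z\<close> hyperbolic area
  becomes Lebesgue measure, so areas of boxes are products of side lengths.\<close>

definition area_chart :: "real^2 \<Rightarrow> complex" where
  "area_chart w = Complex (w $ 1) (1 / w $ 2)"

definition area_map :: "real^2 \<Rightarrow> real^2" where
  "area_map w = vector [Re (f (area_chart w)), 1 / Im (f (area_chart w))]"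

lemma area_chart_uhp: "w $ 2 > 0 \<Longrightarrow> area_chart w \<in> upper_half_plane"
  by (simp add: area_chart_def uhp_iff)

lemma vec2_eq: "(v :: real^2) = w \<longleftrightarrow> v $ 1 = w $ 1 \<and> v $ 2 = w $ 2"
  by (simp add: vec_eq_iff forall_2)

definition area_deriv :: "real^2 \<Rightarrow> real^2 \<Rightarrow> real^2" where
  "area_deriv w h = (let z = area_chart w; d = f' z (Complex (h $ 1) (- (Im z)\<^sup>2 * h $ 2)) in
     vector [Re d, - Im d / (Im (f z))\<^sup>2])"

lemma area_map_deriv:
  assumes w: "w $ 2 > 0"
  shows "(area_map has_derivative area_deriv w) (at w)"
proof -
  let ?z = "area_chart w"
  have z: "?z \<in> upper_half_plane" using area_chart_uhp[OF w] .
  have v: "Im (f ?z) \<noteq> 0" using Im_pos[OF z] by simp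
  have c1: "((\<lambda>w::real^2. w $ i) has_derivative (\<lambda>h. h $ i)) (at w)" for i
    by (rule bounded_linear.has_derivative[OF bounded_linear_vec_nth has_derivative_ident])
  have c2: "((\<lambda>w::real^2. 1 / w $ 2) has_derivative (\<lambda>h. - (Im ?z)\<^sup>2 * h $ 2)) (at w)"
    using w by (auto intro!: derivative_eq_intros c1 HOL.ext simp: area_chart_def power2_eq_square field_simps)
  have "(area_chart has_derivative (\<lambda>h. of_real (h $ 1) + \<i> * of_real (- (Im ?z)\<^sup>2 * h $ 2))) (at w)"
    unfolding area_chart_def Complex_eq
    by (intro has_derivative_add has_derivative_mult_right bounded_linear.has_derivative[OF bounded_linear_of_real] c1 c2[unfolded area_chart_def Complex_eq])
  then have ch: "(area_chart has_derivative (\<lambda>h. Complex (h $ 1) (- (Im ?z)\<^sup>2 * h $ 2))) (at w)"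
    by (simp add: Complex_eq)
  have fc: "((\<lambda>w. f (area_chart w)) has_derivative (\<lambda>h. f' ?z (Complex (h $ 1) (- (Im ?z)\<^sup>2 * h $ 2)))) (at w)"
    by (rule has_derivative_compose[OF ch deriv[OF z]])
  note re = bounded_linear.has_derivative[OF bounded_linear_Re fc]
  note im = bounded_linear.has_derivative[OF bounded_linear_Im fc]
  have im': "((\<lambda>w. 1 / Im (f (area_chart w))) has_derivative (\<lambda>h. - Im (f' ?z (Complex (h $ 1) (- (Im ?z)\<^sup>2 * h $ 2))) / (Im (f ?z))\<^sup>2)) (at w)"
    by (rule has_derivative_eq_rhs[OF has_derivative_divide'[OF has_derivative_const im v]])
       (simp add: power2_eq_square)
  note sum = has_derivative_add[OF has_derivative_scaleR_left[OF re, of "axis 1 1 :: real^2"] has_derivative_scaleR_left[OF im', of "axis 2 1 :: real^2"]]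
  have ax: "axis 1 (1::real) $ (1::2) = 1" "axis 1 (1::real) $ (2::2) = 0" "axis 2 (1::real) $ (1::2) = 0" "axis 2 (1::real) $ (2::2) = 1"
    by (simp_all add: axis_def)
  have "area_map = (\<lambda>w. Re (f (area_chart w)) *\<^sub>R axis 1 1 + (1 / Im (f (area_chart w))) *\<^sub>R axis 2 1)"
    by (simp add: fun_eq_iff area_map_def vec2_eq ax)
  moreover have "area_deriv w = (\<lambda>h. Re (f' ?z (Complex (h $ 1) (- (Im ?z)\<^sup>2 * h $ 2))) *\<^sub>R axis 1 1
      + (- Im (f' ?z (Complex (h $ 1) (- (Im ?z)\<^sup>2 * h $ 2))) / (Im (f ?z))\<^sup>2) *\<^sub>R axis 2 1)"
    by (simp add: fun_eq_iff area_deriv_def vec2_eq Let_def ax)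
  ultimately show ?thesis using sum by simp
qed

lemma area_det:
  assumes w: "w $ 2 > 0"
  shows "det (matrix (area_deriv w)) = 1"
proof -
  let ?z = "area_chart w"
  have z: "?z \<in> upper_half_plane" using area_chart_uhp[OF w] .
  have e: "Complex 1 0 = 1" "Complex 0 (- (Im ?z)\<^sup>2) = (- (Im ?z)\<^sup>2) *\<^sub>R \<i>" by (simp_all add: complex_eq_iff)
  have ax: "axis 1 (1::real) $ (1::2) = 1" "axis 1 (1::real) $ (2::2) = 0" "axis 2 (1::real) $ (1::2) = 0" "axis 2 (1::real) $ (2::2) = 1"
    by (simp_all add: axis_def)
  have "det (matrix (area_deriv w)) = (Im ?z)\<^sup>2 / (Im (f ?z))\<^sup>2 * (Re (f' ?z 1) * Im (f' ?z \<i>) - Re (f' ?z \<i>) * Im (f' ?z 1))"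
    unfolding det_2 matrix_def area_deriv_def Let_def
    by (simp add: ax e linear_scale[OF f'_lin[OF z]] algebra_simps diff_divide_distrib del: scaleR_minus_left)
  also have "\<dots> = 1" unfolding jacobian[OF z] using Im_pos[OF z] by (simp add: power_divide)
  finally show ?thesis .
qed

lemma measure_area_map:
  assumes A: "compact A" "\<And>w. w \<in> A \<Longrightarrow> w $ 2 > 0"
  shows "measure lebesgue (area_map ` A) = measure lebesgue A"
proof -
  have lm: "A \<in> lmeasurable" using A(1) lmeasurable_compact by blast
  have inj: "inj_on area_map A"
  proof (rule inj_onI)
    fix p q assume pq: "p \<in> A" "q \<in> A" "area_map p = area_map q"
    have zU: "area_chart p \<in> upper_half_plane" "area_chart q \<in> upper_half_plane" using area_chart_uhp A pq by auto
    have "f (area_chart p) = f (area_chart q)"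
      using pq(3) by (simp add: area_map_def vec2_eq complex_eq_iff)
    then have "area_chart p = area_chart q" using bij zU by (meson bij_betw_imp_inj_on inj_onD)
    then show "p = q" by (simp add: area_chart_def vec2_eq)
  qed
  have *: "((\<lambda>w. \<bar>det (matrix (area_deriv w))\<bar>) has_integral measure lebesgue A) A"
  proof (rule has_integral_eq[rotated])
    show "((\<lambda>w. 1) has_integral measure lebesgue A) A"
      using lm lmeasure_integral[OF lm] lmeasurable_iff_integrable_on by (metis has_integral_integral)
  qed (use area_det A in auto)
  have "area_map ` A \<in> lmeasurable \<and> measure lebesgue (area_map ` A) = measure lebesgue A"
    by (rule has_measure_differentiable_image[THEN iffD2, OF _ _ inj *])
       (use lm area_map_deriv A in \<open>auto intro: has_derivative_at_withinI\<close>)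
  then show ?thesis by blast
qed

lemma measure_box:
  assumes "a1 \<le> a2" "Y1 \<le> Y2"
  shows "measure lebesgue (cbox (vector [a1, Y1]) (vector [a2, Y2] :: real^2)) = (a2 - a1) * (Y2 - Y1)"
  using assms by (simp add: measure_completion content_cbox_cart interval_ne_empty_cart forall_2 UNIV_2)

lemma in_box: "(w::real^2) \<in> cbox (vector [a1, Y1]) (vector [a2, Y2]) \<longleftrightarrow> a1 \<le> w $ 1 \<and> w $ 1 \<le> a2 \<and> Y1 \<le> w $ 2 \<and> w $ 2 \<le> Y2"
  by (auto simp: mem_box_cart forall_2)

text \<open>The second coordinate is the inverse height: a box with side \<open>[1/s, 2/s]\<close>
  lies close to the boundary and has area of order \<open>1/s\<close>, so a uniform change of
  heights by a large factor becomes visible in the areas.\<close>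

lemma area_image_le:
  assumes "a1 \<le> a2" "0 < Y1" "Y1 \<le> Y2" "b1 \<le> b2" "V1 \<le> V2"
    and "\<And>z. \<lbrakk>z \<in> upper_half_plane; a1 \<le> Re z; Re z \<le> a2; Y1 \<le> 1 / Im z; 1 / Im z \<le> Y2\<rbrakk> \<Longrightarrow>
       b1 \<le> Re (f z) \<and> Re (f z) \<le> b2 \<and> V1 \<le> 1 / Im (f z) \<and> 1 / Im (f z) \<le> V2"
  shows "(a2 - a1) * (Y2 - Y1) \<le> (b2 - b1) * (V2 - V1)"
proof -
  let ?Q = "cbox (vector [a1, Y1]) (vector [a2, Y2]) :: (real^2) set"
  let ?P = "cbox (vector [b1, V1]) (vector [b2, V2]) :: (real^2) set"
  have sub: "area_map ` ?Q \<subseteq> ?P"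
  proof clarify
    fix w :: "real^2" assume "w \<in> ?Q"
    then have w: "a1 \<le> w $ 1" "w $ 1 \<le> a2" "Y1 \<le> w $ 2" "w $ 2 \<le> Y2" using in_box by auto
    then have "w $ 2 > 0" using assms(2) by linarith
    from assms(6)[OF area_chart_uhp[OF this]] w show "area_map w \<in> ?P"
      unfolding in_box by (simp add: area_map_def area_chart_def)
  qed
  have "measure lebesgue (area_map ` ?Q) = measure lebesgue ?Q"
    by (rule measure_area_map) (use in_box assms(2) in \<open>auto simp: less_le_trans\<close>)
  moreover have "measure lebesgue (area_map ` ?Q) \<le> measure lebesgue ?P"
  proof (rule measure_mono_fmeasurable[OF sub])
    have "compact (area_map ` ?Q)"
      by (intro compact_continuous_image compact_cbox continuous_at_imp_continuous_on ballI has_derivative_continuous[OF area_map_deriv])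
         (use in_box assms(2) in \<open>auto simp: less_le_trans\<close>)
    then show "area_map ` ?Q \<in> sets lebesgue" using lmeasurable_compact fmeasurableD by blast
  qed auto
  ultimately show ?thesis using measure_box assms by simp
qed

text \<open>The inverse direction is reduced to the forward one: the compact set of points of the
  first box that land in the second box is mapped onto the second box.\<close>

lemma area_preimage_le:
  assumes "a1 \<le> a2" "0 < Y1" "Y1 \<le> Y2" "b1 \<le> b2" "V1 \<le> V2" "0 < V1"
    and pre: "\<And>z. \<lbrakk>z \<in> upper_half_plane; b1 \<le> Re (f z); Re (f z) \<le> b2; V1 \<le> 1 / Im (f z); 1 / Im (f z) \<le> V2\<rbrakk> \<Longrightarrow>
       a1 \<le> Re z \<and> Re z \<le> a2 \<and> Y1 \<le> 1 / Im z \<and> 1 / Im z \<le> Y2"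
  shows "(b2 - b1) * (V2 - V1) \<le> (a2 - a1) * (Y2 - Y1)"
proof -
  let ?Q = "cbox (vector [a1, Y1]) (vector [a2, Y2]) :: (real^2) set"
  let ?P = "cbox (vector [b1, V1]) (vector [b2, V2]) :: (real^2) set"
  define A where "A = ?Q \<inter> area_map -` ?P"
  have pos: "w $ 2 > 0" if "w \<in> ?Q" for w :: "real^2" using that in_box assms(2) by (auto simp: less_le_trans)
  have cont: "continuous_on ?Q area_map"
    by (intro continuous_at_imp_continuous_on ballI has_derivative_continuous[OF area_map_deriv] pos)
  have cA: "compact A" unfolding A_def
    using continuous_closed_preimage[OF cont closed_cbox closed_cbox] compact_cbox
    by (metis bounded_cbox bounded_subset compact_eq_bounded_closed inf_le1)
  have sub: "?P \<subseteq> area_map ` A"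
  proof
    fix p :: "real^2" assume pP: "p \<in> ?P"
    then have p: "b1 \<le> p $ 1" "p $ 1 \<le> b2" "V1 \<le> p $ 2" "p $ 2 \<le> V2" using in_box by auto
    have p2: "p $ 2 > 0" using p assms(6) by linarith
    obtain z where z: "z \<in> upper_half_plane" "f z = area_chart p"
      using bij area_chart_uhp[OF p2] by (metis bij_betw_imp_surj_on imageE)
    have b: "a1 \<le> Re z \<and> Re z \<le> a2 \<and> Y1 \<le> 1 / Im z \<and> 1 / Im z \<le> Y2"
      by (rule pre[OF z(1)]) (use z p in \<open>simp_all add: area_chart_def\<close>)
    define w :: "real^2" where "w = vector [Re z, 1 / Im z]"
    have wz: "area_chart w = z" by (simp add: w_def area_chart_def)
    have "area_map w = p" unfolding area_map_def wz z(2) by (simp add: vec2_eq area_chart_def)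
    moreover have "w \<in> ?Q" unfolding in_box using b by (simp add: w_def)
    ultimately show "p \<in> area_map ` A" unfolding A_def using pP by auto
  qed
  have "measure lebesgue (area_map ` A) = measure lebesgue A"
    by (rule measure_area_map[OF cA]) (use pos in \<open>auto simp: A_def\<close>)
  moreover have "measure lebesgue ?P \<le> measure lebesgue (area_map ` A)"
  proof (rule measure_mono_fmeasurable[OF sub])
    have "compact (area_map ` A)"
      by (rule compact_continuous_image[OF continuous_on_subset[OF cont] cA]) (auto simp: A_def)
    then show "area_map ` A \<in> lmeasurable" by (rule lmeasurable_compact)
  qed auto
  moreover have "measure lebesgue A \<le> measure lebesgue ?Q"
    by (rule measure_mono_fmeasurable) (use cA lmeasurable_compact in \<open>auto simp: A_def\<close>)
  ultimately show ?thesis using measure_box assms by simp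
qed

section \<open>Behaviour of \<open>f\<close> and \<open>S\<close> above a boundary interval\<close>

lemma \<phi>_isCont: "isCont \<phi> b"
  using \<phi>_cont by (simp add: continuous_on_eq_continuous_at)

text \<open>The property \<open>Q\<close> may depend on \<open>m\<close>; the index map
  \<open>r\<close> is returned so that a condition that sharpens with \<open>m\<close> survives the
  passage to a convergent subsequence.\<close>

lemma boundary_seq:
  assumes "\<And>m::nat. \<exists>z. c1 \<le> Re z \<and> Re z \<le> c2 \<and> 0 < Im z \<and> Im z < inverse (real (Suc m)) \<and> Q m z"
  obtains b and z :: "nat \<Rightarrow> complex" and r :: "nat \<Rightarrow> nat" where "c1 \<le> b" "b \<le> c2" "strict_mono r"
    "\<And>m. z m \<in> upper_half_plane" "\<And>m. Q (r m) (z m)"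
    "z \<longlonglongrightarrow> of_real b" "(\<lambda>m. f (z m)) \<longlonglongrightarrow> of_real (\<phi> b)"
proof -
  obtain y where y: "\<And>m. c1 \<le> Re (y m) \<and> Re (y m) \<le> c2 \<and> 0 < Im (y m) \<and> Im (y m) < inverse (real (Suc m)) \<and> Q m (y m)"
    using assms by metis
  obtain b r where r: "b \<in> {c1..c2}" "strict_mono r" "((\<lambda>m. Re (y m)) \<circ> r) \<longlonglongrightarrow> b"
    using compact_Icc[of c1 c2] y unfolding compact_def by (metis (no_types, lifting) atLeastAtMost_iff)
  have inv: "(\<lambda>m. inverse (real (Suc (r m)))) \<longlonglongrightarrow> 0"
    using LIMSEQ_subseq_LIMSEQ[OF LIMSEQ_inverse_real_of_nat r(2)] by (simp add: o_def)
  have im: "(\<lambda>m. Im (y (r m))) \<longlonglongrightarrow> 0"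
    by (rule tendsto_sandwich[OF _ _ tendsto_const inv]) (use y in \<open>auto intro!: always_eventually less_imp_le\<close>)
  have lim: "(\<lambda>m. y (r m)) \<longlonglongrightarrow> of_real b"
    unfolding tendsto_complex_iff using im r(3) by (simp add: o_def)
  have U: "y m \<in> upper_half_plane" for m using y by (simp add: uhp_iff)
  have "y m \<noteq> of_real b" for m using y[of m] by (metis Im_complex_of_real less_irrefl)
  then have "filterlim (\<lambda>m. y (r m)) (at (of_real b) within upper_half_plane) sequentially"
    unfolding filterlim_at using lim U by auto
  then have "(\<lambda>m. f (y (r m))) \<longlonglongrightarrow> of_real (\<phi> b)"
    by (rule filterlim_compose[OF extends_real])
  then show ?thesis using that[of b r "\<lambda>m. y (r m)"] r(1,2) lim U y by auto
qed

lemma norm4: "norm (a, b, e, d) \<le> \<bar>a\<bar> + \<bar>b\<bar> + \<bar>e\<bar> + \<bar>d\<bar>" for a b e d :: real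
  using norm_Pair_le[of a "(b, e, d)"] norm_Pair_le[of b "(e, d)"] norm_Pair_le[of e d] by simp

text \<open>Each entry of \<open>S z\<close> is \<open>n z\<close> times a bounded multiple of
  \<open>sin (\<theta> z)\<close> plus a bounded multiple of the heights. If the heights of
  \<open>z\<close> and \<open>f z\<close> are comparable, \<open>n z\<close> times the larger one is
  at most \<open>K\<close>, so a sine of the order of the height keeps \<open>S z\<close>
  bounded.\<close>

lemma norm_S_le:
  assumes z: "z \<in> upper_half_plane" and M: "1 \<le> M" "cmod z \<le> M" "cmod (f z) \<le> M"
    and K0: "0 \<le> K0" "\<bar>sin (\<theta> z)\<bar> \<le> K0 * max (Im (f z)) (Im z)"
    and K: "1 \<le> K" "Im (f z) \<le> K * Im z" "Im z \<le> K * Im (f z)"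
  shows "norm (S z) \<le> 4 * (K * (K0 * M\<^sup>2 + 2 * M))"
proof -
  define m where "m = max (Im (f z)) (Im z)"
  have pos: "Im z > 0" "Im (f z) > 0" using Im_pos[OF z] by auto
  have m: "m > 0" "Im z \<le> m" "Im (f z) \<le> m" "\<bar>sin (\<theta> z)\<bar> \<le> K0 * m" using pos K0 by (auto simp: m_def)
  have nm: "n z * m \<le> K"
  proof -
    have "m * m \<le> K * (Im (f z) * Im z)"
      unfolding m_def using K pos by (cases "Im z \<le> Im (f z)") (auto simp: max_def intro: mult_right_mono order_trans[OF mult_left_mono])
    also have "\<dots> \<le> K * (K * (Im (f z) * Im z))" using K(1) pos by simp
    finally have "(n z * m)\<^sup>2 \<le> n z * n z * (K * (K * (Im (f z) * Im z)))"
      using n_pos[OF z] by (simp add: power2_eq_square mult.assoc mult.left_commute mult_left_mono)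
    also have "\<dots> = K\<^sup>2 * (n z * n z * (Im (f z) * Im z))" by (simp add: power2_eq_square)
    also have "\<dots> = K\<^sup>2" unfolding n_sq[OF z] by simp
    finally show ?thesis by (rule power2_le_imp_le) (use K(1) in simp)
  qed
  define B where "B = K0 * M\<^sup>2 + 2 * M"
  have sM: "\<bar>sin (\<theta> z)\<bar> * t \<le> m * (K0 * T)" if "0 \<le> t" "t \<le> T" for t T
  proof -
    have "\<bar>sin (\<theta> z)\<bar> * t \<le> (K0 * m) * T" using that m K0(1) by (intro mult_mono) auto
    then show ?thesis by (simp add: mult_ac)
  qed
  have M2: "M \<le> M\<^sup>2" "1 \<le> M\<^sup>2" using M(1) by (simp_all add: power2_eq_square) (metis M(1) mult_mono mult_1 order_trans zero_le_one)
  have KM: "K0 * 1 \<le> K0 * M\<^sup>2" "K0 * M \<le> K0 * M\<^sup>2"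
    using mult_left_mono[OF M2(2) K0(1)] mult_left_mono[OF M2(1) K0(1)] by simp_all
  have cs: "\<bar>cos (\<theta> z) * t\<bar> \<le> \<bar>t\<bar>" for t using abs_cos_le_one[of "\<theta> z"] by (simp add: abs_mult mult_left_le_one_le)
  have b0: "\<bar>Im (E z)\<bar> \<le> m * B"
  proof -
    have "\<bar>Im (E z)\<bar> \<le> m * (K0 * 1)" using sM[of 1 1] by (simp add: E_def)
    also have "\<dots> \<le> m * B" using m(1) KM M(1) by (intro mult_left_mono) (auto simp: B_def)
    finally show ?thesis .
  qed
  have b1: "\<bar>Im (E z * f z)\<bar> \<le> m * B"
  proof -
    have "\<bar>Im (E z * f z)\<bar> \<le> \<bar>cos (\<theta> z) * Im (f z)\<bar> + \<bar>sin (\<theta> z)\<bar> * \<bar>Re (f z)\<bar>"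
      by (simp add: E_def flip: abs_mult)
    also have "\<dots> \<le> m * M + m * (K0 * M)"
    proof (rule add_mono)
      have "\<bar>cos (\<theta> z) * Im (f z)\<bar> \<le> m * 1" using cs[of "Im (f z)"] m pos by simp
      also have "\<dots> \<le> m * M" using m M by (intro mult_left_mono) auto
      finally show "\<bar>cos (\<theta> z) * Im (f z)\<bar> \<le> m * M" .
      show "\<bar>sin (\<theta> z)\<bar> * \<bar>Re (f z)\<bar> \<le> m * (K0 * M)" using abs_Re_le_cmod[of "f z"] M by (intro sM) auto
    qed
    also have "\<dots> = m * (M + K0 * M)" by (simp add: algebra_simps)
    also have "\<dots> \<le> m * B" using m(1) KM M(1) by (intro mult_left_mono) (auto simp: B_def)
    finally show ?thesis .
  qed
  have b2: "\<bar>Im (E z * cnj z)\<bar> \<le> m * B"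
  proof -
    have "\<bar>Im (E z * cnj z)\<bar> \<le> \<bar>cos (\<theta> z) * Im z\<bar> + \<bar>sin (\<theta> z)\<bar> * \<bar>Re z\<bar>"
      by (simp add: E_def flip: abs_mult)
    also have "\<dots> \<le> m * M + m * (K0 * M)"
    proof (rule add_mono)
      have "\<bar>cos (\<theta> z) * Im z\<bar> \<le> m * 1" using cs[of "Im z"] m pos by simp
      also have "\<dots> \<le> m * M" using m M by (intro mult_left_mono) auto
      finally show "\<bar>cos (\<theta> z) * Im z\<bar> \<le> m * M" .
      show "\<bar>sin (\<theta> z)\<bar> * \<bar>Re z\<bar> \<le> m * (K0 * M)" using abs_Re_le_cmod[of z] M by (intro sM) auto
    qed
    also have "\<dots> = m * (M + K0 * M)" by (simp add: algebra_simps)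
    also have "\<dots> \<le> m * B" using m(1) KM M(1) by (intro mult_left_mono) (auto simp: B_def)
    finally show ?thesis .
  qed
  have b3: "\<bar>Im (E z * f z * cnj z)\<bar> \<le> m * B"
  proof -
    have "\<bar>Im (E z * f z * cnj z)\<bar> = \<bar>cos (\<theta> z) * Im (f z * cnj z) + sin (\<theta> z) * Re (f z * cnj z)\<bar>"
      by (simp add: E_def mult.assoc)
    also have "\<dots> \<le> \<bar>cos (\<theta> z) * Im (f z * cnj z)\<bar> + \<bar>sin (\<theta> z)\<bar> * \<bar>Re (f z * cnj z)\<bar>"
      by (simp flip: abs_mult)
    also have "\<dots> \<le> m * (2 * M) + m * (K0 * M\<^sup>2)"
    proof (rule add_mono)
      have "\<bar>cos (\<theta> z) * Im (f z * cnj z)\<bar> \<le> \<bar>Im (f z) * Re z\<bar> + \<bar>Re (f z) * Im z\<bar>"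
        by (rule order_trans[OF cs]) (simp add: abs_triangle_ineq4 algebra_simps)
      also have "\<dots> = Im (f z) * \<bar>Re z\<bar> + \<bar>Re (f z)\<bar> * Im z" using pos by (simp add: abs_mult)
      also have "\<dots> \<le> m * M + M * m"
        using m pos M abs_Re_le_cmod[of z] abs_Re_le_cmod[of "f z"] by (intro add_mono mult_mono) auto
      finally show "\<bar>cos (\<theta> z) * Im (f z * cnj z)\<bar> \<le> m * (2 * M)" by (simp add: mult_ac)
      have "\<bar>Re (f z * cnj z)\<bar> \<le> cmod (f z * cnj z)" by (rule abs_Re_le_cmod)
      also have "\<dots> \<le> M * M" unfolding norm_mult using M by (intro mult_mono) auto
      finally show "\<bar>sin (\<theta> z)\<bar> * \<bar>Re (f z * cnj z)\<bar> \<le> m * (K0 * M\<^sup>2)" by (intro sM) (auto simp: power2_eq_square)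
    qed
    also have "\<dots> = m * B" by (simp add: B_def algebra_simps)
    finally show ?thesis .
  qed
  have B0: "B \<ge> 0" using K0(1) M(1) by (simp add: B_def)
  have sc: "\<bar>Im (of_real (n z) * X)\<bar> \<le> K * B" if "\<bar>Im X\<bar> \<le> m * B" for X
  proof -
    have "\<bar>Im (of_real (n z) * X)\<bar> = n z * \<bar>Im X\<bar>" using n_pos[OF z] by (simp add: abs_mult)
    also have "\<dots> \<le> n z * (m * B)" using that n_pos[OF z] by (intro mult_left_mono) auto
    also have "\<dots> = (n z * m) * B" by simp
    also have "\<dots> \<le> K * B" using nm B0 by (rule mult_right_mono)
    finally show ?thesis .
  qed
  have "norm (S z) \<le> \<bar>Im (n z * E z)\<bar> + \<bar>Im (n z * E z * f z)\<bar> + \<bar>Im (n z * E z * cnj z)\<bar> + \<bar>Im (n z * E z * f z * cnj z)\<bar>"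
    unfolding S_def imv_def by (rule norm4)
  also have "\<dots> \<le> K * B + K * B + K * B + K * B"
    using sc[OF b0] sc[OF b1] sc[OF b2] sc[OF b3] by (intro add_mono) (simp_all only: mult.assoc)
  finally show ?thesis by (simp add: B_def)
qed

lemma f_bounded_strip:
  obtains M \<epsilon> where "M \<ge> 1" "\<epsilon> > 0" "\<And>z. \<lbrakk>c1 \<le> Re z; Re z \<le> c2; 0 < Im z; Im z < \<epsilon>\<rbrakk> \<Longrightarrow> cmod (f z) \<le> M \<and> cmod z \<le> M"
proof -
  have "\<exists>m::nat. \<forall>z. c1 \<le> Re z \<longrightarrow> Re z \<le> c2 \<longrightarrow> 0 < Im z \<longrightarrow> Im z < inverse (real (Suc m)) \<longrightarrow> cmod (f z) \<le> real m \<and> cmod z \<le> real m"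
  proof (rule ccontr)
    assume "\<not> ?thesis"
    then have "\<exists>z. c1 \<le> Re z \<and> Re z \<le> c2 \<and> 0 < Im z \<and> Im z < inverse (real (Suc m)) \<and> \<not> (cmod (f z) \<le> real m \<and> cmod z \<le> real m)" for m
      by blast
    then obtain b z r where bz: "strict_mono r" "\<And>m. \<not> (cmod (f (z m)) \<le> real (r m) \<and> cmod (z m) \<le> real (r m))"
      "z \<longlonglongrightarrow> of_real b" "(\<lambda>m. f (z m)) \<longlonglongrightarrow> of_real (\<phi> b)"
      by (rule boundary_seq) blast
    obtain B1 where B1: "\<And>m. cmod (z m) \<le> B1" using convergent_imp_bounded[OF bz(3)] by (auto simp: bounded_iff)
    obtain B2 where B2: "\<And>m. cmod (f (z m)) \<le> B2" using convergent_imp_bounded[OF bz(4)] by (auto simp: bounded_iff)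
    obtain m where "real m \<ge> max B1 B2" using real_arch_simple by blast
    then have "real (r m) \<ge> max B1 B2" using seq_suble[OF bz(1), of m] by (meson of_nat_mono order_trans)
    then show False using B1[of m] B2[of m] bz(2)[of m] by linarith
  qed
  then obtain m :: nat where m: "\<And>z. c1 \<le> Re z \<Longrightarrow> Re z \<le> c2 \<Longrightarrow> 0 < Im z \<Longrightarrow> Im z < inverse (real (Suc m)) \<Longrightarrow> cmod (f z) \<le> real m \<and> cmod z \<le> real m"
    by blast
  show ?thesis
    by (rule that[of "max 1 (real m)" "inverse (real (Suc m))"]) (use m in \<open>force+\<close>)
qed

text \<open>The hypotheses give boundary limits of \<open>f\<close>, not of its inverse. A sequence
  violating the claim cannot escape to infinity by \<open>extends_infty\<close>, cannot accumulate
  inside since the heights of the images tend to 0, and a limit on the boundary lies in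
  \<open>[p1, p2]\<close> by monotonicity of \<open>\<phi>\<close>.\<close>

lemma near_boundary_preimage:
  assumes "c1 < p1" "p1 \<le> p2" "p2 < c2" "0 < \<epsilon>"
  obtains \<eta> where "\<eta> > 0" "\<And>z. \<lbrakk>z \<in> upper_half_plane; \<phi> p1 \<le> Re (f z); Re (f z) \<le> \<phi> p2; Im (f z) < \<eta>\<rbrakk> \<Longrightarrow> c1 \<le> Re z \<and> Re z \<le> c2 \<and> Im z < \<epsilon>"
proof -
  have "\<exists>m::nat. \<forall>z\<in>upper_half_plane. \<phi> p1 \<le> Re (f z) \<longrightarrow> Re (f z) \<le> \<phi> p2 \<longrightarrow> Im (f z) < inverse (real (Suc m)) \<longrightarrow> c1 \<le> Re z \<and> Re z \<le> c2 \<and> Im z < \<epsilon>"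
  proof (rule ccontr)
    assume "\<not> ?thesis"
    then have "\<forall>m::nat. \<exists>z\<in>upper_half_plane. \<phi> p1 \<le> Re (f z) \<and> Re (f z) \<le> \<phi> p2 \<and> Im (f z) < inverse (real (Suc m)) \<and> \<not> (c1 \<le> Re z \<and> Re z \<le> c2 \<and> Im z < \<epsilon>)"
      by blast
    then obtain z where z: "\<And>m::nat. z m \<in> upper_half_plane" "\<And>m. \<phi> p1 \<le> Re (f (z m))" "\<And>m. Re (f (z m)) \<le> \<phi> p2"
      "\<And>m. Im (f (z m)) < inverse (real (Suc m))" "\<And>m. \<not> (c1 \<le> Re (z m) \<and> Re (z m) \<le> c2 \<and> Im (z m) < \<epsilon>)"
      by metis
    have im: "(\<lambda>m. Im (f (z m))) \<longlonglongrightarrow> 0"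
      by (rule tendsto_sandwich[OF _ _ tendsto_const LIMSEQ_inverse_real_of_nat])
         (use z Im_pos in \<open>auto intro!: always_eventually less_imp_le\<close>)
    have fb: "cmod (f (z m)) \<le> \<bar>\<phi> p1\<bar> + \<bar>\<phi> p2\<bar> + 1" for m
    proof -
      have "inverse (real (Suc m)) \<le> 1" by (simp add: inverse_le_1_iff)
      then have "\<bar>Im (f (z m))\<bar> \<le> 1" using z(4)[of m] Im_pos(2)[OF z(1)[of m]] by linarith
      moreover have "\<bar>Re (f (z m))\<bar> \<le> \<bar>\<phi> p1\<bar> + \<bar>\<phi> p2\<bar>" using z(2,3)[of m] by linarith
      ultimately show ?thesis using cmod_le[of "f (z m)"] by linarith
    qed
    have "bounded (range z)"
    proof (rule ccontr)
      assume nb: "\<not> bounded (range z)"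
      then have "\<exists>m. cmod (z m) > real k" for k
        unfolding bounded_iff by (metis not_le rangeE)
      then obtain s where s: "\<And>k. cmod (z (s k)) > real k" by metis
      have inf: "filterlim (\<lambda>k. z (s k)) at_infinity sequentially"
        unfolding filterlim_at_infinity_conv_norm_at_top
        by (rule filterlim_at_top_mono[OF filterlim_real_sequentially]) (use s in \<open>auto intro!: always_eventually less_imp_le\<close>)
      have "filterlim (\<lambda>k. z (s k)) (inf at_infinity (principal upper_half_plane)) sequentially"
        unfolding filterlim_inf filterlim_principal using inf z(1) by auto
      from filterlim_compose[OF extends_infty this] have "filterlim (\<lambda>k. f (z (s k))) at_infinity sequentially" .
      then have "filterlim (\<lambda>k. cmod (f (z (s k)))) at_top sequentially"
        unfolding filterlim_at_infinity_conv_norm_at_top .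
      then have "\<forall>\<^sub>F k in sequentially. \<bar>\<phi> p1\<bar> + \<bar>\<phi> p2\<bar> + 2 \<le> cmod (f (z (s k)))"
        unfolding filterlim_at_top by blast
      then obtain k where "\<bar>\<phi> p1\<bar> + \<bar>\<phi> p2\<bar> + 2 \<le> cmod (f (z (s k)))" by (auto simp: eventually_sequentially)
      then show False using fb[of "s k"] by linarith
    qed
    then obtain \<zeta> r where r: "strict_mono r" "(z \<circ> r) \<longlonglongrightarrow> \<zeta>"
      using bounded_imp_convergent_subsequence by blast
    have zr: "(\<lambda>m. z (r m)) \<longlonglongrightarrow> \<zeta>" using r(2) by (simp add: o_def)
    have imr: "(\<lambda>m. Im (f (z (r m)))) \<longlonglongrightarrow> 0" using LIMSEQ_subseq_LIMSEQ[OF im r(1)] by (simp add: o_def)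
    have "Im \<zeta> \<ge> 0"
      by (rule LIMSEQ_le_const[OF tendsto_Im[OF zr]]) (use z(1) in \<open>auto simp: uhp_iff less_imp_le\<close>)
    moreover have "\<not> Im \<zeta> > 0"
    proof
      assume "Im \<zeta> > 0"
      then have \<zeta>: "\<zeta> \<in> upper_half_plane" by (simp add: uhp_iff)
      have "isCont f \<zeta>" using has_derivative_continuous[OF deriv[OF \<zeta>]] .
      then have "(\<lambda>m. f (z (r m))) \<longlonglongrightarrow> f \<zeta>" using zr isCont_tendsto_compose by blast
      then have "Im (f \<zeta>) = 0" using imr LIMSEQ_unique tendsto_Im by blast
      then show False using Im_pos[OF \<zeta>] by simp
    qed
    ultimately have "Im \<zeta> = 0" by simp
    then have \<zeta>: "\<zeta> = of_real (Re \<zeta>)" by (simp add: complex_eq_iff)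
    have "z m \<noteq> of_real (Re \<zeta>)" for m using z(1)[of m] by (auto simp: uhp_iff complex_eq_iff)
    then have "filterlim (\<lambda>m. z (r m)) (at (of_real (Re \<zeta>)) within upper_half_plane) sequentially"
      unfolding filterlim_at using zr \<zeta> z(1) by auto
    then have "(\<lambda>m. f (z (r m))) \<longlonglongrightarrow> of_real (\<phi> (Re \<zeta>))"
      by (rule filterlim_compose[OF extends_real])
    then have re: "(\<lambda>m. Re (f (z (r m)))) \<longlonglongrightarrow> \<phi> (Re \<zeta>)" using tendsto_Re by fastforce
    have "\<phi> p1 \<le> \<phi> (Re \<zeta>)" "\<phi> (Re \<zeta>) \<le> \<phi> p2"
      using LIMSEQ_le_const[OF re] LIMSEQ_le_const2[OF re] z(2,3) by auto
    then have p: "p1 \<le> Re \<zeta>" "Re \<zeta> \<le> p2" using \<phi>_mono strict_mono_less_eq by blast+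
    have e1: "\<forall>\<^sub>F m in sequentially. c1 < Re (z (r m))"
      by (rule order_tendstoD(1)[OF tendsto_Re[OF zr]]) (use p assms in linarith)
    have e2: "\<forall>\<^sub>F m in sequentially. Re (z (r m)) < c2"
      by (rule order_tendstoD(2)[OF tendsto_Re[OF zr]]) (use p assms in linarith)
    have e3: "\<forall>\<^sub>F m in sequentially. Im (z (r m)) < \<epsilon>"
      by (rule order_tendstoD(2)[OF tendsto_Im[OF zr]]) (use \<open>Im \<zeta> = 0\<close> assms in linarith)
    have "\<forall>\<^sub>F m in sequentially. False"
      using e1 e2 e3 by eventually_elim (use z(5) in force)
    then show False by simp
  qed
  then obtain m :: nat where "\<forall>z\<in>upper_half_plane. \<phi> p1 \<le> Re (f z) \<longrightarrow> Re (f z) \<le> \<phi> p2 \<longrightarrow> Im (f z) < inverse (real (Suc m)) \<longrightarrow> c1 \<le> Re z \<and> Re z \<le> c2 \<and> Im z < \<epsilon>"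
    by blast
  then show ?thesis by (intro that[of "inverse (real (Suc m))"]) auto
qed

text \<open>
  Near every interval of the boundary the surface \<open>S\<close> approaches the graph of \<open>\<phi>\<close>: otherwise
  \<open>Im f / Im z\<close> would tend uniformly to \<open>0\<close> or to \<open>\<infinity>\<close> there, which contradicts the
  preservation of area.
\<close>

lemma angle_not_small:
  assumes c12: "c1 < c2" and K0: "0 \<le> K0" and e0: "0 < e0"
  shows "\<exists>z. c1 \<le> Re z \<and> Re z \<le> c2 \<and> 0 < Im z \<and> Im z < e0 \<and> K0 * max (Im (f z)) (Im z) < \<bar>sin (\<theta> z)\<bar>"
proof (rule ccontr)
  assume "\<not> ?thesis"
  then have small: "\<bar>sin (\<theta> z)\<bar> \<le> K0 * max (Im (f z)) (Im z)" if "c1 \<le> Re z" "Re z \<le> c2" "0 < Im z" "Im z < e0" for z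
    using that by (meson not_le)
  obtain M e1 where M: "M \<ge> 1" "e1 > 0" "\<And>z. \<lbrakk>c1 \<le> Re z; Re z \<le> c2; 0 < Im z; Im z < e1\<rbrakk> \<Longrightarrow> cmod (f z) \<le> M \<and> cmod z \<le> M"
    using f_bounded_strip[of c1 c2] by blast
  define p1 p2 where "p1 = c1 + (c2 - c1) / 3" and "p2 = c1 + 2 * (c2 - c1) / 3"
  have p: "c1 < p1" "p1 < p2" "p2 < c2" unfolding p1_def p2_def using c12 by (auto simp: field_simps)
  have dp: "\<phi> p1 < \<phi> p2" using \<phi>_mono p(2) strict_monoD by blast
  \<comment> \<open>The two summands beyond 1 are chosen against the area bounds of the two cases
    below: an expansion of heights by \<open>K\<close> gives
    \<open>K * (c2 - c1) \<le> 4 * M\<close>, a contraction gives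
    \<open>K * (\<phi> p2 - \<phi> p1) \<le> 2 * (c2 - c1)\<close>.\<close>
  define K where "K = 1 + 4 * M / (c2 - c1) + 2 * (c2 - c1) / (\<phi> p2 - \<phi> p1)"
  have K: "K \<ge> 1" "K * (c2 - c1) > 4 * M" "K * (\<phi> p2 - \<phi> p1) > 2 * (c2 - c1)"
  proof -
    have t: "0 < 4 * M / (c2 - c1)" "0 < 2 * (c2 - c1) / (\<phi> p2 - \<phi> p1)" using M(1) c12 dp by auto
    then show "K \<ge> 1" by (simp add: K_def)
    have "K * (c2 - c1) > (4 * M / (c2 - c1)) * (c2 - c1)"
      using t c12 by (intro mult_strict_right_mono) (auto simp: K_def)
    then show "K * (c2 - c1) > 4 * M" using c12 by simp
    have "K * (\<phi> p2 - \<phi> p1) > (2 * (c2 - c1) / (\<phi> p2 - \<phi> p1)) * (\<phi> p2 - \<phi> p1)"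
      using t dp by (intro mult_strict_right_mono) (auto simp: K_def)
    then show "K * (\<phi> p2 - \<phi> p1) > 2 * (c2 - c1)" using dp by simp
  qed
  obtain KK where KK: "compact KK" "KK \<subseteq> upper_half_plane"
    "\<And>z. z \<in> upper_half_plane \<Longrightarrow> norm (S z) \<le> 4 * (K * (K0 * M\<^sup>2 + 2 * M)) \<Longrightarrow> z \<in> KK"
    using S_bounded_compact by blast
  obtain y where y: "y > 0" "\<And>z. z \<in> KK \<Longrightarrow> y \<le> Im z"
  proof (cases "KK = {}")
    case False
    obtain z0 where "z0 \<in> KK" "\<And>z. z \<in> KK \<Longrightarrow> Im z0 \<le> Im z"
      using continuous_attains_inf[OF KK(1) False continuous_on_Im[OF continuous_on_id]] by blast
    then show ?thesis using that[of "Im z0"] KK(2) by (auto simp: uhp_iff)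
  qed (use that[of 1] in auto)
  define e where "e = min y (min e0 e1)"
  have e: "e > 0" "e \<le> y" "e \<le> e0" "e \<le> e1" using y(1) e0 M(2) by (auto simp: e_def)
  define T where "T = {z. c1 \<le> Re z \<and> Re z \<le> c2 \<and> 0 < Im z \<and> Im z < e}"
  have TU: "z \<in> upper_half_plane" if "z \<in> T" for z using that by (simp add: T_def uhp_iff)
  \<comment> \<open>In the thin strip, comparable heights would bound \<open>S z\<close> by
    \<open>norm_S_le\<close> and place \<open>z\<close> in the compact set \<open>KK\<close>, which
    lies above the strip.\<close>
  have dich: "Im (f z) > K * Im z \<or> Im z > K * Im (f z)" if z: "z \<in> T" for z
  proof (rule ccontr)
    assume "\<not> ?thesis"
    then have "norm (S z) \<le> 4 * (K * (K0 * M\<^sup>2 + 2 * M))"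
      using z e M K(1) small[of z] K0 by (intro norm_S_le TU) (auto simp: T_def)
    then have "z \<in> KK" using KK(3) TU[OF z] by blast
    then show False using y(2)[of z] z e by (auto simp: T_def)
  qed
  have Tconv: "convex T"
  proof -
    have "T = {z. Re z \<ge> c1} \<inter> {z. Re z \<le> c2} \<inter> {z. Im z > 0} \<inter> {z. Im z < e}" by (auto simp: T_def)
    then show ?thesis
      by (simp only:) (intro convex_Int convex_halfspace_Re_ge convex_halfspace_Re_le convex_halfspace_Im_gt convex_halfspace_Im_lt)
  qed
  have pos: "Im z > 0" "Im (f z) > 0" if "z \<in> T" for z using Im_pos TU that by auto
  have Kz: "Im z \<le> K * Im z" "Im (f z) \<le> K * Im (f z)" if z: "z \<in> T" for z
    using pos[OF z] mult_right_mono[OF K(1), of "Im z"] mult_right_mono[OF K(1), of "Im (f z)"] by simp_all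
  have neq: "Im (f z) \<noteq> Im z" if z: "z \<in> T" for z
    using dich[OF z] Kz[OF z] by linarith
  have "(\<forall>z\<in>T. Im (f z) > K * Im z) \<or> (\<forall>z\<in>T. Im z > K * Im (f z))"
  proof (rule ccontr)
    assume "\<not> ?thesis"
    then obtain z1 z2 where z12: "z1 \<in> T" "z2 \<in> T" "\<not> Im (f z1) > K * Im z1" "\<not> Im z2 > K * Im (f z2)" by blast
    have "Im z1 > Im (f z1)" "Im (f z2) > Im z2"
      using dich[OF z12(1)] dich[OF z12(2)] z12(3,4) Kz[OF z12(1)] Kz[OF z12(2)] by linarith+
    then have ord: "Im (f z1) - Im z1 \<le> 0" "0 \<le> Im (f z2) - Im z2" by simp_all
    have conn: "connected ((\<lambda>z. Im (f z) - Im z) ` T)"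
    proof (rule connected_continuous_image[OF _ convex_connected[OF Tconv]])
      have "continuous_on T f" using continuous_on_f TU continuous_on_subset by blast
      then show "continuous_on T (\<lambda>z. Im (f z) - Im z)" by (intro continuous_intros)
    qed
    have "0 \<in> (\<lambda>z. Im (f z) - Im z) ` T"
      by (rule connectedD_interval[OF conn imageI[OF z12(1)] imageI[OF z12(2)] ord])
    then show False using neq by force
  qed
  then show False
  proof
    assume A: "\<forall>z\<in>T. Im (f z) > K * Im z"
    define s where "s = e / 2"
    have s: "s > 0" "s < e" using e by (auto simp: s_def)
    \<comment> \<open>The box of heights between \<open>s / 2\<close> and \<open>s\<close> has area
      \<open>(c2 - c1) / s\<close>; its image lies over \<open>[- M, M]\<close> at heights at least
      \<open>K * s / 2\<close>.\<close>
    have "(c2 - c1) * (2 / s - 1 / s) \<le> (M - - M) * (2 / (K * s) - 0)"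
    proof (rule area_image_le)
      fix z assume z: "z \<in> upper_half_plane" "c1 \<le> Re z" "Re z \<le> c2" "1 / s \<le> 1 / Im z" "1 / Im z \<le> 2 / s"
      have zp: "Im z > 0" using z by (simp add: uhp_iff)
      have z1: "Im z \<le> s" "s / 2 \<le> Im z" using z(4,5) zp s by (auto simp: field_simps)
      then have zT: "z \<in> T" using z s zp by (auto simp: T_def)
      have b: "cmod (f z) \<le> M" using M(3)[of z] z zp z1 s e by auto
      have "K * s / 2 \<le> K * Im z" using z1 K(1) by simp
      then have v: "K * s / 2 \<le> Im (f z)" using A zT by force
      have "1 / Im (f z) \<le> 1 / (K * s / 2)" using v K(1) s by (intro frac_le) auto
      then show "- M \<le> Re (f z) \<and> Re (f z) \<le> M \<and> 0 \<le> 1 / Im (f z) \<and> 1 / Im (f z) \<le> 2 / (K * s)"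
        using b abs_Re_le_cmod[of "f z"] pos[OF zT] by auto
    qed (use c12 s K M in \<open>auto simp: divide_right_mono\<close>)
    then have "(c2 - c1) / s \<le> 4 * M / (K * s)" by (simp add: field_simps)
    then have "((c2 - c1) / s) * (K * s) \<le> (4 * M / (K * s)) * (K * s)"
      using s K(1) by (intro mult_right_mono) auto
    then have "(c2 - c1) * K \<le> 4 * M" using s K(1) by simp
    then show False using K(2) by (simp add: mult.commute)
  next
    assume A: "\<forall>z\<in>T. Im z > K * Im (f z)"
    obtain \<eta> where \<eta>: "\<eta> > 0" "\<And>z. \<lbrakk>z \<in> upper_half_plane; \<phi> p1 \<le> Re (f z); Re (f z) \<le> \<phi> p2; Im (f z) < \<eta>\<rbrakk> \<Longrightarrow> c1 \<le> Re z \<and> Re z \<le> c2 \<and> Im z < e"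
      using near_boundary_preimage[OF p(1) less_imp_le[OF p(2)] p(3) e(1)] by blast
    define s where "s = min (\<eta> / 2) (e / K)"
    have s: "s > 0" "s < \<eta>" "K * s \<le> e" using \<eta>(1) e(1) K(1)
      by (auto simp: s_def min_def field_simps split: if_splits)
    have Ks: "K * s > 0" using K(1) s by simp
    \<comment> \<open>Now the box of heights between \<open>s / 2\<close> and \<open>s\<close> is
      taken in the image, and its preimage has heights at least \<open>K * s / 2\<close>.\<close>
    have "(\<phi> p2 - \<phi> p1) * (2 / s - 1 / s) \<le> (c2 - c1) * (2 / (K * s) - 1 / e)"
    proof (rule area_preimage_le)
      fix z assume z: "z \<in> upper_half_plane" "\<phi> p1 \<le> Re (f z)" "Re (f z) \<le> \<phi> p2" "1 / s \<le> 1 / Im (f z)" "1 / Im (f z) \<le> 2 / s"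
      have vp: "Im (f z) > 0" "Im z > 0" using Im_pos[OF z(1)] by auto
      have v: "Im (f z) \<le> s" "s / 2 \<le> Im (f z)" using z(4,5) vp s by (auto simp: field_simps)
      have zz: "c1 \<le> Re z \<and> Re z \<le> c2 \<and> Im z < e" using \<eta>(2)[OF z(1-3)] v s by linarith
      then have zT: "z \<in> T" using vp by (auto simp: T_def)
      have "K * (s / 2) \<le> K * Im (f z)" using v K(1) by (intro mult_left_mono) auto
      also have "\<dots> < Im z" using A zT by blast
      finally have y: "K * s / 2 \<le> Im z" by simp
      have "1 / Im z \<le> 1 / (K * s / 2)" using y Ks by (intro frac_le) auto
      moreover have "1 / e \<le> 1 / Im z" using zz vp e by (intro frac_le) auto
      ultimately show "c1 \<le> Re z \<and> Re z \<le> c2 \<and> 1 / e \<le> 1 / Im z \<and> 1 / Im z \<le> 2 / (K * s)" using zz by simp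
    next
      have "1 / e \<le> 1 / (K * s)" using s Ks by (intro frac_le) auto
      also have "\<dots> \<le> 2 / (K * s)" using Ks by (intro divide_right_mono) auto
      finally show "1 / e \<le> 2 / (K * s)" .
    qed (use c12 s e dp in \<open>auto simp: divide_right_mono\<close>)
    also have "\<dots> \<le> (c2 - c1) * (2 / (K * s))" using c12 e by (intro mult_left_mono) auto
    finally have "(\<phi> p2 - \<phi> p1) / s \<le> 2 * (c2 - c1) / (K * s)" by (simp add: field_simps)
    then have "((\<phi> p2 - \<phi> p1) / s) * (K * s) \<le> (2 * (c2 - c1) / (K * s)) * (K * s)"
      using Ks by (intro mult_right_mono) auto
    then have "(\<phi> p2 - \<phi> p1) * K \<le> 2 * (c2 - c1)" using s K(1) by simp
    then show False using K(3) by (simp add: mult.commute)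
  qed
qed

text \<open>The matrix of rank one with kernel \<open>b\<close> and image \<open>\<phi> b\<close>:
  the point at infinity that encodes the pair \<open>(b, \<phi> b)\<close> of the graph.\<close>

definition \<xi> :: "real \<Rightarrow> real \<times> real \<times> real \<times> real" where
  "\<xi> b = (1, \<phi> b, b, \<phi> b * b)"

text \<open>The sign \<open>\<epsilon>\<close> accounts for the fact that \<open>S z\<close> and \<open>- S z\<close> are the same isometry.\<close>

definition good :: "real \<Rightarrow> real \<Rightarrow> bool" where
  "good \<epsilon> b \<longleftrightarrow> (\<exists>z. (\<forall>m. z m \<in> upper_half_plane \<and> 0 < \<epsilon> * fst (S (z m))) \<and>
      (\<lambda>m. S (z m) /\<^sub>R fst (S (z m))) \<longlonglongrightarrow> \<xi> b)"

section \<open>Limit points of the surface at infinity and their sign\<close>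

lemma fst_S: "fst (S z) = n z * sin (\<theta> z)"
  by (simp add: S_def imv_def E_def)

lemma S_normalized:
  assumes "z \<in> upper_half_plane" "sin (\<theta> z) \<noteq> 0"
  shows "S z /\<^sub>R fst (S z) = (1, Re (f z) + Im (f z) * (cos (\<theta> z) / sin (\<theta> z)), Re z - Im z * (cos (\<theta> z) / sin (\<theta> z)),
     Re (f z * cnj z) + Im (f z * cnj z) * (cos (\<theta> z) / sin (\<theta> z)))"
proof -
  have "n z \<noteq> 0" using n_pos[OF assms(1)] by simp
  then show ?thesis
    unfolding fst_S using assms(2)
    by (simp add: S_def imv_def E_def mult.assoc field_simps)
qed

text \<open>Along points where the sine dominates the heights by a factor tending to infinity, the
  cotangent terms in \<open>S_normalized\<close> vanish in the limit and only the boundary values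
  remain.\<close>

lemma good_dense:
  assumes c12: "c1 < c2"
  shows "\<exists>b \<epsilon>. c1 \<le> b \<and> b \<le> c2 \<and> \<epsilon> \<in> {1, -1} \<and> good \<epsilon> b"
proof -
  have "\<exists>z. c1 \<le> Re z \<and> Re z \<le> c2 \<and> 0 < Im z \<and> Im z < inverse (real (Suc m)) \<and>
      real (Suc m) * max (Im (f z)) (Im z) < \<bar>sin (\<theta> z)\<bar>" for m :: nat
    by (rule angle_not_small[OF c12]) auto
  then obtain b z r where bz: "c1 \<le> b" "b \<le> c2" "strict_mono r" "\<And>m. z m \<in> upper_half_plane"
     "\<And>m. real (Suc (r m)) * max (Im (f (z m))) (Im (z m)) < \<bar>sin (\<theta> (z m))\<bar>"
     "z \<longlonglongrightarrow> of_real b" "(\<lambda>m. f (z m)) \<longlonglongrightarrow> of_real (\<phi> b)"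
    by (rule boundary_seq) blast
  have s0: "sin (\<theta> (z m)) \<noteq> 0" for m
  proof -
    have "0 \<le> real (Suc (r m)) * max (Im (f (z m))) (Im (z m))" using Im_pos[OF bz(4)[of m]] by simp
    then show ?thesis using bz(5)[of m] by linarith
  qed
  define ct where "ct m = cos (\<theta> (z m)) / sin (\<theta> (z m))" for m
  have inv: "(\<lambda>m. inverse (real (Suc (r m)))) \<longlonglongrightarrow> 0"
    using LIMSEQ_subseq_LIMSEQ[OF LIMSEQ_inverse_real_of_nat bz(3)] by (simp add: o_def)
  have sm: "\<bar>t * ct m\<bar> \<le> inverse (real (Suc (r m)))" if t: "0 \<le> t" "t \<le> max (Im (f (z m))) (Im (z m))" for t m
  proof -
    have "real (Suc (r m)) * t \<le> \<bar>sin (\<theta> (z m))\<bar>"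
      using bz(5)[of m] mult_left_mono[OF t(2), of "real (Suc (r m))"] by linarith
    then have "t \<le> \<bar>sin (\<theta> (z m))\<bar> * inverse (real (Suc (r m)))" by (simp add: field_simps)
    moreover have "\<bar>t * ct m\<bar> \<le> t / \<bar>sin (\<theta> (z m))\<bar>"
    proof -
      have "\<bar>t * ct m\<bar> = t * \<bar>cos (\<theta> (z m))\<bar> / \<bar>sin (\<theta> (z m))\<bar>" using t by (simp add: ct_def abs_mult abs_divide)
      also have "\<dots> \<le> t * 1 / \<bar>sin (\<theta> (z m))\<bar>" using t abs_cos_le_one by (intro divide_right_mono mult_left_mono) auto
      finally show ?thesis by simp
    qed
    moreover have "t / \<bar>sin (\<theta> (z m))\<bar> \<le> inverse (real (Suc (r m)))" if "t \<le> \<bar>sin (\<theta> (z m))\<bar> * inverse (real (Suc (r m)))"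
      using that s0[of m] by (simp add: pos_divide_le_eq mult.commute)
    ultimately show ?thesis by linarith
  qed
  have sm1: "\<bar>Im (f (z m)) * ct m\<bar> \<le> inverse (real (Suc (r m)))" "\<bar>Im (z m) * ct m\<bar> \<le> inverse (real (Suc (r m)))" for m
    using sm[of "Im (f (z m))" m] sm[of "Im (z m)" m] Im_pos[OF bz(4)[of m]] by simp_all
  have l1: "(\<lambda>m. Im (f (z m)) * ct m) \<longlonglongrightarrow> 0"
    by (rule tendsto_rabs_zero_cancel, rule tendsto_sandwich[OF _ _ tendsto_const inv])
       (use sm1 in \<open>simp_all del: of_nat_Suc\<close>)
  have l2: "(\<lambda>m. Im (z m) * ct m) \<longlonglongrightarrow> 0"
    by (rule tendsto_rabs_zero_cancel, rule tendsto_sandwich[OF _ _ tendsto_const inv])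
       (use sm1 in \<open>simp_all del: of_nat_Suc\<close>)
  note lre = tendsto_Re[OF bz(6)] tendsto_Re[OF bz(7)]
  have l3: "(\<lambda>m. Im (f (z m) * cnj (z m)) * ct m) \<longlonglongrightarrow> 0"
  proof -
    have "(\<lambda>m. (Im (f (z m)) * ct m) * Re (z m) - Re (f (z m)) * (Im (z m) * ct m)) \<longlonglongrightarrow> 0 * Re (of_real b) - Re (of_real (\<phi> b)) * 0"
      by (intro tendsto_intros l1 l2 lre)
    then show ?thesis by (simp add: algebra_simps)
  qed
  have lim: "(\<lambda>m. S (z m) /\<^sub>R fst (S (z m))) \<longlonglongrightarrow> \<xi> b"
  proof -
    have "(\<lambda>m. (1, Re (f (z m)) + Im (f (z m)) * ct m, Re (z m) - Im (z m) * ct m,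
       Re (f (z m) * cnj (z m)) + Im (f (z m) * cnj (z m)) * ct m))
       \<longlonglongrightarrow> (1, Re (of_real (\<phi> b)) + 0, Re (of_real b) - 0, Re (of_real (\<phi> b) * cnj (of_real b)) + 0)"
      by (intro tendsto_Pair tendsto_add tendsto_diff tendsto_const l1 l2 l3 lre tendsto_Re tendsto_mult tendsto_cnj bz(6,7))
    then show ?thesis unfolding S_normalized[OF bz(4) s0] ct_def \<xi>_def by simp
  qed
  have ne: "fst (S (z m)) \<noteq> 0" for m using s0[of m] n_pos[OF bz(4)[of m]] unfolding fst_S by simp
  have sub: "good \<epsilon> b" if inf: "infinite {m. 0 < \<epsilon> * fst (S (z m))}" for \<epsilon>
  proof -
    obtain q :: "nat \<Rightarrow> nat" where q: "strict_mono q" "\<And>m. 0 < \<epsilon> * fst (S (z (q m)))"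
      using infinite_enumerate[OF inf] by blast
    show ?thesis unfolding good_def
      using q bz(4) LIMSEQ_subseq_LIMSEQ[OF lim q(1)] by (intro exI[of _ "\<lambda>m. z (q m)"]) (auto simp: o_def)
  qed
  \<comment> \<open>The sign of the first entry cannot be prescribed; one of the two signs occurs
    infinitely often.\<close>
  have "{m. 0 < 1 * fst (S (z m))} \<union> {m. 0 < (-1) * fst (S (z m))} = UNIV"
    using ne by (auto simp: neq_iff)
  then have "infinite {m. 0 < 1 * fst (S (z m))} \<or> infinite {m. 0 < (-1) * fst (S (z m))}"
    using infinite_UNIV_nat by (metis finite_Un)
  then show ?thesis using sub bz(1,2) by blast
qed

lemma good_le:
  assumes g: "good \<epsilon> b" and x: "x \<in> upper_half_plane"
  shows "\<epsilon> * ads (\<xi> b) (S x) \<le> 0"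
proof -
  obtain z where z: "\<And>m. z m \<in> upper_half_plane" "\<And>m. 0 < \<epsilon> * fst (S (z m))"
    "(\<lambda>m. S (z m) /\<^sub>R fst (S (z m))) \<longlonglongrightarrow> \<xi> b"
    using g unfolding good_def by blast
  have "(\<lambda>m. \<epsilon> * ads (S (z m) /\<^sub>R fst (S (z m))) (S x)) \<longlonglongrightarrow> \<epsilon> * ads (\<xi> b) (S x)"
    by (intro tendsto_intros ads.tendsto z(3))
  then show ?thesis
  proof (rule LIMSEQ_le_const2)
    have "\<epsilon> * ads (S (z m) /\<^sub>R fst (S (z m))) (S x) \<le> 0" for m
    proof -
      have "\<epsilon> * ads (S (z m) /\<^sub>R fst (S (z m))) (S x) = (\<epsilon> * fst (S (z m))) * ads (S (z m)) (S x) / (fst (S (z m)))\<^sup>2"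
        unfolding ads.scaleR_left by (simp add: power2_eq_square field_simps)
      moreover have "ads (S (z m)) (S x) \<le> 0" using ads_S_le[OF z(1) x, of m] by linarith
      ultimately show ?thesis using z(2)[of m] by (simp add: mult_pos_neg divide_le_0_iff mult_le_0_iff)
    qed
    then show "\<exists>N. \<forall>m\<ge>N. \<epsilon> * ads (S (z m) /\<^sub>R fst (S (z m))) (S x) \<le> 0" by blast
  qed
qed

lemma ads_\<xi>: "ads (\<xi> b) (\<xi> b') = - ((\<phi> b - \<phi> b') * (b - b') / 2)"
  by (simp add: \<xi>_def field_simps)

lemma ads_\<xi>_neg:
  assumes "b \<noteq> b'"
  shows "ads (\<xi> b) (\<xi> b') < 0"
proof -
  have "(\<phi> b - \<phi> b') * (b - b') > 0"
    using assms strict_monoD[OF \<phi>_mono, of b b'] strict_monoD[OF \<phi>_mono, of b' b]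
    by (cases "b < b'") (auto intro: mult_neg_neg mult_pos_pos)
  then show ?thesis unfolding ads_\<xi> by simp
qed

text \<open>Passing to the limit in \<open>good_le\<close> along points approaching
  \<open>\<xi> b'\<close> gives a sign for the pairing of the two boundary points, and that pairing
  is strictly negative because \<open>\<phi>\<close> is increasing.\<close>

lemma good_sign:
  assumes g: "good \<epsilon> b" and g': "good \<epsilon>' b'" and "b \<noteq> b'" and e: "\<epsilon> \<in> {1, -1}" "\<epsilon>' \<in> {1, -1}"
  shows "\<epsilon> = \<epsilon>'"
proof -
  obtain z where z: "\<And>m. z m \<in> upper_half_plane" "\<And>m. 0 < \<epsilon>' * fst (S (z m))"
    "(\<lambda>m. S (z m) /\<^sub>R fst (S (z m))) \<longlonglongrightarrow> \<xi> b'"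
    using g' unfolding good_def by blast
  have "(\<lambda>m. \<epsilon> * \<epsilon>' * ads (\<xi> b) (S (z m) /\<^sub>R fst (S (z m)))) \<longlonglongrightarrow> \<epsilon> * \<epsilon>' * ads (\<xi> b) (\<xi> b')"
    by (intro tendsto_intros ads.tendsto z(3))
  then have "\<epsilon> * \<epsilon>' * ads (\<xi> b) (\<xi> b') \<le> 0"
  proof (rule LIMSEQ_le_const2)
    have "\<epsilon> * \<epsilon>' * ads (\<xi> b) (S (z m) /\<^sub>R fst (S (z m))) \<le> 0" for m
    proof -
      have "\<epsilon> * \<epsilon>' * ads (\<xi> b) (S (z m) /\<^sub>R fst (S (z m))) = (\<epsilon>' * fst (S (z m))) * (\<epsilon> * ads (\<xi> b) (S (z m))) / (fst (S (z m)))\<^sup>2"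
        unfolding ads.scaleR_right by (simp add: power2_eq_square field_simps)
      then show ?thesis using z(2)[of m] good_le[OF g z(1)[of m]] by (simp add: divide_le_0_iff mult_le_0_iff)
    qed
    then show "\<exists>N. \<forall>m\<ge>N. \<epsilon> * \<epsilon>' * ads (\<xi> b) (S (z m) /\<^sub>R fst (S (z m))) \<le> 0" by blast
  qed
  then show ?thesis using ads_\<xi>_neg[OF \<open>b \<noteq> b'\<close>] e by auto
qed

lemma isCont_ads_\<xi>: "isCont (\<lambda>b. ads (\<xi> b) p) b"
proof -
  have "isCont \<xi> b" unfolding \<xi>_def by (intro continuous_intros \<phi>_isCont)
  then show ?thesis
    by (rule bounded_linear.isCont[OF ads.bounded_linear_left])
qed

text \<open>The sign of a single good point propagates: \<open>good_sign\<close> transfers it to the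
  other good points, these are dense, and \<open>ads (\<xi> b) (S x)\<close> is continuous in
  \<open>b\<close>. Equality would make \<open>S x\<close> a maximiser and hence
  \<open>(f x - \<phi> b) * (x - b)\<close> zero, which is impossible in the half-plane.\<close>

theorem orientation:
  obtains \<epsilon> where "\<epsilon> \<in> {1, -1 :: real}" "\<And>b x. x \<in> upper_half_plane \<Longrightarrow> \<epsilon> * ads (\<xi> b) (S x) < 0"
    "\<And>x. x \<in> upper_half_plane \<Longrightarrow> 0 < \<epsilon> * fst (S x)"
proof -
  obtain b0 \<epsilon> where b0: "\<epsilon> \<in> {1, -1}" "good \<epsilon> b0" using good_dense[of 0 1] by auto
  have le: "\<epsilon> * ads (\<xi> b) (S x) \<le> 0" if x: "x \<in> upper_half_plane" for b x
  proof (rule ccontr)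
    assume "\<not> ?thesis"
    then have "\<epsilon> * ads (\<xi> b) (S x) > 0" by simp
    moreover have "isCont (\<lambda>b. \<epsilon> * ads (\<xi> b) (S x)) b" by (intro continuous_intros isCont_ads_\<xi>)
    ultimately have "\<forall>\<^sub>F t in at b. \<epsilon> * ads (\<xi> t) (S x) > 0"
      unfolding isCont_def by (rule order_tendstoD(1)[rotated])
    then obtain d where d: "d > 0" "\<And>t. t \<noteq> b \<Longrightarrow> dist t b < d \<Longrightarrow> \<epsilon> * ads (\<xi> t) (S x) > 0"
      unfolding eventually_at by auto
    \<comment> \<open>The interval avoids \<open>b0\<close>, since \<open>good_sign\<close> compares
      distinct boundary points.\<close>
    obtain c1 c2 where c: "c1 < c2" "\<And>t. c1 \<le> t \<Longrightarrow> t \<le> c2 \<Longrightarrow> t \<noteq> b \<and> dist t b < d \<and> t \<noteq> b0"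
    proof (cases "b \<ge> b0")
      case True
      show ?thesis by (rule that[of "b + d/3" "b + d/2"]) (use True d(1) in \<open>auto simp: dist_real_def\<close>)
    next
      case False
      show ?thesis by (rule that[of "b - d/2" "b - d/3"]) (use False d(1) in \<open>auto simp: dist_real_def\<close>)
    qed
    obtain t \<epsilon>' where t: "c1 \<le> t" "t \<le> c2" "\<epsilon>' \<in> {1, -1}" "good \<epsilon>' t" using good_dense[OF c(1)] by blast
    then have "\<epsilon>' = \<epsilon>" using good_sign[OF t(4) b0(2)] c(2) b0(1) by blast
    then show False using good_le[OF _ x, of \<epsilon> t] t d(2)[of t] c(2)[of t] by force
  qed
  have lt: "\<epsilon> * ads (\<xi> b) (S x) < 0" if x: "x \<in> upper_half_plane" for b x
  proof (rule ccontr)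
    assume "\<not> ?thesis"
    then have z: "\<epsilon> * ads (\<xi> b) (S x) = 0" using le[OF x, of b] by linarith
    have e\<xi>: "ads (\<epsilon>, \<epsilon> * \<phi> b, \<epsilon> * b, \<epsilon> * (\<phi> b * b)) p = \<epsilon> * ads (\<xi> b) p" for p
      using ads.scaleR_left[of \<epsilon> "\<xi> b" p] by (simp add: \<xi>_def)
    have "(\<epsilon> * \<phi> b) * x + (\<epsilon> * b) * f x - (\<epsilon> * (\<phi> b * b)) - \<epsilon> * f x * x = 0"
      using ads_S_critical[OF x, of \<epsilon> "\<epsilon> * \<phi> b" "\<epsilon> * b" "\<epsilon> * (\<phi> b * b)"] le z unfolding e\<xi> by simp
    moreover have "(\<epsilon> * \<phi> b) * x + (\<epsilon> * b) * f x - (\<epsilon> * (\<phi> b * b)) - \<epsilon> * f x * x = - (\<epsilon> * ((f x - \<phi> b) * (x - b)))"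
      by (simp add: algebra_simps)
    ultimately have "(f x - \<phi> b) * (x - b) = 0" using b0(1) by auto
    then have "Im (f x) = 0 \<or> Im x = 0" by auto
    then show False using Im_pos[OF x] by auto
  qed
  have inf: "filterlim \<phi> at_top at_top"
    unfolding filterlim_at_top_ge[where c=0]
  proof (intro allI impI)
    fix Z :: real
    obtain b where "\<phi> b = Z" using \<phi>_surj by (metis surjD)
    show "\<forall>\<^sub>F x in at_top. Z \<le> \<phi> x"
      by (rule eventually_mono[OF eventually_ge_at_top[of b]]) (use \<open>\<phi> b = Z\<close> strict_mono_less_eq[OF \<phi>_mono] in blast)
  qed
  \<comment> \<open>The first entry is a pairing with the boundary point at infinity:
    \<open>\<xi> b\<close> divided by \<open>b * \<phi> b\<close> tends to
    \<open>(0, 0, 0, 1)\<close>, whose pairing with \<open>p\<close> is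
    \<open>- fst p / 2\<close>.\<close>
  have e0: "0 \<le> \<epsilon> * fst (S x)" if x: "x \<in> upper_half_plane" for x
  proof -
    obtain s0 s1 s2 s3 where S: "S x = (s0, s1, s2, s3)" by (cases "S x")
    have i1: "((\<lambda>b::real. inverse b) \<longlongrightarrow> 0) at_top" by (rule tendsto_inverse_0_at_top[OF filterlim_ident])
    have i2: "((\<lambda>b::real. inverse (\<phi> b)) \<longlongrightarrow> 0) at_top" by (rule tendsto_inverse_0_at_top[OF inf])
    have "((\<lambda>b. \<epsilon> * ((inverse b * s2 + inverse (\<phi> b) * s1 - s0 - inverse b * inverse (\<phi> b) * s3) / 2)) \<longlongrightarrow>
        \<epsilon> * ((0 * s2 + 0 * s1 - s0 - 0 * 0 * s3) / 2)) at_top"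
      by (intro tendsto_intros i1 i2) simp_all
    moreover have "\<forall>\<^sub>F b in at_top. \<epsilon> * ((inverse b * s2 + inverse (\<phi> b) * s1 - s0 - inverse b * inverse (\<phi> b) * s3) / 2) \<le> 0"
      using eventually_gt_at_top[of 0] filterlim_at_top_dense[THEN iffD1, OF inf, rule_format, of 0]
    proof eventually_elim
      case (elim b)
      have "\<epsilon> * ((inverse b * s2 + inverse (\<phi> b) * s1 - s0 - inverse b * inverse (\<phi> b) * s3) / 2) = \<epsilon> * ads (\<xi> b) (S x) / (b * \<phi> b)"
        unfolding S \<xi>_def using elim by (simp add: field_simps)
      then show ?case using le[OF x, of b] elim by (simp add: divide_le_0_iff)
    qed
    ultimately have "\<epsilon> * ((0 * s2 + 0 * s1 - s0 - 0 * 0 * s3) / 2) \<le> 0"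
      by (rule tendsto_upperbound) simp
    then show ?thesis unfolding S by simp
  qed
  have "0 < \<epsilon> * fst (S x)" if x: "x \<in> upper_half_plane" for x
  proof (rule ccontr)
    assume "\<not> ?thesis"
    then have z: "\<epsilon> * fst (S x) = 0" using e0[OF x] by linarith
    have e\<xi>: "ads (0, 0, 0, \<epsilon>) p = - (\<epsilon> * fst p) / 2" for p by (cases p) simp
    have "complex_of_real 0 * x + of_real 0 * f x - of_real \<epsilon> - of_real 0 * f x * x = 0"
      by (rule ads_S_critical[OF x, of 0 0 0 \<epsilon>]) (unfold e\<xi> z, use e0 in simp)
    then show False using b0(1) by auto
  qed
  then show ?thesis using that b0(1) lt by blast
qed

end

section \<open>Uniqueness\<close>

lemma second_derivative_at_max:
  fixes h :: "real \<Rightarrow> real"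
  assumes d: "0 < \<delta>" and h1: "\<And>t. \<bar>t\<bar> < \<delta> \<Longrightarrow> (h has_real_derivative h1 t) (at t)"
    and h2: "(h1 has_real_derivative h2) (at 0)" and max: "\<And>t. \<bar>t\<bar> < \<delta> \<Longrightarrow> h t \<le> h 0"
  shows "h2 \<le> 0"
proof (rule ccontr)
  assume "\<not> h2 \<le> 0"
  then have "h2 > 0" by simp
  have h10: "h1 0 = 0"
    by (rule DERIV_local_max[OF h1 d]) (use d max in auto)
  obtain e where e: "e > 0" "\<And>s. 0 < s \<Longrightarrow> s < e \<Longrightarrow> h1 0 < h1 (0 + s)"
    using DERIV_pos_inc_right[OF h2 \<open>h2 > 0\<close>] by auto
  define t where "t = min \<delta> e / 2"
  have t: "t > 0" "t < \<delta>" "t < e" using d e(1) by (auto simp: t_def)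
  obtain s where s: "0 < s" "s < t" "h t - h 0 = (t - 0) * h1 s"
    using MVT2[OF t(1), of h h1] h1 t by (metis abs_of_nonneg less_le_trans less_trans less_imp_le not_less)
  have "h1 s > 0" using e(2)[of s] s t h10 by simp
  then have "h t > h 0" using s(3) t(1) by (metis diff_gt_0_iff_gt diff_zero mult_pos_pos)
  then show False using max[of t] t by simp
qed

lemma has_vector_derivative_along:
  assumes "(F has_derivative D) (at (x + t *\<^sub>R e))"
  shows "((\<lambda>t. F (x + t *\<^sub>R e)) has_vector_derivative D e) (at t)"
proof -
  have "((\<lambda>t. x + t *\<^sub>R e) has_derivative (\<lambda>s. s *\<^sub>R e)) (at t)"
    by (auto intro!: derivative_eq_intros)
  from has_derivative_compose[OF this assms]
  show ?thesis
    unfolding has_vector_derivative_def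
    by (rule has_derivative_eq_rhs) (simp add: linear_scale[OF has_derivative_linear[OF assms]] fun_eq_iff)
qed

text \<open>Converse of \<open>mob_coincide\<close>: a real quadratic with a root in the half-plane
  has nonpositive discriminant.\<close>

lemma ads_mob_fixed:
  assumes p: "ads (a, b, c, d) (a, b, c, d) = -1" and p': "ads (a', b', c', d') (a', b', c', d') = -1"
    and z: "z \<in> upper_half_plane" and eq: "mob (a, b, c, d) z = mob (a', b', c', d') z"
  shows "\<bar>ads (a, b, c, d) (a', b', c', d')\<bar> \<le> 1"
proof -
  define A where "A = b * a' - b' * a"
  define B where "B = b' * c + d' * a - b * c' - d * a'"
  define C where "C = d * c' - d' * c"
  define t where "t = ads (a, b, c, d) (a', b', c', d')"
  have det: "b * c - a * d = -1" "b' * c' - a' * d' = -1" using p p' by (simp_all add: algebra_simps)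
  have "B\<^sup>2 - 4 * A * C = (2 * t)\<^sup>2 - 4 * ((b * c - a * d) * (b' * c' - a' * d'))"
    unfolding A_def B_def C_def t_def by (simp add: power2_eq_square field_simps)
  then have disc: "B\<^sup>2 - 4 * A * C = 4 * t\<^sup>2 - 4" unfolding det by (simp add: power_mult_distrib)
  have y: "Im z > 0" using z by (simp add: uhp_iff)
  note nz = Im_mob(1)[OF p y] Im_mob(1)[OF p' y]
  have "(b * z - d) * (a' * z - c') - (b' * z - d') * (a * z - c) = A * z\<^sup>2 + B * z + C"
    unfolding A_def B_def C_def by (simp add: power2_eq_square algebra_simps)
  then have root: "A * z\<^sup>2 + B * z + C = 0"
    using eq nz unfolding mob_Pair by (simp add: frac_eq_eq)
  have "Im (A * z\<^sup>2 + B * z + C) = 0" "Re (A * z\<^sup>2 + B * z + C) = 0" unfolding root by simp_all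
  then have 1: "Im z * (2 * A * Re z + B) = 0" and 2: "A * ((Re z)\<^sup>2 - (Im z)\<^sup>2) + B * Re z + C = 0"
    by (simp_all add: power2_eq_square algebra_simps)
  have B: "B = - 2 * A * Re z" using 1 y by simp
  have C: "C = A * ((Re z)\<^sup>2 + (Im z)\<^sup>2)" using 2 unfolding B by (simp add: power2_eq_square algebra_simps)
  have "B\<^sup>2 - 4 * A * C = - (2 * A * Im z)\<^sup>2" unfolding B C by (simp add: power2_eq_square algebra_simps)
  then have "t\<^sup>2 \<le> 1" using disc by (smt (verit) zero_le_power2)
  then show ?thesis unfolding t_def by (simp add: abs_square_le_1)
qed

section \<open>Comparison of two surfaces with the same boundary map\<close>

locale two_ml = A: boundary_ml f f' \<theta> \<rho> c \<phi> + B: boundary_ml g g' \<theta>' \<sigma> k \<phi>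
  for f f' \<theta> \<rho> c g g' \<theta>' \<sigma> k \<phi>
begin

text \<open>With \<open>d\<close> the hyperbolic distance,
  \<open>m = 4 * cosh (d (f x) (g y) / 2) * cosh (d x y / 2)\<close>; hence the bound 4 and its
  equality case.\<close>

lemma mixed_lower:
  assumes x: "x \<in> upper_half_plane" and y: "y \<in> upper_half_plane"
  defines "m \<equiv> A.n x * B.n y * cmod (f x - cnj (g y)) * cmod (x - cnj y)"
  shows "4 \<le> m" "m \<le> 4 \<Longrightarrow> x = y \<and> f x = g y"
proof -
  have cj: "(cmod (a - cnj b))\<^sup>2 = (cmod (a - b))\<^sup>2 + 4 * (Im a * Im b)" for a b
    unfolding cmod_power2 by (simp add: power2_eq_square algebra_simps)
  note pos = A.Im_pos[OF x] B.Im_pos[OF y]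
  define P Q where "P = Im (f x) * Im (g y)" and "Q = Im x * Im y"
  have PQ: "P > 0" "Q > 0" using pos by (simp_all add: P_def Q_def)
  define a b where "a = (cmod (f x - g y))\<^sup>2" and "b = (cmod (x - y))\<^sup>2"
  have ab: "a \<ge> 0" "b \<ge> 0" by (simp_all add: a_def b_def)
  have nn: "(A.n x * B.n y)\<^sup>2 * (P * Q) = 1"
  proof -
    have "(A.n x * B.n y)\<^sup>2 * (P * Q) = (A.n x * A.n x * (Im (f x) * Im x)) * (B.n y * B.n y * (Im (g y) * Im y))"
      by (simp add: P_def Q_def power2_eq_square algebra_simps)
    then show ?thesis using A.n_sq[OF x] B.n_sq[OF y] by simp
  qed
  have m2: "m\<^sup>2 = (A.n x * B.n y)\<^sup>2 * ((a + 4 * P) * (b + 4 * Q))"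
    unfolding m_def power_mult_distrib cj P_def Q_def a_def b_def by (simp add: algebra_simps)
  have exp: "(a + 4 * P) * (b + 4 * Q) = 16 * (P * Q) + (a * b + 4 * (a * Q) + 4 * (P * b))"
    by (simp add: algebra_simps)
  have m2': "m\<^sup>2 = 16 + (A.n x * B.n y)\<^sup>2 * (a * b + 4 * (a * Q) + 4 * (P * b))"
    unfolding m2 exp using nn by (simp add: algebra_simps)
  have npos: "A.n x * B.n y > 0" using A.n_pos[OF x] B.n_pos[OF y] by simp
  have m0: "m \<ge> 0" unfolding m_def using npos by simp
  have rest: "0 \<le> a * b + 4 * (a * Q) + 4 * (P * b)" using ab PQ by simp
  have "4\<^sup>2 \<le> m\<^sup>2" unfolding m2' using mult_nonneg_nonneg[OF zero_le_power2 rest, of "A.n x * B.n y"] by simp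
  then show "4 \<le> m" using m0 by (rule power2_le_imp_le)
  assume "m \<le> 4"
  then have "m\<^sup>2 \<le> 4\<^sup>2" using m0 by (rule power_mono)
  then have "(A.n x * B.n y)\<^sup>2 * (a * b + 4 * (a * Q) + 4 * (P * b)) \<le> 0" unfolding m2' by simp
  then have "a * b + 4 * (a * Q) + 4 * (P * b) \<le> 0" using npos by (metis mult_pos_pos not_le zero_less_power)
  moreover have "0 \<le> a * b" "0 \<le> a * Q" "0 \<le> P * b" using ab PQ by simp_all
  ultimately have "a * Q = 0" "P * b = 0" by linarith+
  then show "x = y \<and> f x = g y" using PQ by (simp add: a_def b_def)
qed

text \<open>For the frames \<open>(1, \<i>)\<close> and \<open>(q, \<i> * q)\<close> the complex
  bilinear part of \<open>ads_imv\<close> cancels in the sum and the sesquilinear part doubles. The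
  unit number \<open>q\<close> is chosen to turn that part into its modulus with the sign
  \<open>\<epsilon>\<close>, the largest possible value.\<close>

lemma mixed_frames:
  assumes x: "x \<in> upper_half_plane" and y: "y \<in> upper_half_plane" and e: "\<epsilon> \<in> {1, -1 :: real}"
  obtains e1 e2 d1 d2 where "A.\<beta> x e1 = 1" "A.\<beta> x e2 = \<i>"
    "(B.\<beta> y d1)\<^sup>2 + (B.\<beta> y d2)\<^sup>2 = 0" "(cmod (B.\<beta> y d1))\<^sup>2 + (cmod (B.\<beta> y d2))\<^sup>2 = 2"
    "2 * \<epsilon> * (ads (imv (A.\<beta> x e1 * A.n x) (f x) x) (imv (B.\<beta> y d1 * B.n y) (g y) y)
      + ads (imv (A.\<beta> x e2 * A.n x) (f x) x) (imv (B.\<beta> y d2 * B.n y) (g y) y))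
     = A.n x * B.n y * cmod (f x - cnj (g y)) * cmod (x - cnj y)"
proof -
  define P where "P = (f x - cnj (g y)) * (x - cnj y)"
  have "P \<noteq> 0"
  proof -
    have "Im (f x - cnj (g y)) > 0" "Im (x - cnj y) > 0" using A.Im_pos[OF x] B.Im_pos[OF y] by auto
    then have "f x - cnj (g y) \<noteq> 0" "x - cnj y \<noteq> 0" by (metis less_irrefl zero_complex.sel(2))+
    then show ?thesis by (simp add: P_def)
  qed
  then have P: "cmod P > 0" by simp
  define q where "q = - of_real \<epsilon> * P / of_real (cmod P)"
  have e2: "\<epsilon> * \<epsilon> = 1" "\<bar>\<epsilon>\<bar> = 1" using e by auto
  have q1: "cmod q = 1" unfolding q_def using P e2 by (simp add: norm_mult norm_divide)
  have PP: "P * cnj P = of_real (cmod P) * of_real (cmod P)"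
    by (simp only: complex_norm_square[symmetric] power2_eq_square of_real_mult)
  have qP: "cnj q * P = - of_real (\<epsilon> * cmod P)"
  proof -
    have "cnj q * P = - of_real \<epsilon> * (P * cnj P) / of_real (cmod P)" by (simp add: q_def)
    then show ?thesis unfolding PP using P by simp
  qed
  obtain e1 where e1: "A.\<beta> x e1 = 1" using A.\<beta>_surj[OF x] by blast
  obtain e2' where e2': "A.\<beta> x e2' = \<i>" using A.\<beta>_surj[OF x] by blast
  obtain d1 where d1: "B.\<beta> y d1 = q" using B.\<beta>_surj[OF y] by blast
  obtain d2 where d2: "B.\<beta> y d2 = \<i> * q" using B.\<beta>_surj[OF y] by blast
  show ?thesis
  proof (rule that[OF e1 e2', of d1 d2])
    show "(B.\<beta> y d1)\<^sup>2 + (B.\<beta> y d2)\<^sup>2 = 0" unfolding d1 d2 by (simp add: power_mult_distrib)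
    show "(cmod (B.\<beta> y d1))\<^sup>2 + (cmod (B.\<beta> y d2))\<^sup>2 = 2" unfolding d1 d2 using q1 by (simp add: norm_mult)
    define T where "T = (f x - g y) * (x - y)"
    have Re1: "k * (f x - g y) * (x - y) - l * (f x - cnj (g y)) * (x - cnj y) = k * T - l * P" for k l
      by (simp add: T_def P_def algebra_simps)
    have "ads (imv (A.\<beta> x e1 * A.n x) (f x) x) (imv (B.\<beta> y d1 * B.n y) (g y) y)
      + ads (imv (A.\<beta> x e2' * A.n x) (f x) x) (imv (B.\<beta> y d2 * B.n y) (g y) y)
      = Re ((A.n x * (q * B.n y)) * T - (A.n x * (cnj q * B.n y)) * P
          + ((\<i> * A.n x * (\<i> * q * B.n y)) * T - (\<i> * A.n x * cnj (\<i> * q * B.n y)) * P)) / 4"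
      unfolding ads_imv Re1 e1 e2' d1 d2 by (simp add: field_simps)
    also have "\<dots> = Re (- 2 * (A.n x * B.n y) * (cnj q * P)) / 4"
      by (simp add: algebra_simps)
    also have "\<dots> = \<epsilon> * (A.n x * B.n y * cmod P) / 2"
      unfolding qP by simp
    finally have *: "ads (imv (A.\<beta> x e1 * A.n x) (f x) x) (imv (B.\<beta> y d1 * B.n y) (g y) y)
      + ads (imv (A.\<beta> x e2' * A.n x) (f x) x) (imv (B.\<beta> y d2 * B.n y) (g y) y) = \<epsilon> * (A.n x * B.n y * cmod P) / 2" .
    have "2 * \<epsilon> * (\<epsilon> * (A.n x * B.n y * cmod P) / 2) = (\<epsilon> * \<epsilon>) * (A.n x * B.n y * cmod P)" by simp
    then show "2 * \<epsilon> * (ads (imv (A.\<beta> x e1 * A.n x) (f x) x) (imv (B.\<beta> y d1 * B.n y) (g y) y)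
      + ads (imv (A.\<beta> x e2' * A.n x) (f x) x) (imv (B.\<beta> y d2 * B.n y) (g y) y))
     = A.n x * B.n y * cmod (f x - cnj (g y)) * cmod (x - cnj y)"
      unfolding * e2(1) by (simp add: P_def norm_mult)
  qed
qed

text \<open>The second-order condition is summed over two motions that move both points along
  matched orthonormal frames. By \<open>frame_trace\<close> the second derivatives are twice the
  points plus tangent vectors, and the tangent vectors drop out by the first-order conditions
  \<open>critx\<close> and \<open>crity\<close>. The pairing contributes the left side, each barrier
  at most \<open>2 * \<eta>\<close>.\<close>

lemma max_principle:
  assumes x: "x \<in> upper_half_plane" and y: "y \<in> upper_half_plane" and e: "\<epsilon> \<in> {1, -1 :: real}" and \<eta>: "0 \<le> \<eta>"
    and p0: "\<And>x. x \<in> upper_half_plane \<Longrightarrow> ads p0 (A.S x) < 0" and q0: "\<And>y. y \<in> upper_half_plane \<Longrightarrow> ads q0 (B.S y) < 0"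
    and max: "\<And>x' y'. \<lbrakk>x' \<in> upper_half_plane; y' \<in> upper_half_plane\<rbrakk> \<Longrightarrow>
      \<epsilon> * ads (A.S x') (B.S y') - \<eta> * (ln (- ads p0 (A.S x')) + ln (- ads q0 (B.S y')))
      \<le> \<epsilon> * ads (A.S x) (B.S y) - \<eta> * (ln (- ads p0 (A.S x)) + ln (- ads q0 (B.S y)))"
  shows "4 * (\<epsilon> * ads (A.S x) (B.S y)) + A.n x * B.n y * cmod (f x - cnj (g y)) * cmod (x - cnj y) \<le> 4 * \<eta>"
proof -
  define dA where "dA v w = imv (A.\<beta> w v * A.n w) (f w) w" for v w
  define dB where "dB v w = imv (B.\<beta> w v * B.n w) (g w) w" for v w
  let ?a = "A.S x" and ?b = "B.S y"
  have critx: "\<epsilon> * ads (dA v x) ?b - \<eta> * (ads p0 (dA v x) / ads p0 ?a) = 0" for v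
  proof -
    have d: "(A.S has_derivative (\<lambda>v. dA v x)) (at x)" unfolding dA_def by (rule A.S_deriv[OF x])
    have "((\<lambda>x'. \<epsilon> * ads (A.S x') ?b - \<eta> * (ln (- ads p0 (A.S x')) + ln (- ads q0 ?b))) has_derivative
        (\<lambda>v. \<epsilon> * ads (dA v x) ?b - \<eta> * (ads p0 (dA v x) / ads p0 ?a))) (at x)"
      using p0[OF x]
      by (auto intro!: derivative_eq_intros bounded_linear.has_derivative[OF ads.bounded_linear_left d]
          bounded_linear.has_derivative[OF ads.bounded_linear_right d] simp: field_simps)
    then have "(\<lambda>v. \<epsilon> * ads (dA v x) ?b - \<eta> * (ads p0 (dA v x) / ads p0 ?a)) = (\<lambda>v. 0)"
      by (rule differential_zero_maxmin[OF x open_uhp]) (use max[OF _ y] in blast)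
    then show ?thesis by (rule fun_cong)
  qed
  have crity: "\<epsilon> * ads ?a (dB v y) - \<eta> * (ads q0 (dB v y) / ads q0 ?b) = 0" for v
  proof -
    have d: "(B.S has_derivative (\<lambda>v. dB v y)) (at y)" unfolding dB_def by (rule B.S_deriv[OF y])
    have "((\<lambda>y'. \<epsilon> * ads ?a (B.S y') - \<eta> * (ln (- ads p0 ?a) + ln (- ads q0 (B.S y')))) has_derivative
        (\<lambda>v. \<epsilon> * ads ?a (dB v y) - \<eta> * (ads q0 (dB v y) / ads q0 ?b))) (at y)"
      using q0[OF y]
      by (auto intro!: derivative_eq_intros
          bounded_linear.has_derivative[OF ads.bounded_linear_right d] simp: field_simps)
    then have "(\<lambda>v. \<epsilon> * ads ?a (dB v y) - \<eta> * (ads q0 (dB v y) / ads q0 ?b)) = (\<lambda>v. 0)"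
      by (rule differential_zero_maxmin[OF y open_uhp]) (use max[OF x] in blast)
    then show ?thesis by (rule fun_cong)
  qed
  have second: "\<epsilon> * (ads (GA e) ?b + 2 * ads (dA e x) (dB d y) + ads ?a (GB d))
      - \<eta> * ((ads p0 (GA e) / ads p0 ?a - (ads p0 (dA e x) / ads p0 ?a)\<^sup>2) + (ads q0 (GB d) / ads q0 ?b - (ads q0 (dB d y) / ads q0 ?b)\<^sup>2)) \<le> 0"
    if GA: "(dA e has_derivative GA) (at x)" and GB: "(dB d has_derivative GB) (at y)" for e d GA GB
  proof -
    obtain r1 where r1: "r1 > 0" "ball x r1 \<subseteq> upper_half_plane" using open_uhp x open_contains_ball by blast
    obtain r2 where r2: "r2 > 0" "ball y r2 \<subseteq> upper_half_plane" using open_uhp y open_contains_ball by blast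
    define \<delta> where "\<delta> = min r1 r2 / (1 + norm e + norm d)"
    have pos: "1 + norm e + norm d > 0" by (meson add_pos_nonneg norm_ge_zero zero_less_one)
    have \<delta>: "\<delta> > 0" using r1 r2 pos by (simp add: \<delta>_def)
    have U: "x + t *\<^sub>R e \<in> upper_half_plane" "y + t *\<^sub>R d \<in> upper_half_plane" if t: "\<bar>t\<bar> < \<delta>" for t
    proof -
      have "\<bar>t\<bar> * (1 + norm e + norm d) < min r1 r2" using t pos by (simp add: \<delta>_def pos_less_divide_eq)
      moreover have "\<bar>t\<bar> * norm e \<le> \<bar>t\<bar> * (1 + norm e + norm d)" "\<bar>t\<bar> * norm d \<le> \<bar>t\<bar> * (1 + norm e + norm d)"
        by (intro mult_left_mono; simp)+
      ultimately have "norm (t *\<^sub>R e) < r1" "norm (t *\<^sub>R d) < r2" by auto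
      then have "x + t *\<^sub>R e \<in> ball x r1" "y + t *\<^sub>R d \<in> ball y r2" by (simp_all add: dist_norm)
      then show "x + t *\<^sub>R e \<in> upper_half_plane" "y + t *\<^sub>R d \<in> upper_half_plane" using r1 r2 by blast+
    qed
    define a where "a t = A.S (x + t *\<^sub>R e)" for t
    define b where "b t = B.S (y + t *\<^sub>R d)" for t
    define a1 where "a1 t = dA e (x + t *\<^sub>R e)" for t
    define b1 where "b1 t = dB d (y + t *\<^sub>R d)" for t
    have a': "(a has_vector_derivative a1 t) (at t)" if "\<bar>t\<bar> < \<delta>" for t
      unfolding a_def[abs_def] a1_def dA_def by (rule has_vector_derivative_along[OF A.S_deriv[OF U(1)[OF that]]])
    have b': "(b has_vector_derivative b1 t) (at t)" if "\<bar>t\<bar> < \<delta>" for t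
      unfolding b_def[abs_def] b1_def dB_def by (rule has_vector_derivative_along[OF B.S_deriv[OF U(2)[OF that]]])
    have a1': "(a1 has_vector_derivative GA e) (at 0)"
      unfolding a1_def[abs_def] by (rule has_vector_derivative_along) (use GA in simp)
    have b1': "(b1 has_vector_derivative GB d) (at 0)"
      unfolding b1_def[abs_def] by (rule has_vector_derivative_along) (use GB in simp)
    have pa: "ads p0 (a t) < 0" and qb: "ads q0 (b t) < 0" if "\<bar>t\<bar> < \<delta>" for t
      unfolding a_def b_def using p0 q0 U[OF that] by auto
    note bil = bounded_bilinear.has_vector_derivative[OF bounded_bilinear_ads]
    note lr = bounded_linear.has_vector_derivative[OF ads.bounded_linear_right]
    define h where "h t = \<epsilon> * ads (a t) (b t) - \<eta> * (ln (- ads p0 (a t)) + ln (- ads q0 (b t)))" for t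
    define h1 where "h1 t = \<epsilon> * (ads (a t) (b1 t) + ads (a1 t) (b t)) - \<eta> * (ads p0 (a1 t) / ads p0 (a t) + ads q0 (b1 t) / ads q0 (b t))" for t
    have hd: "(h has_real_derivative h1 t) (at t)" if t: "\<bar>t\<bar> < \<delta>" for t
    proof -
      have 1: "((\<lambda>t. ads (a t) (b t)) has_real_derivative (ads (a t) (b1 t) + ads (a1 t) (b t))) (at t)"
        "((\<lambda>t. ads p0 (a t)) has_real_derivative ads p0 (a1 t)) (at t)"
        "((\<lambda>t. ads q0 (b t)) has_real_derivative ads q0 (b1 t)) (at t)"
        unfolding has_real_derivative_iff_has_vector_derivative
        using bil[OF a'[OF t] b'[OF t]] lr[OF a'[OF t]] lr[OF b'[OF t]] by auto
      show ?thesis unfolding h_def[abs_def] h1_def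
        using pa[OF t] qb[OF t] by (auto intro!: derivative_eq_intros 1 simp: field_simps)
    qed
    define h2 where "h2 = \<epsilon> * ((ads (a 0) (GB d) + ads (a1 0) (b1 0)) + (ads (a1 0) (b1 0) + ads (GA e) (b 0)))
       - \<eta> * ((ads p0 (GA e) * ads p0 (a 0) - ads p0 (a1 0) * ads p0 (a1 0)) / (ads p0 (a 0) * ads p0 (a 0))
         + (ads q0 (GB d) * ads q0 (b 0) - ads q0 (b1 0) * ads q0 (b1 0)) / (ads q0 (b 0) * ads q0 (b 0)))"
    have z: "\<bar>0\<bar> < \<delta>" using \<delta> by simp
    have h1d: "(h1 has_real_derivative h2) (at 0)"
    proof -
      have 1: "((\<lambda>t. ads (a t) (b1 t)) has_real_derivative (ads (a 0) (GB d) + ads (a1 0) (b1 0))) (at 0)"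
        "((\<lambda>t. ads (a1 t) (b t)) has_real_derivative (ads (a1 0) (b1 0) + ads (GA e) (b 0))) (at 0)"
        "((\<lambda>t. ads p0 (a t)) has_real_derivative ads p0 (a1 0)) (at 0)"
        "((\<lambda>t. ads q0 (b t)) has_real_derivative ads q0 (b1 0)) (at 0)"
        "((\<lambda>t. ads p0 (a1 t)) has_real_derivative ads p0 (GA e)) (at 0)"
        "((\<lambda>t. ads q0 (b1 t)) has_real_derivative ads q0 (GB d)) (at 0)"
        unfolding has_real_derivative_iff_has_vector_derivative
        using bil[OF a'[OF z] b1'] bil[OF a1' b'[OF z]] lr[OF a'[OF z]] lr[OF b'[OF z]] lr[OF a1'] lr[OF b1'] by auto
      have nz: "ads p0 (a 0) \<noteq> 0" "ads q0 (b 0) \<noteq> 0" using pa[OF z] qb[OF z] by auto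
      show ?thesis unfolding h1_def[abs_def] h2_def
        by (intro DERIV_diff DERIV_cmult DERIV_add DERIV_divide 1 nz)
    qed
    have "h2 \<le> 0"
    proof (rule second_derivative_at_max[OF \<delta> hd h1d])
      show "h t \<le> h 0" if "\<bar>t\<bar> < \<delta>" for t
        unfolding h_def a_def b_def using max[OF U[OF that]] by simp
    qed
    moreover have "a 0 = ?a" "b 0 = ?b" "a1 0 = dA e x" "b1 0 = dB d y"
      by (simp_all add: a_def b_def a1_def b1_def)
    ultimately show ?thesis
      using p0[OF x] q0[OF y] unfolding h2_def by (simp add: power2_eq_square diff_divide_distrib algebra_simps)
  qed
  obtain e1 e2 d1 d2 where fr: "A.\<beta> x e1 = 1" "A.\<beta> x e2 = \<i>"
    "(B.\<beta> y d1)\<^sup>2 + (B.\<beta> y d2)\<^sup>2 = 0" "(cmod (B.\<beta> y d1))\<^sup>2 + (cmod (B.\<beta> y d2))\<^sup>2 = 2"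
    "2 * \<epsilon> * (ads (dA e1 x) (dB d1 y) + ads (dA e2 x) (dB d2 y))
     = A.n x * B.n y * cmod (f x - cnj (g y)) * cmod (x - cnj y)"
    unfolding dA_def dB_def by (rule mixed_frames[OF x y e]) blast
  have frA: "(A.\<beta> x e1)\<^sup>2 + (A.\<beta> x e2)\<^sup>2 = 0" "(cmod (A.\<beta> x e1))\<^sup>2 + (cmod (A.\<beta> x e2))\<^sup>2 = 2"
    unfolding fr by simp_all
  obtain G1 G2 W where G: "(dA e1 has_derivative G1) (at x)" "(dA e2 has_derivative G2) (at x)"
    "G1 e1 + G2 e2 = 2 *\<^sub>R ?a + dA W x"
    unfolding dA_def[abs_def] by (rule A.frame_trace[OF x frA]) blast
  obtain H1 H2 V where H: "(dB d1 has_derivative H1) (at y)" "(dB d2 has_derivative H2) (at y)"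
    "H1 d1 + H2 d2 = 2 *\<^sub>R ?b + dB V y"
    unfolding dB_def[abs_def] by (rule B.frame_trace[OF y fr(3,4)]) blast
  have sA: "ads (G1 e1) p + ads (G2 e2) p = 2 * ads ?a p + ads (dA W x) p" for p
    using G(3) by (metis ads.add_left ads.scaleR_left real_scaleR_def)
  have sA': "ads p (G1 e1) + ads p (G2 e2) = 2 * ads p ?a + ads p (dA W x)" for p
    using sA[of p] by (simp add: ads_commute)
  have sB: "ads p (H1 d1) + ads p (H2 d2) = 2 * ads p ?b + ads p (dB V y)" for p
    using H(3) by (metis ads.add_right ads.scaleR_right real_scaleR_def)
  define u where "u = \<epsilon> * ads ?a ?b"
  define m where "m = A.n x * B.n y * cmod (f x - cnj (g y)) * cmod (x - cnj y)"
  have P: "(ads p0 (G1 e1) + ads p0 (G2 e2)) / ads p0 ?a = 2 + ads p0 (dA W x) / ads p0 ?a"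
    unfolding sA' using p0[OF x] by (simp add: field_simps)
  have Q: "(ads q0 (H1 d1) + ads q0 (H2 d2)) / ads q0 ?b = 2 + ads q0 (dB V y) / ads q0 ?b"
    unfolding sB using q0[OF y] by (simp add: field_simps)
  define sq where "sq = (ads p0 (dA e1 x) / ads p0 ?a)\<^sup>2 + (ads p0 (dA e2 x) / ads p0 ?a)\<^sup>2 + (ads q0 (dB d1 y) / ads q0 ?b)\<^sup>2 + (ads q0 (dB d2 y) / ads q0 ?b)\<^sup>2"
  have "\<epsilon> * ((ads (G1 e1) ?b + ads (G2 e2) ?b) + 2 * (ads (dA e1 x) (dB d1 y) + ads (dA e2 x) (dB d2 y)) + (ads ?a (H1 d1) + ads ?a (H2 d2)))
    - \<eta> * ((ads p0 (G1 e1) + ads p0 (G2 e2)) / ads p0 ?a + (ads q0 (H1 d1) + ads q0 (H2 d2)) / ads q0 ?b - sq) \<le> 0"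
    using add_mono[OF second[OF G(1) H(1)] second[OF G(2) H(2)]] unfolding sq_def
    by (simp add: algebra_simps add_divide_distrib)
  then have "4 * u + m + (\<epsilon> * ads (dA W x) ?b - \<eta> * (ads p0 (dA W x) / ads p0 ?a)) + (\<epsilon> * ads ?a (dB V y) - \<eta> * (ads q0 (dB V y) / ads q0 ?b)) - 4 * \<eta> + \<eta> * sq \<le> 0"
    unfolding P Q unfolding sA sB m_def fr(5)[symmetric] u_def by (simp add: algebra_simps)
  then have "4 * u + m - 4 * \<eta> + \<eta> * sq \<le> 0" unfolding critx crity by simp
  moreover have "0 \<le> \<eta> * sq" using \<eta> unfolding sq_def by simp
  ultimately show ?thesis unfolding u_def m_def by linarith
qed

text \<open>If the pairing were \<open>t \<ge> 1\<close>, a combination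
  \<open>r = p' + \<mu> *\<^sub>R p\<close> with \<open>\<mu> > 0\<close> would be null,
  \<open>\<mu>\<close> being a root of \<open>1 + \<mu>\<^sup>2 - 2 * \<mu> * t\<close>. Up to a
  positive factor \<open>r\<close> is a matrix of rank one with kernel \<open>r2 / r0\<close>, hence
  orthogonal to \<open>\<xi>\<close> there, whereas \<open>p\<close> and \<open>p'\<close> pair
  negatively with every \<open>\<xi> b\<close>.\<close>

lemma ads_less_one:
  fixes p p' :: "real \<times> real \<times> real \<times> real"
  assumes p: "ads p p = -1" "fst p > 0" "\<And>b. ads (A.\<xi> b) p < 0"
    and p': "ads p' p' = -1" "fst p' > 0" "\<And>b. ads (A.\<xi> b) p' < 0"
  shows "ads p p' < 1"
proof (rule ccontr)
  assume "\<not> ads p p' < 1"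
  define t where "t = ads p p'"
  have t: "t \<ge> 1" using \<open>\<not> ads p p' < 1\<close> by (simp add: t_def)
  define \<mu> where "\<mu> = t + sqrt (t\<^sup>2 - 1)"
  have t2: "t\<^sup>2 - 1 \<ge> 0" using t by simp
  have \<mu>: "\<mu> > 0" using t real_sqrt_ge_zero[OF t2] unfolding \<mu>_def by linarith
  have "(sqrt (t\<^sup>2 - 1))\<^sup>2 = t\<^sup>2 - 1" using t2 by simp
  then have root: "1 + \<mu>\<^sup>2 - 2 * \<mu> * t = 0"
    unfolding \<mu>_def by (simp add: power2_eq_square algebra_simps)
  define r where "r = p' + \<mu> *\<^sub>R p"
  obtain r0 r1 r2 r3 where r: "r = (r0, r1, r2, r3)" by (cases r)
  have "ads r r = - (1 + \<mu>\<^sup>2 - 2 * \<mu> * t)"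
    unfolding r_def ads.add_left ads.add_right ads.scaleR_left ads.scaleR_right p(1) p'(1)
    using ads_commute[of p p'] by (simp add: t_def power2_eq_square algebra_simps)
  then have null: "r1 * r2 = r0 * r3" using root unfolding r by (simp add: field_simps)
  have "fst r > 0" unfolding r_def using p(2) p'(2) \<mu> by (simp add: add_pos_pos)
  then have r0: "r0 > 0" by (simp add: r)
  have "ads (A.\<xi> (r2 / r0)) r = 0"
  proof -
    have r3: "r3 = r1 * r2 / r0" using null r0 by (simp add: field_simps)
    show ?thesis unfolding r A.\<xi>_def r3 using r0 by (simp add: field_simps)
  qed
  moreover have "ads (A.\<xi> b) r < 0" for b
    unfolding r_def ads.add_right ads.scaleR_right using p(3)[of b] p'(3)[of b] \<mu>
    by (simp add: add_neg_neg mult_pos_neg)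
  ultimately show False by (metis less_irrefl)
qed

text \<open>Once \<open>u \<le> -1\<close> holds everywhere, any pair with \<open>u = -1\<close> is
  a maximum, and \<open>max_principle\<close> with \<open>\<eta> = 0\<close> leads to the equality
  case of \<open>mixed_lower\<close>. Such a pair exists for every \<open>y\<close>: take the point
  \<open>x\<close> of the first surface whose isometry agrees at \<open>y\<close> with that of the
  second.\<close>

theorem uniqueness:
  assumes y: "y \<in> upper_half_plane"
  shows "f y = g y"
proof -
  obtain \<epsilon>1 where e1: "\<epsilon>1 \<in> {1, -1 :: real}" "\<And>b x. x \<in> upper_half_plane \<Longrightarrow> \<epsilon>1 * ads (A.\<xi> b) (A.S x) < 0"
    "\<And>x. x \<in> upper_half_plane \<Longrightarrow> 0 < \<epsilon>1 * fst (A.S x)" by (rule A.orientation) blast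
  obtain \<epsilon>2 where e2: "\<epsilon>2 \<in> {1, -1 :: real}" "\<And>b x. x \<in> upper_half_plane \<Longrightarrow> \<epsilon>2 * ads (B.\<xi> b) (B.S x) < 0"
    "\<And>x. x \<in> upper_half_plane \<Longrightarrow> 0 < \<epsilon>2 * fst (B.S x)" by (rule B.orientation) blast
  define \<epsilon> where "\<epsilon> = \<epsilon>1 * \<epsilon>2"
  have e: "\<epsilon> \<in> {1, -1}" using e1(1) e2(1) by (auto simp: \<epsilon>_def)
  have sq: "\<epsilon>1 * \<epsilon>1 = 1" "\<epsilon>2 * \<epsilon>2 = 1" using e1(1) e2(1) by auto
  define u where "u x y = \<epsilon> * ads (A.S x) (B.S y)" for x y
  have u1: "u x y < 1" if x: "x \<in> upper_half_plane" and y: "y \<in> upper_half_plane" for x y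
  proof -
    have "ads (\<epsilon>1 *\<^sub>R A.S x) (\<epsilon>2 *\<^sub>R B.S y) < 1"
    proof (rule ads_less_one)
      show "ads (\<epsilon>1 *\<^sub>R A.S x) (\<epsilon>1 *\<^sub>R A.S x) = -1"
        unfolding ads.scaleR_left ads.scaleR_right A.ads_S_S[OF x] using sq(1) by simp
      show "ads (\<epsilon>2 *\<^sub>R B.S y) (\<epsilon>2 *\<^sub>R B.S y) = -1"
        unfolding ads.scaleR_left ads.scaleR_right B.ads_S_S[OF y] using sq(2) by simp
      have "B.\<xi> = A.\<xi>" by (simp add: fun_eq_iff A.\<xi>_def B.\<xi>_def)
      then show "ads (A.\<xi> b) (\<epsilon>2 *\<^sub>R B.S y) < 0" for b
        unfolding ads.scaleR_right using e2(2)[OF y, of b] by simp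
      show "ads (A.\<xi> b) (\<epsilon>1 *\<^sub>R A.S x) < 0" for b
        unfolding ads.scaleR_right using e1(2)[OF x, of b] by simp
    qed (use e1(3)[OF x] e2(3)[OF y] in auto)
    then show ?thesis unfolding ads.scaleR_left ads.scaleR_right u_def \<epsilon>_def by (simp add: mult_ac)
  qed
  have i: "\<i> \<in> upper_half_plane" by (simp add: uhp_iff)
  \<comment> \<open>The barriers are logarithms of pairings with one fixed point of each surface;
    these grow with the norm of \<open>S\<close> by \<open>ads_S_coercive\<close>.\<close>
  define p0 where "p0 = A.S \<i>"
  define q0 where "q0 = B.S \<i>"
  have p0: "ads p0 (A.S x) \<le> -1" if "x \<in> upper_half_plane" for x
    unfolding p0_def using A.ads_S_le[OF i that] .
  have q0: "ads q0 (B.S x) \<le> -1" if "x \<in> upper_half_plane" for x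
    unfolding q0_def using B.ads_S_le[OF i that] .
  have p0': "ads p0 (A.S x) < 0" if "x \<in> upper_half_plane" for x using p0[OF that] by simp
  have q0': "ads q0 (B.S x) < 0" if "x \<in> upper_half_plane" for x using q0[OF that] by simp
  define \<psi> where "\<psi> x y = ln (- ads p0 (A.S x)) + ln (- ads q0 (B.S y))" for x y
  have le: "u x y \<le> -1" if xy: "x \<in> upper_half_plane" "y \<in> upper_half_plane" for x y
  proof (rule ccontr)
    assume "\<not> u x y \<le> -1"
    then have gt: "u x y > -1" by simp
    have \<psi>0: "\<psi> x y \<ge> 0" unfolding \<psi>_def using p0[OF xy(1)] q0[OF xy(2)] by simp
    \<comment> \<open>Half of the excess of \<open>u x y\<close> over -1 pays for
      \<open>\<eta> * (1 + \<psi> x y)\<close>, so the perturbed value at \<open>(x, y)\<close>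
      still exceeds \<open>-1 + \<eta>\<close>.\<close>
    define \<eta> where "\<eta> = (u x y + 1) / (2 * (1 + \<psi> x y))"
    have \<eta>: "\<eta> > 0" using gt \<psi>0 by (simp add: \<eta>_def)
    have "\<eta> * (1 + \<psi> x y) = (u x y + 1) / 2" using \<psi>0 by (simp add: \<eta>_def field_simps)
    then have start: "u x y - \<eta> * \<psi> x y > -1 + \<eta>" using gt \<eta> by (simp add: algebra_simps)
    define R where "R = exp (2 / \<eta>)"
    obtain k1 where k1: "k1 > 0" "\<And>z. z \<in> upper_half_plane \<Longrightarrow> k1 * norm (A.S z) \<le> - ads p0 (A.S z)"
      using A.ads_S_coercive[OF i] unfolding p0_def by blast
    obtain k2 where k2: "k2 > 0" "\<And>z. z \<in> upper_half_plane \<Longrightarrow> k2 * norm (B.S z) \<le> - ads q0 (B.S z)"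
      using B.ads_S_coercive[OF i] unfolding q0_def by blast
    obtain K1 where K1: "compact K1" "K1 \<subseteq> upper_half_plane" "\<And>z. z \<in> upper_half_plane \<Longrightarrow> norm (A.S z) \<le> R / k1 \<Longrightarrow> z \<in> K1"
      using A.S_bounded_compact by blast
    obtain K2 where K2: "compact K2" "K2 \<subseteq> upper_half_plane" "\<And>z. z \<in> upper_half_plane \<Longrightarrow> norm (B.S z) \<le> R / k2 \<Longrightarrow> z \<in> K2"
      using B.S_bounded_compact by blast
    have inK: "x' \<in> K1 \<and> y' \<in> K2"
      if x': "x' \<in> upper_half_plane" and y': "y' \<in> upper_half_plane" and ge: "u x y - \<eta> * \<psi> x y \<le> u x' y' - \<eta> * \<psi> x' y'" for x' y'
    proof -
      \<comment> \<open>The 2 is the gap between the strict upper bound 1 of \<open>u\<close> and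
        the value -1 exceeded at the start.\<close>
      have "\<eta> * \<psi> x' y' < 2" using ge start u1[OF x' y'] \<eta> by linarith
      then have "\<psi> x' y' \<le> 2 / \<eta>" using \<eta> by (simp add: field_simps)
      moreover have l1: "ln (- ads p0 (A.S x')) \<ge> 0" "ln (- ads q0 (B.S y')) \<ge> 0" using p0[OF x'] q0[OF y'] by auto
      ultimately have "ln (- ads p0 (A.S x')) \<le> 2 / \<eta>" "ln (- ads q0 (B.S y')) \<le> 2 / \<eta>" unfolding \<psi>_def by linarith+
      then have "exp (ln (- ads p0 (A.S x'))) \<le> R" "exp (ln (- ads q0 (B.S y'))) \<le> R" unfolding R_def by simp_all
      then have "- ads p0 (A.S x') \<le> R" "- ads q0 (B.S y') \<le> R" using p0'[OF x'] q0'[OF y'] by simp_all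
      then have "k1 * norm (A.S x') \<le> R" "k2 * norm (B.S y') \<le> R" using k1(2)[OF x'] k2(2)[OF y'] by linarith+
      then have "norm (A.S x') \<le> R / k1" "norm (B.S y') \<le> R / k2" using k1(1) k2(1) by (simp_all add: field_simps)
      then show ?thesis using K1(3)[OF x'] K2(3)[OF y'] by blast
    qed
    have cA: "continuous_on (K1 \<times> K2) (\<lambda>z. A.S (fst z))"
      by (rule continuous_on_compose2[OF A.continuous_on_S continuous_on_fst[OF continuous_on_id]]) (use K1(2) in auto)
    have cB: "continuous_on (K1 \<times> K2) (\<lambda>z. B.S (snd z))"
      by (rule continuous_on_compose2[OF B.continuous_on_S continuous_on_snd[OF continuous_on_id]]) (use K2(2) in auto)
    have cont: "continuous_on (K1 \<times> K2) (\<lambda>z. u (fst z) (snd z) - \<eta> * \<psi> (fst z) (snd z))"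
      unfolding u_def \<psi>_def
    proof (intro continuous_intros ads.continuous_on cA cB ballI)
      fix z assume "z \<in> K1 \<times> K2"
      then have z: "fst z \<in> upper_half_plane" "snd z \<in> upper_half_plane" using K1(2) K2(2) by auto
      show "- ads p0 (A.S (fst z)) \<noteq> 0" "- ads q0 (B.S (snd z)) \<noteq> 0" using p0[OF z(1)] q0[OF z(2)] by auto
    qed
    have xyK: "x \<in> K1" "y \<in> K2" using inK[OF xy] by simp_all
    then have "K1 \<times> K2 \<noteq> {}" by blast
    then obtain z where z: "z \<in> K1 \<times> K2" "\<And>w. w \<in> K1 \<times> K2 \<Longrightarrow> u (fst w) (snd w) - \<eta> * \<psi> (fst w) (snd w) \<le> u (fst z) (snd z) - \<eta> * \<psi> (fst z) (snd z)"
      using continuous_attains_sup[OF compact_Times[OF K1(1) K2(1)] _ cont] by blast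
    obtain a b where ab: "z = (a, b)" by fastforce
    have aU: "a \<in> upper_half_plane" and bU: "b \<in> upper_half_plane" using z(1) ab K1(2) K2(2) by auto
    have ge: "u x y - \<eta> * \<psi> x y \<le> u a b - \<eta> * \<psi> a b" using z(2)[of "(x, y)"] xyK ab by simp
    have max: "u x' y' - \<eta> * \<psi> x' y' \<le> u a b - \<eta> * \<psi> a b" if U: "x' \<in> upper_half_plane" "y' \<in> upper_half_plane" for x' y'
    proof (rule ccontr)
      assume n: "\<not> ?thesis"
      then have "(x', y') \<in> K1 \<times> K2" using inK[OF U] ge by simp
      then show False using n z(2)[of "(x', y')"] ab by simp
    qed
    have "4 * u a b + A.n a * B.n b * cmod (f a - cnj (g b)) * cmod (a - cnj b) \<le> 4 * \<eta>"
      unfolding u_def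
      by (rule max_principle[OF aU bU e less_imp_le[OF \<eta>] p0' q0' max[unfolded u_def \<psi>_def]])
    then have "u a b \<le> -1 + \<eta>" using mixed_lower(1)[OF aU bU] by linarith
    moreover have "\<psi> a b \<ge> 0" unfolding \<psi>_def using p0[OF aU] q0[OF bU] by simp
    ultimately show False using ge start \<eta> mult_nonneg_nonneg[of \<eta> "\<psi> a b"] by linarith
  qed
  have gy: "g y \<in> upper_half_plane" using B.maps[OF y] .
  obtain x where x: "x \<in> upper_half_plane" "mob (A.S x) y = g y" using A.mob_S_surj[OF y gy] .
  obtain a b c' d a' b' c'' d' where S: "A.S x = (a, b, c', d)" "B.S y = (a', b', c'', d')"
    by (metis prod.exhaust)
  have "\<bar>ads (A.S x) (B.S y)\<bar> \<le> 1"
    unfolding S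
    by (rule ads_mob_fixed[OF _ _ y]) (unfold S[symmetric], simp_all add: A.ads_S_S[OF x(1)] B.ads_S_S[OF y] x(2) B.mob_S_self[OF y])
  then have "u x y \<ge> -1" unfolding u_def using e by auto
  then have eq: "u x y = -1" using le[OF x(1) y] by simp
  have "4 * u x y + A.n x * B.n y * cmod (f x - cnj (g y)) * cmod (x - cnj y) \<le> 4 * 0"
    unfolding u_def
  proof (rule max_principle[OF x(1) y e order_refl p0' q0'])
    show "\<epsilon> * ads (A.S x') (B.S y') - 0 * (ln (- ads p0 (A.S x')) + ln (- ads q0 (B.S y')))
      \<le> \<epsilon> * ads (A.S x) (B.S y) - 0 * (ln (- ads p0 (A.S x)) + ln (- ads q0 (B.S y)))"
      if U: "x' \<in> upper_half_plane" "y' \<in> upper_half_plane" for x' y'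
      using le[OF U] eq unfolding u_def by simp
  qed
  then have m4: "A.n x * B.n y * cmod (f x - cnj (g y)) * cmod (x - cnj y) \<le> 4" using eq by simp
  have "x = y \<and> f x = g y" by (rule mixed_lower(2)[OF x(1) y m4])
  then show ?thesis by metis
qed

end

section \<open>From the minimal surface equation to the angle\<close>

text \<open>The mean value inequality is applied to the increment in direction \<open>b\<close> as a
  function of the step \<open>s\<close> in direction \<open>a\<close>, with its expected linear part
  removed; differentiability of \<open>f' w a\<close> at \<open>z\<close> bounds the derivative of
  this function by \<open>e * t\<close>.\<close>

lemma second_difference_bound:
  fixes f :: "'a::real_normed_vector \<Rightarrow> 'b::real_normed_vector"
  assumes U: "open U" "z \<in> U" and f: "\<And>w. w \<in> U \<Longrightarrow> (f has_derivative f' w) (at w)"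
    and Da: "((\<lambda>w. f' w a) has_derivative Da) (at z)" and e: "0 < e"
  shows "\<forall>\<^sub>F t in at_right 0. norm (f (z + t *\<^sub>R a + t *\<^sub>R b) - f (z + t *\<^sub>R a) - f (z + t *\<^sub>R b) + f z - (t * t) *\<^sub>R Da b)
     \<le> e * (t * t)"
proof -
  define C where "C = 2 * norm a + norm b + 1"
  have C: "C > 0" unfolding C_def by (meson add_nonneg_pos add_nonneg_nonneg norm_ge_zero zero_less_one mult_nonneg_nonneg zero_le_numeral)
  have "\<exists>d>0. \<forall>w. norm (w - z) < d \<longrightarrow> norm (f' w a - f' z a - Da (w - z)) \<le> (e / C) * norm (w - z)"
    using Da divide_pos_pos[OF e C] unfolding has_derivative_at_alt by blast
  then obtain d where d: "d > 0" "\<And>w. norm (w - z) < d \<Longrightarrow> norm (f' w a - f' z a - Da (w - z)) \<le> (e / C) * norm (w - z)"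
    by blast
  obtain r where r: "r > 0" "ball z r \<subseteq> U" using U open_contains_ball by blast
  have linD: "linear Da" using Da has_derivative_linear by blast
  show ?thesis
    unfolding eventually_at_right_field
  proof (intro exI[of _ "min d r / C"] conjI allI impI)
    show "0 < min d r / C" using d r C by simp
    fix t :: real assume t: "0 < t" "t < min d r / C"
    have tC: "t * C < min d r" using t C by (simp add: pos_less_divide_eq)
    have near: "norm (s *\<^sub>R a + \<tau> *\<^sub>R b) < min d r" "norm (s *\<^sub>R a + \<tau> *\<^sub>R b) \<le> t * (norm a + norm b)"
      if "0 \<le> s" "s \<le> t" "0 \<le> \<tau>" "\<tau> \<le> t" for s \<tau>
    proof -
      have "norm (s *\<^sub>R a + \<tau> *\<^sub>R b) \<le> s * norm a + \<tau> * norm b"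
        using that by (intro order_trans[OF norm_triangle_ineq]) simp
      also have "\<dots> \<le> t * norm a + t * norm b" using that by (intro add_mono mult_right_mono) auto
      finally show 1: "norm (s *\<^sub>R a + \<tau> *\<^sub>R b) \<le> t * (norm a + norm b)" by (simp add: algebra_simps)
      also have "\<dots> \<le> t * C" using t unfolding C_def by (intro mult_left_mono) auto
      finally show "norm (s *\<^sub>R a + \<tau> *\<^sub>R b) < min d r" using tC by simp
    qed
    have inU: "z + s *\<^sub>R a + \<tau> *\<^sub>R b \<in> U" if "0 \<le> s" "s \<le> t" "0 \<le> \<tau>" "\<tau> \<le> t" for s \<tau>
    proof -
      have "z + s *\<^sub>R a + \<tau> *\<^sub>R b \<in> ball z r" using near(1)[OF that] norm_minus_commute[of z "z + s *\<^sub>R a + \<tau> *\<^sub>R b"] by (simp add: dist_norm add.assoc)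
      then show ?thesis using r by blast
    qed
    define g where "g s = f ((z + t *\<^sub>R b) + s *\<^sub>R a) - f (z + s *\<^sub>R a) - (s * t) *\<^sub>R Da b" for s
    define g' where "g' s = f' ((z + t *\<^sub>R b) + s *\<^sub>R a) a - f' (z + s *\<^sub>R a) a - t *\<^sub>R Da b" for s
    have "norm (g t - g 0) \<le> (e * t) * norm (t - 0)"
    proof (rule differentiable_bound[where f'="\<lambda>s h. h *\<^sub>R g' s" and S="{0..t}"])
      fix s assume s: "s \<in> {0..t}"
      have "z + s *\<^sub>R a + t *\<^sub>R b \<in> U" and u2: "z + s *\<^sub>R a \<in> U" using inU[of s t] inU[of s 0] s t by auto
      moreover have comm: "(z + t *\<^sub>R b) + s *\<^sub>R a = z + s *\<^sub>R a + t *\<^sub>R b" by (simp add: algebra_simps)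
      ultimately have u1: "(z + t *\<^sub>R b) + s *\<^sub>R a \<in> U" by metis
      note 1 = has_vector_derivative_along[OF f[OF u1], unfolded has_vector_derivative_def]
      note 2 = has_vector_derivative_along[OF f[OF u2], unfolded has_vector_derivative_def]
      have 3: "((\<lambda>s. (s * t) *\<^sub>R Da b) has_derivative (\<lambda>h. (h * t) *\<^sub>R Da b)) (at s)"
        by (auto intro!: derivative_eq_intros)
      have "(g has_derivative (\<lambda>h. h *\<^sub>R g' s)) (at s)"
        unfolding g_def[abs_def]
        by (rule has_derivative_eq_rhs[OF has_derivative_diff[OF has_derivative_diff[OF 1 2] 3]])
           (simp add: fun_eq_iff g'_def algebra_simps)
      then show "(g has_derivative (\<lambda>h. h *\<^sub>R g' s)) (at s within {0..t})" by (rule has_derivative_at_withinI)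
      have n1: "norm (s *\<^sub>R a + t *\<^sub>R b) < d" "norm (s *\<^sub>R a) < d" using near(1)[of s t] near(1)[of s 0] s t by auto
      have e1: "norm (f' (z + s *\<^sub>R a + t *\<^sub>R b) a - f' z a - Da (s *\<^sub>R a + t *\<^sub>R b)) \<le> (e / C) * norm (s *\<^sub>R a + t *\<^sub>R b)"
        using d(2)[of "z + s *\<^sub>R a + t *\<^sub>R b"] n1 by (simp add: add.assoc)
      have e2: "norm (f' (z + s *\<^sub>R a) a - f' z a - Da (s *\<^sub>R a)) \<le> (e / C) * norm (s *\<^sub>R a)"
        using d(2)[of "z + s *\<^sub>R a"] n1 by simp
      have "g' s = (f' (z + s *\<^sub>R a + t *\<^sub>R b) a - f' z a - Da (s *\<^sub>R a + t *\<^sub>R b)) - (f' (z + s *\<^sub>R a) a - f' z a - Da (s *\<^sub>R a))"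
        unfolding g'_def comm linear_add[OF linD] linear_scale[OF linD] by simp
      then have "norm (g' s) \<le> (e / C) * norm (s *\<^sub>R a + t *\<^sub>R b) + (e / C) * norm (s *\<^sub>R a)"
        using e1 e2 by (metis norm_triangle_le_diff add_mono)
      also have "\<dots> = (e / C) * (norm (s *\<^sub>R a + t *\<^sub>R b) + norm (s *\<^sub>R a))" by (simp add: algebra_simps)
      also have "\<dots> \<le> (e / C) * (t * C)"
      proof (rule mult_left_mono)
        have "norm (s *\<^sub>R a) \<le> t * norm a" using s by (simp add: mult_right_mono)
        then show "norm (s *\<^sub>R a + t *\<^sub>R b) + norm (s *\<^sub>R a) \<le> t * C"
          using near(2)[of s t] s t unfolding C_def by (simp add: algebra_simps)
      qed (use e C in simp)
      also have "\<dots> = e * t" using C by simp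
      finally show "onorm (\<lambda>h. h *\<^sub>R g' s) \<le> e * t"
        by (intro onorm_le) (simp add: mult.commute mult_left_mono)
    qed (use t in auto)
    then show "norm (f (z + t *\<^sub>R a + t *\<^sub>R b) - f (z + t *\<^sub>R a) - f (z + t *\<^sub>R b) + f z - (t * t) *\<^sub>R Da b) \<le> e * (t * t)"
      using t unfolding g_def by (simp add: algebra_simps)
  qed
qed

text \<open>The second difference is symmetric in the two directions, and divided by
  \<open>t * t\<close> it approximates both sides.\<close>

lemma second_derivative_symmetric:
  fixes f :: "'a::real_normed_vector \<Rightarrow> 'b::real_normed_vector"
  assumes U: "open U" "z \<in> U" and f: "\<And>w. w \<in> U \<Longrightarrow> (f has_derivative f' w) (at w)"
    and Da: "((\<lambda>w. f' w a) has_derivative Da) (at z)" and Db: "((\<lambda>w. f' w b) has_derivative Db) (at z)"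
  shows "Da b = Db a"
proof (rule ccontr)
  assume "Da b \<noteq> Db a"
  then have n: "norm (Da b - Db a) > 0" by simp
  define e where "e = norm (Da b - Db a) / 4"
  have e: "e > 0" using n by (simp add: e_def)
  have ev: "\<forall>\<^sub>F t in at_right (0::real). t > 0" by (simp add: eventually_at_right_less)
  have "\<forall>\<^sub>F t in at_right 0. norm (f (z + t *\<^sub>R a + t *\<^sub>R b) - f (z + t *\<^sub>R a) - f (z + t *\<^sub>R b) + f z - (t * t) *\<^sub>R Da b) \<le> e * (t * t)"
    by (rule second_difference_bound[OF U f Da e])
  moreover have "\<forall>\<^sub>F t in at_right 0. norm (f (z + t *\<^sub>R b + t *\<^sub>R a) - f (z + t *\<^sub>R b) - f (z + t *\<^sub>R a) + f z - (t * t) *\<^sub>R Db a) \<le> e * (t * t)"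
    by (rule second_difference_bound[OF U f Db e])
  ultimately have "\<forall>\<^sub>F t in at_right (0::real). False"
    using ev
  proof eventually_elim
    case (elim t)
    define \<Delta> where "\<Delta> = f (z + t *\<^sub>R a + t *\<^sub>R b) - f (z + t *\<^sub>R a) - f (z + t *\<^sub>R b) + f z"
    have 1: "norm (\<Delta> - (t * t) *\<^sub>R Da b) \<le> e * (t * t)" using elim(1) by (simp add: \<Delta>_def)
    have "f (z + t *\<^sub>R b + t *\<^sub>R a) - f (z + t *\<^sub>R b) - f (z + t *\<^sub>R a) + f z = \<Delta>"
      by (simp add: \<Delta>_def algebra_simps)
    then have 2: "norm (\<Delta> - (t * t) *\<^sub>R Db a) \<le> e * (t * t)" using elim(2) by simp
    have "(t * t) *\<^sub>R (Da b - Db a) = (\<Delta> - (t * t) *\<^sub>R Db a) - (\<Delta> - (t * t) *\<^sub>R Da b)" by (simp add: algebra_simps)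
    then have "norm ((t * t) *\<^sub>R (Da b - Db a)) \<le> e * (t * t) + e * (t * t)"
      using norm_triangle_le_diff[of "\<Delta> - (t * t) *\<^sub>R Db a" "\<Delta> - (t * t) *\<^sub>R Da b"] 1 2 by (metis add_mono)
    then have "(t * t) * (4 * e) \<le> (t * t) * (2 * e)" by (simp add: e_def)
    then show False using elim(3) e by (simp add: mult_le_cancel_left_pos)
  qed
  then show False by (simp add: eventually_False trivial_limit_at_right_real)
qed

text \<open>
  The equations for the first derivatives of \<open>arg f\<^sub>z\<close>, obtained from the vanishing of the mean
  curvature and from the two derivatives of the area equation. Here \<open>X\<close>, \<open>Y\<close> are the partial
  derivatives of \<open>f\<close>, \<open>P\<close>, \<open>Q\<close>, \<open>R\<close> the second ones, \<open>s = 1 / Im f\<close> and \<open>t = 1 / Im z\<close>.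
\<close>

lemma angle_equations:
  fixes X Y P Q R :: complex and s t :: real
  defines "J \<equiv> Re X * Im Y - Im X * Re Y" and "a \<equiv> (X - \<i> * Y) / 2" and "c \<equiv> (X + \<i> * Y) / 2"
  assumes J: "J > 0"
    and L1: "(Re P * Im Y - Im P * Re Y) + (Re X * Im Q - Im X * Re Q) = 2 * J * s * Im X"
    and L2: "(Re Q * Im Y - Im Q * Re Y) + (Re X * Im R - Im X * Re R) = 2 * J * s * Im Y - 2 * J * t"
    and M: "of_real (J + (cmod Y)\<^sup>2) * (P + \<i> * s * X * X - Y * t) - of_real (2 * Re (X * cnj Y)) * (Q + \<i> * s * X * Y + X * t)
      + of_real (J + (cmod X)\<^sup>2) * (R + \<i> * s * Y * Y + Y * t) = 0"
  shows "Im ((P - \<i> * Q) / 2 * cnj a) = (cmod a)\<^sup>2 * (t - Re X * s)"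
    and "Im ((Q - \<i> * R) / 2 * cnj a) = - ((cmod a)\<^sup>2 * (Re Y * s))"
    and "(cmod a)\<^sup>2 = (cmod c)\<^sup>2 + J"
proof -
  show ac: "(cmod a)\<^sup>2 = (cmod c)\<^sup>2 + J"
    unfolding cmod_power2 a_def c_def J_def by (simp add: power2_eq_square field_simps)
  define T1 where "T1 = Im ((P - \<i> * Q) / 2 * cnj a) - (cmod a)\<^sup>2 * (t - Re X * s)"
  define T2 where "T2 = Im ((Q - \<i> * R) / 2 * cnj a) + (cmod a)\<^sup>2 * (Re Y * s)"
  define T where "T = Complex T2 T1"
  define LL1 where "LL1 = (Re P * Im Y - Im P * Re Y) + (Re X * Im Q - Im X * Re Q) - 2 * J * s * Im X"
  define LL2 where "LL2 = (Re Q * Im Y - Im Q * Re Y) + (Re X * Im R - Im X * Re R) - (2 * J * s * Im Y - 2 * J * t)"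
  define MM where "MM = of_real (J + (cmod Y)\<^sup>2) * (P + \<i> * s * X * X - Y * t) - of_real (2 * Re (X * cnj Y)) * (Q + \<i> * s * X * Y + X * t)
      + of_real (J + (cmod X)\<^sup>2) * (R + \<i> * s * Y * Y + Y * t)"
  \<comment> \<open>The two claims say that the components of \<open>T\<close> vanish. The
    hypotheses combine to \<open>a * cnj T + c * T = 0\<close>, and \<open>cmod a > cmod c\<close>
    because \<open>J > 0\<close>; so \<open>T = 0\<close>.\<close>
  have "a * cnj T + c * T = a * Complex LL1 LL2 / 2 - MM / 4"
    unfolding T_def T1_def T2_def LL1_def LL2_def MM_def cmod_power2 a_def c_def J_def complex_eq_iff
    by (simp add: power2_eq_square field_simps)
  also have "\<dots> = 0" using L1 L2 M unfolding LL1_def LL2_def MM_def by (simp add: Complex_eq_0)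
  finally have "c * T = - (a * cnj T)" by (simp add: add_eq_0_iff)
  then have "cmod c * cmod T = cmod a * cmod T" by (metis norm_minus_cancel norm_mult complex_mod_cnj)
  moreover have "cmod a \<noteq> cmod c" using ac J by auto
  ultimately have "T = 0" by simp
  then have "T1 = 0" "T2 = 0" by (simp_all add: T_def Complex_eq_0)
  then show "Im ((P - \<i> * Q) / 2 * cnj a) = (cmod a)\<^sup>2 * (t - Re X * s)" "Im ((Q - \<i> * R) / 2 * cnj a) = - ((cmod a)\<^sup>2 * (Re Y * s))"
    unfolding T1_def T2_def by linarith+
qed

text \<open>Near \<open>z\<close> the continuous logarithm is \<open>g z + Ln (a w / a z)\<close>:
  by continuity the imaginary part of \<open>g w - g z\<close> stays within the range in which
  \<open>Ln\<close> inverts \<open>exp\<close>.\<close>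

lemma continuous_logarithm_has_derivative:
  fixes a g :: "'a::real_normed_vector \<Rightarrow> complex"
  assumes U: "open U" "z \<in> U" and g: "continuous_on U g" and eq: "\<And>w. w \<in> U \<Longrightarrow> a w = exp (g w)"
    and a: "(a has_derivative D) (at z)"
  shows "(g has_derivative (\<lambda>v. D v / a z)) (at z)"
proof -
  have nz: "a z \<noteq> 0" using eq[OF U(2)] by simp
  have q: "((\<lambda>w. a w / a z) has_derivative (\<lambda>v. D v / a z)) (at z)"
    by (rule bounded_linear.has_derivative[OF bounded_linear_divide a])
  have Ln: "(Ln has_derivative (\<lambda>h. h)) (at (a z / a z))"
  proof -
    have "(Ln has_derivative (\<lambda>h. h)) (at 1)"
      by (rule has_derivative_eq_rhs[OF has_field_derivative_Ln[of 1, unfolded has_field_derivative_def]])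
         (auto simp: fun_eq_iff)
    then show ?thesis using nz by simp
  qed
  have L: "((\<lambda>w. g z + Ln (a w / a z)) has_derivative (\<lambda>v. D v / a z)) (at z)"
    by (rule has_derivative_eq_rhs[OF has_derivative_add[OF has_derivative_const has_derivative_compose[OF q Ln]]]) simp
  have "isCont g z" using g U continuous_on_eq_continuous_at by blast
  then have "\<forall>\<^sub>F w in nhds z. dist (g w) (g z) < pi"
    using tendstoD[of g "g z" "nhds z" pi] by (simp add: isCont_def tendsto_nhds_iff pi_gt_zero)
  moreover have "\<forall>\<^sub>F w in nhds z. w \<in> U" using U eventually_nhds by blast
  ultimately have ev: "\<forall>\<^sub>F w in nhds z. g z + Ln (a w / a z) = g w"
  proof eventually_elim
    case (elim w)
    have "a w / a z = exp (g w - g z)" using eq[OF elim(2)] eq[OF U(2)] by (simp add: exp_diff)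
    moreover have "\<bar>Im (g w - g z)\<bar> < pi"
      using elim(1) abs_Im_le_cmod[of "g w - g z"] by (simp add: dist_norm)
    ultimately show ?case using Ln_exp[of "g w - g z"] by (simp add: abs_less_iff)
  qed
  then obtain S where S: "open S" "z \<in> S" "\<And>w. w \<in> S \<Longrightarrow> g z + Ln (a w / a z) = g w"
    unfolding eventually_nhds by blast
  show ?thesis
    by (rule has_derivative_transform_within_open[OF L S(1,2)]) (use S(3) in auto)
qed

section \<open>First and second derivatives of a smooth map and of its graph\<close>

definition fd :: "(complex \<Rightarrow> complex) \<Rightarrow> complex \<Rightarrow> complex \<Rightarrow> complex" where
  "fd f z = frechet_derivative f (at z)"

definition fd2 :: "(complex \<Rightarrow> complex) \<Rightarrow> complex \<Rightarrow> complex \<Rightarrow> complex \<Rightarrow> complex" where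
  "fd2 f z u v = frechet_derivative (\<lambda>w. fd f w v) (at z) u"

lemma frechet_derivative_eqI: "(F has_derivative D) (at z) \<Longrightarrow> frechet_derivative F (at z) = D"
  using frechet_derivative_at by metis

context
  fixes f :: "complex \<Rightarrow> complex"
  assumes smooth: "smooth_on upper_half_plane f"
begin

lemma smooth_fd: "z \<in> upper_half_plane \<Longrightarrow> (f has_derivative fd f z) (at z)"
  using smooth unfolding smooth_on_def fd_def
  by (metis Ck_on.simps(2) frechet_derivative_works)

lemma smooth_fd2: "z \<in> upper_half_plane \<Longrightarrow> ((\<lambda>w. fd f w v) has_derivative (\<lambda>u. fd2 f z u v)) (at z)"
proof -
  assume z: "z \<in> upper_half_plane"
  have "Ck_on (Suc (Suc 0)) upper_half_plane f" using smooth unfolding smooth_on_def by blast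
  then have "(\<lambda>w. fd f w v) differentiable (at z)" using z by (simp add: fd_def)
  then show ?thesis unfolding fd2_def by (simp add: frechet_derivative_works[symmetric])
qed

lemma fd_linear: "z \<in> upper_half_plane \<Longrightarrow> linear (fd f z)"
  using smooth_fd has_derivative_linear by blast

lemma fd2_linear: "z \<in> upper_half_plane \<Longrightarrow> linear (\<lambda>u. fd2 f z u v)"
  using smooth_fd2 has_derivative_linear by blast

lemma fd2_commute: "z \<in> upper_half_plane \<Longrightarrow> fd2 f z u v = fd2 f z v u"
  using second_derivative_symmetric[OF open_uhp _ smooth_fd smooth_fd2 smooth_fd2] by metis

lemma complex_expand: "v = Re v *\<^sub>R 1 + Im v *\<^sub>R \<i>" for v :: complex
  by (simp add: complex_eq_iff)

lemma fd_expand: "z \<in> upper_half_plane \<Longrightarrow> fd f z v = Re v *\<^sub>R fd f z 1 + Im v *\<^sub>R fd f z \<i>"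
  by (subst complex_expand[of v]) (simp only: linear_add[OF fd_linear] linear_scale[OF fd_linear])

lemma fd2_linear_right: "z \<in> upper_half_plane \<Longrightarrow> linear (\<lambda>v. fd2 f z u v)"
  by (simp only: fd2_commute[of z u]) (rule fd2_linear)

lemma graph_deriv:
  "z \<in> upper_half_plane \<Longrightarrow> frechet_derivative (\<lambda>z. (z, f z)) (at z) = (\<lambda>v. (v, fd f z v))"
  by (rule frechet_derivative_eqI) (intro has_derivative_Pair has_derivative_ident smooth_fd)

lemma graph_deriv2:
  assumes z: "z \<in> upper_half_plane"
  shows "frechet_derivative (\<lambda>w. frechet_derivative (\<lambda>z. (z, f z)) (at w) v) (at z) = (\<lambda>u. (0, fd2 f z u v))"
proof (rule frechet_derivative_eqI)
  have "((\<lambda>w. (v, fd f w v)) has_derivative (\<lambda>u. (0, fd2 f z u v))) (at z)"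
    by (intro has_derivative_Pair has_derivative_const smooth_fd2[OF z])
  then show "((\<lambda>w. frechet_derivative (\<lambda>z. (z, f z)) (at w) v) has_derivative (\<lambda>u. (0, fd2 f z u v))) (at z)"
    by (rule has_derivative_transform_within_open[OF _ open_uhp z]) (simp add: graph_deriv)
qed

end

text \<open>Turns a trace condition over all orthonormal frames into one on the coefficients for
  \<open>1\<close> and \<open>\<i>\<close>. Gram-Schmidt on this basis gives the frame
  \<open>e1\<close>, \<open>e2\<close>; the result is the trace against the adjugate of the metric
  matrix.\<close>

lemma trace_orthonormal:
  fixes H G :: "complex \<Rightarrow> complex \<Rightarrow> real"
  assumes H: "\<And>u v. H u v = Re u * Re v * H 1 1 + (Re u * Im v + Im u * Re v) * H 1 \<i> + Im u * Im v * H \<i> \<i>"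
    and G: "\<And>u v. G u v = Re u * Re v * G 1 1 + (Re u * Im v + Im u * Re v) * G 1 \<i> + Im u * Im v * G \<i> \<i>"
    and pos: "G 1 1 > 0" "G 1 1 * G \<i> \<i> - (G 1 \<i>)\<^sup>2 > 0"
    and tr: "\<And>e1 e2. G e1 e1 = 1 \<Longrightarrow> G e2 e2 = 1 \<Longrightarrow> G e1 e2 = 0 \<Longrightarrow> H e1 e1 + H e2 e2 = 0"
  shows "G \<i> \<i> * H 1 1 - 2 * G 1 \<i> * H 1 \<i> + G 1 1 * H \<i> \<i> = 0"
proof -
  define E F K where "E = G 1 1" and "F = G 1 \<i>" and "K = G \<i> \<i>"
  define D where "D = E * K - F\<^sup>2"
  have E: "E > 0" and D: "D > 0" using pos by (simp_all add: E_def F_def K_def D_def)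
  define s t where "s = 1 / sqrt E" and "t = 1 / sqrt (E * D)"
  have s: "s * s * E = 1" using E by (simp add: s_def)
  have t: "t * t * (E * D) = 1" using E D by (simp add: t_def)
  define e1 e2 where "e1 = complex_of_real s" and "e2 = Complex (- F * t) (E * t)"
  have "G e1 e1 = s * s * E" unfolding G[of e1 e1] by (simp add: e1_def E_def)
  then have g1: "G e1 e1 = 1" using s by simp
  have "G e2 e2 = t * t * (E * D)"
    unfolding G[of e2 e2] unfolding E_def[symmetric] F_def[symmetric] K_def[symmetric] D_def e2_def by (simp add: power2_eq_square algebra_simps)
  then have g2: "G e2 e2 = 1" using t by simp
  have g3: "G e1 e2 = 0"
    unfolding G[of e1 e2] unfolding E_def[symmetric] F_def[symmetric] K_def[symmetric] e1_def e2_def by (simp add: algebra_simps)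
  have "H e1 e1 = s * s * H 1 1" unfolding H[of e1 e1] by (simp add: e1_def)
  moreover have "H e2 e2 = t * t * (F\<^sup>2 * H 1 1 - 2 * E * F * H 1 \<i> + E\<^sup>2 * H \<i> \<i>)"
    unfolding H[of e2 e2] unfolding e2_def by (simp add: power2_eq_square algebra_simps)
  ultimately have "s * s * H 1 1 + t * t * (F\<^sup>2 * H 1 1 - 2 * E * F * H 1 \<i> + E\<^sup>2 * H \<i> \<i>) = 0"
    using tr[OF g1 g2 g3] by simp
  then have "(E * D) * (s * s * H 1 1 + t * t * (F\<^sup>2 * H 1 1 - 2 * E * F * H 1 \<i> + E\<^sup>2 * H \<i> \<i>)) = 0" by simp
  moreover have "(E * D) * (s * s * H 1 1 + t * t * (F\<^sup>2 * H 1 1 - 2 * E * F * H 1 \<i> + E\<^sup>2 * H \<i> \<i>))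
     = (s * s * E) * D * H 1 1 + (t * t * (E * D)) * (F\<^sup>2 * H 1 1 - 2 * E * F * H 1 \<i> + E\<^sup>2 * H \<i> \<i>)"
    by (simp add: algebra_simps)
  ultimately have "D * H 1 1 + (F\<^sup>2 * H 1 1 - 2 * E * F * H 1 \<i> + E\<^sup>2 * H \<i> \<i>) = 0"
    unfolding s t by simp
  then have "E * (K * H 1 1 - 2 * F * H 1 \<i> + E * H \<i> \<i>) = 0"
    unfolding D_def by (simp add: power2_eq_square algebra_simps)
  then show ?thesis using E by (simp add: E_def F_def K_def)
qed

text \<open>For each \<open>N2\<close> a vector \<open>N1\<close> can be added that makes
  \<open>(N1, N2)\<close> normal to the graph, and the second fundamental form is then the pairing
  of \<open>N2\<close> with \<open>B\<close>, the second covariant differential of \<open>f\<close>,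
  up to a positive factor. Since \<open>N2\<close> is arbitrary, the trace of \<open>B\<close> in
  the induced metric vanishes as a vector.\<close>

lemma minimal_equation:
  assumes smooth: "smooth_on upper_half_plane f" and f: "f z \<in> upper_half_plane"
    and min: "minimal_immersion (\<lambda>z. (z, f z))" and z: "z \<in> upper_half_plane"
  defines "X \<equiv> fd f z 1" and "Y \<equiv> fd f z \<i>" and "s \<equiv> 1 / Im (f z)" and "t \<equiv> 1 / Im z"
  assumes J: "Re X * Im Y - Im X * Re Y > 0"
  shows "of_real (t\<^sup>2 + (cmod Y)\<^sup>2 * s\<^sup>2) * (fd2 f z 1 1 + \<i> * s * X * X - Y * t)
      - of_real (2 * (Re (X * cnj Y) * s\<^sup>2)) * (fd2 f z 1 \<i> + \<i> * s * X * Y + X * t)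
      + of_real (t\<^sup>2 + (cmod X)\<^sup>2 * s\<^sup>2) * (fd2 f z \<i> \<i> + \<i> * s * Y * Y + Y * t) = 0" (is "?M = 0")
proof -
  have s: "s > 0" and t: "t > 0" using f z by (simp_all add: s_def t_def uhp_iff)
  let ?F = "\<lambda>z. (z, f z)"
  define B where "B u v = fd2 f z u v + \<i> * s * fd f z u * fd f z v - fd f z (\<i> * t * u * v)" for u v
  note fdx = fd_expand[OF smooth z, folded X_def Y_def]
  have lin: "linear (fd f z)" by (rule fd_linear[OF smooth z])
  have metric: "induced_metric ?F z u v = (u \<bullet> v) * t\<^sup>2 + (fd f z u \<bullet> fd f z v) * s\<^sup>2" for u v
    by (simp add: induced_metric_def graph_deriv[OF smooth z] prod_metric_def hyp_metric_def s_def t_def power_divide)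
  have "?M \<bullet> N2 = 0" for N2
  proof -
    define N1 where "N1 = - (s\<^sup>2 / t\<^sup>2) *\<^sub>R Complex (X \<bullet> N2) (Y \<bullet> N2)"
    have ort: "(u \<bullet> N1) * t\<^sup>2 + (fd f z u \<bullet> N2) * s\<^sup>2 = 0" for u
      unfolding N1_def fdx[of u] using t by (simp add: inner_complex_def field_simps)
    have normal: "normal_to ?F z (N1, N2)"
      unfolding normal_to_def graph_deriv[OF smooth z] prod_metric_def hyp_metric_def
      using ort by (simp add: s_def t_def power_divide)
    define H where "H u v = second_fundamental_form ?F z (N1, N2) u v" for u v
    have HB: "H u v = (B u v \<bullet> N2) * s\<^sup>2" for u v
    proof -
      have "H u v = ((\<i> * t * u * v) \<bullet> N1) * t\<^sup>2 + ((fd2 f z u v + \<i> * s * fd f z u * fd f z v) \<bullet> N2) * s\<^sup>2"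
        unfolding H_def second_fundamental_form_def cov_deriv_def graph_deriv[OF smooth z] graph_deriv2[OF smooth z]
        by (simp add: prod_metric_def hyp_metric_def prod_christoffel_def hyp_christoffel_def s_def t_def power_divide)
      also have "\<dots> = ((fd2 f z u v + \<i> * s * fd f z u * fd f z v) \<bullet> N2) * s\<^sup>2 - (fd f z (\<i> * t * u * v) \<bullet> N2) * s\<^sup>2"
        using ort[of "\<i> * t * u * v"] by linarith
      finally show ?thesis unfolding B_def by (simp add: inner_diff_left algebra_simps)
    qed
    have Bx: "B u v = (Re u * Re v) *\<^sub>R B 1 1 + (Re u * Im v + Im u * Re v) *\<^sub>R B 1 \<i> + (Im u * Im v) *\<^sub>R B \<i> \<i>" for u v
    proof -
      have 2: "fd2 f z u v = (Re u * Re v) *\<^sub>R fd2 f z 1 1 + (Re u * Im v + Im u * Re v) *\<^sub>R fd2 f z 1 \<i> + (Im u * Im v) *\<^sub>R fd2 f z \<i> \<i>"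
      proof -
        have e1: "fd2 f z u w = Re u *\<^sub>R fd2 f z 1 w + Im u *\<^sub>R fd2 f z \<i> w" for w
          by (subst complex_expand[OF smooth, of u]) (simp only: linear_add[OF fd2_linear[OF smooth z]] linear_scale[OF fd2_linear[OF smooth z]])
        have e2: "fd2 f z w v = Re v *\<^sub>R fd2 f z w 1 + Im v *\<^sub>R fd2 f z w \<i>" for w
          by (subst complex_expand[OF smooth, of v]) (simp only: linear_add[OF fd2_linear_right[OF smooth z]] linear_scale[OF fd2_linear_right[OF smooth z]])
        show ?thesis unfolding e1 e2[of 1] e2[of \<i>] fd2_commute[OF smooth z, of \<i> 1] by (simp add: algebra_simps)
      qed
      have 3: "fd f z (\<i> * t * u * v) = (Re u * Re v) *\<^sub>R fd f z (\<i> * t * 1 * 1) + (Re u * Im v + Im u * Re v) *\<^sub>R fd f z (\<i> * t * 1 * \<i>) + (Im u * Im v) *\<^sub>R fd f z (\<i> * t * \<i> * \<i>)"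
        unfolding linear_scale[OF lin, symmetric] linear_add[OF lin, symmetric]
        by (rule arg_cong[of _ _ "fd f z"]) (simp add: complex_eq_iff algebra_simps)
      have 4: "\<i> * s * fd f z u * fd f z v = (Re u * Re v) *\<^sub>R (\<i> * s * fd f z 1 * fd f z 1) + (Re u * Im v + Im u * Re v) *\<^sub>R (\<i> * s * fd f z 1 * fd f z \<i>) + (Im u * Im v) *\<^sub>R (\<i> * s * fd f z \<i> * fd f z \<i>)"
        unfolding fdx[of u] fdx[of v] X_def[symmetric] Y_def[symmetric] by (simp add: scaleR_conv_of_real algebra_simps)
      show ?thesis unfolding B_def 2 3 4 by (simp add: algebra_simps)
    qed
    define G where "G u v = induced_metric ?F z u v" for u v
    have G11: "G 1 1 = t\<^sup>2 + (cmod X)\<^sup>2 * s\<^sup>2" unfolding G_def metric X_def[symmetric] by (simp add: power2_norm_eq_inner)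
    have G22: "G \<i> \<i> = t\<^sup>2 + (cmod Y)\<^sup>2 * s\<^sup>2" unfolding G_def metric Y_def[symmetric] by (simp add: power2_norm_eq_inner)
    have G12: "G 1 \<i> = Re (X * cnj Y) * s\<^sup>2" unfolding G_def metric X_def[symmetric] Y_def[symmetric] by (simp add: inner_complex_def)
    have "G \<i> \<i> * H 1 1 - 2 * G 1 \<i> * H 1 \<i> + G 1 1 * H \<i> \<i> = 0"
    proof (rule trace_orthonormal)
      show "H u v = Re u * Re v * H 1 1 + (Re u * Im v + Im u * Re v) * H 1 \<i> + Im u * Im v * H \<i> \<i>" for u v
        unfolding HB by (subst Bx) (simp add: inner_add_left algebra_simps)
      show "G u v = Re u * Re v * G 1 1 + (Re u * Im v + Im u * Re v) * G 1 \<i> + Im u * Im v * G \<i> \<i>" for u v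
        unfolding G_def metric fdx[of u] fdx[of v] X_def[symmetric] Y_def[symmetric]
        by (simp add: inner_complex_def algebra_simps)
      show "G 1 1 > 0" unfolding G11 using t by (simp add: add_pos_nonneg)
      have "G 1 1 * G \<i> \<i> - (G 1 \<i>)\<^sup>2 = t\<^sup>2 * t\<^sup>2 + t\<^sup>2 * s\<^sup>2 * ((cmod X)\<^sup>2 + (cmod Y)\<^sup>2) + s\<^sup>2 * s\<^sup>2 * (Re X * Im Y - Im X * Re Y)\<^sup>2"
        unfolding G11 G22 G12 cmod_power2 by (simp add: power2_eq_square algebra_simps)
      also have "\<dots> > 0" using t by (intro add_pos_nonneg) auto
      finally show "G 1 1 * G \<i> \<i> - (G 1 \<i>)\<^sup>2 > 0" .
      show "H e1 e1 + H e2 e2 = 0" if "G e1 e1 = 1" "G e2 e2 = 1" "G e1 e2 = 0" for e1 e2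
        using min z normal that unfolding minimal_immersion_def H_def G_def by blast
    qed
    then have "((G \<i> \<i> *\<^sub>R B 1 1 - (2 * G 1 \<i>) *\<^sub>R B 1 \<i> + G 1 1 *\<^sub>R B \<i> \<i>) \<bullet> N2) * s\<^sup>2 = 0"
      unfolding HB by (simp add: inner_add_left inner_diff_left algebra_simps)
    then have "(G \<i> \<i> *\<^sub>R B 1 1 - (2 * G 1 \<i>) *\<^sub>R B 1 \<i> + G 1 1 *\<^sub>R B \<i> \<i>) \<bullet> N2 = 0" using s by simp
    moreover have "B 1 1 = fd2 f z 1 1 + \<i> * s * X * X - Y * t" "B 1 \<i> = fd2 f z 1 \<i> + \<i> * s * X * Y + X * t"
       "B \<i> \<i> = fd2 f z \<i> \<i> + \<i> * s * Y * Y + Y * t"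
      unfolding B_def X_def[symmetric] Y_def[symmetric] fdx[of "\<i> * t * _ * _"] by (simp_all add: scaleR_conv_of_real mult.commute)
    ultimately show ?thesis unfolding G11 G22 G12 by (simp only: scaleR_conv_of_real)
  qed
  then show ?thesis by (metis inner_eq_zero_iff)
qed

text \<open>\<open>a\<close> is the complex-linear coefficient of the differential. It has no zeros,
  its squared modulus being at least the Jacobian, so a continuous logarithm exists on the
  contractible half-plane and provides a globally defined angle.\<close>

theorem minimal_lagrangian_conformal:
  assumes ml: "minimal_lagrangian f"
  obtains \<theta> \<rho> c where "conformal_ml f (fd f) \<theta> \<rho> c"
proof -
  have smooth: "smooth_on upper_half_plane f" and bij: "bij_betw f upper_half_plane upper_half_plane"
    and min: "minimal_immersion (\<lambda>z. (z, f z))" and area: "area_preserving f"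
    using ml unfolding minimal_lagrangian_def op_diffeo_def by auto
  have maps: "f z \<in> upper_half_plane" if "z \<in> upper_half_plane" for z
    using bij that by (auto simp: bij_betw_def)
  define X where "X z = fd f z 1" for z
  define Y where "Y z = fd f z \<i>" for z
  define J where "J z = Re (X z) * Im (Y z) - Im (X z) * Re (Y z)" for z
  define a where "a z = (X z - \<i> * Y z) / 2" for z
  define c where "c z = (X z + \<i> * Y z) / 2" for z
  define Da where "Da z u = (fd2 f z u 1 - \<i> * fd2 f z u \<i>) / 2" for z u
  have pos: "Im z > 0" "Im (f z) > 0" if "z \<in> upper_half_plane" for z using that maps by (auto simp: uhp_iff)
  have JJ: "J z = (Im (f z) / Im z)\<^sup>2" if z: "z \<in> upper_half_plane" for z
  proof -
    have "hyp_area_form (f z) (fd f z 1) (fd f z \<i>) = hyp_area_form z 1 \<i>"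
      using area z unfolding area_preserving_def fd_def by blast
    then have "J z / (Im (f z))\<^sup>2 = 1 / (Im z)\<^sup>2" by (simp add: hyp_area_form_def J_def X_def Y_def)
    then show ?thesis using pos[OF z] by (simp add: power_divide field_simps)
  qed
  have Jpos: "J z > 0" if z: "z \<in> upper_half_plane" for z using JJ[OF z] pos[OF z] by simp
  note dX = smooth_fd2[OF smooth, of _ 1] and dY = smooth_fd2[OF smooth, of _ \<i>]
  have da: "(a has_derivative Da z) (at z)" if z: "z \<in> upper_half_plane" for z
    unfolding a_def[abs_def] X_def Y_def Da_def[abs_def]
    by (rule bounded_linear.has_derivative[OF bounded_linear_divide
          has_derivative_diff[OF dX[OF z] has_derivative_mult_right[OF dY[OF z]]]])
  have eqs: "Im (Da z 1 * cnj (a z)) = (cmod (a z))\<^sup>2 * (1 / Im z - Re (X z) * (1 / Im (f z)))"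
    "Im (Da z \<i> * cnj (a z)) = - ((cmod (a z))\<^sup>2 * (Re (Y z) * (1 / Im (f z))))"
    "(cmod (a z))\<^sup>2 = (cmod (c z))\<^sup>2 + J z" if z: "z \<in> upper_half_plane" for z
  proof -
    define s t where "s = 1 / Im (f z)" and "t = 1 / Im z"
    have st: "s > 0" "t > 0" using pos[OF z] by (simp_all add: s_def t_def)
    have Jst: "J z * s\<^sup>2 = t\<^sup>2" unfolding JJ[OF z] s_def t_def using pos[OF z] by (simp add: power_divide)
    have v: "Im (f z) * s = 1" "Im (f z) / Im z = Im (f z) * t" using pos[OF z] by (simp_all add: s_def t_def)
    define D1 where "D1 u = (Re (X z) * Im (fd2 f z u \<i>) + Re (fd2 f z u 1) * Im (Y z)) - (Im (X z) * Re (fd2 f z u \<i>) + Im (fd2 f z u 1) * Re (Y z))" for u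
    have d1: "(J has_derivative D1) (at z)"
      unfolding J_def[abs_def] D1_def[abs_def] X_def Y_def
      by (intro has_derivative_diff has_derivative_mult bounded_linear.has_derivative[OF bounded_linear_Re]
          bounded_linear.has_derivative[OF bounded_linear_Im] dX[OF z] dY[OF z])
    define D2 where "D2 u = 2 * (Im (f z) * t) * (Im (fd f z u) * t - Im (f z) * (Im u * t\<^sup>2))" for u
    have "((\<lambda>w. (Im (f w) / Im w)\<^sup>2) has_derivative D2) (at z)"
    proof -
      note imf = bounded_linear.has_derivative[OF bounded_linear_Im smooth_fd[OF smooth z]]
      note imz = bounded_linear.has_derivative[OF bounded_linear_Im has_derivative_ident]
      have nz: "Im z \<noteq> 0" using pos[OF z] by simp
      note q = has_derivative_divide'[OF imf imz nz]
      show ?thesis unfolding power2_eq_square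
        by (rule has_derivative_eq_rhs[OF has_derivative_mult[OF q q]])
          (use nz in \<open>simp add: fun_eq_iff D2_def t_def power2_eq_square field_simps\<close>)
    qed
    then have d2: "(J has_derivative D2) (at z)"
      by (rule has_derivative_transform_within_open[OF _ open_uhp z]) (simp add: JJ)
    \<comment> \<open>The Jacobian is differentiated twice over, from its definition and from the
      area equation; comparing the results in the directions \<open>1\<close> and
      \<open>\<i>\<close> gives the hypotheses \<open>L1\<close> and \<open>L2\<close>.\<close>
    have D: "D1 u = D2 u" for u using has_derivative_unique[OF d1 d2] by simp
    have Js: "J z * s = Im (f z) * t\<^sup>2"
    proof -
      have "J z * s = (J z * s\<^sup>2) * Im (f z)" using v(1) by (simp add: power2_eq_square algebra_simps)
      then show ?thesis unfolding Jst by simp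
    qed
    have Jt: "J z = (Im (f z))\<^sup>2 * t\<^sup>2" using JJ[OF z] unfolding v(2) by (simp add: power_mult_distrib)
    have L1: "(Re (fd2 f z 1 1) * Im (Y z) - Im (fd2 f z 1 1) * Re (Y z)) + (Re (X z) * Im (fd2 f z 1 \<i>) - Im (X z) * Re (fd2 f z 1 \<i>))
        = 2 * J z * s * Im (X z)"
    proof -
      have "D2 1 = 2 * (Im (f z) * t\<^sup>2) * Im (X z)" by (simp add: D2_def X_def power2_eq_square)
      then show ?thesis using D[of 1] unfolding Js[symmetric] D1_def by (simp add: algebra_simps)
    qed
    have L2: "(Re (fd2 f z 1 \<i>) * Im (Y z) - Im (fd2 f z 1 \<i>) * Re (Y z)) + (Re (X z) * Im (fd2 f z \<i> \<i>) - Im (X z) * Re (fd2 f z \<i> \<i>))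
        = 2 * J z * s * Im (Y z) - 2 * J z * t"
    proof -
      have "D2 \<i> = 2 * (Im (f z) * t\<^sup>2) * Im (Y z) - 2 * ((Im (f z))\<^sup>2 * t\<^sup>2) * t"
        by (simp add: D2_def Y_def power2_eq_square algebra_simps)
      then show ?thesis using D[of \<i>] unfolding Js[symmetric] Jt[symmetric] D1_def fd2_commute[OF smooth z, of \<i> 1]
        by (simp add: algebra_simps)
    qed
    have M: "of_real (J z + (cmod (Y z))\<^sup>2) * (fd2 f z 1 1 + \<i> * s * X z * X z - Y z * t) - of_real (2 * Re (X z * cnj (Y z))) * (fd2 f z 1 \<i> + \<i> * s * X z * Y z + X z * t)
      + of_real (J z + (cmod (X z))\<^sup>2) * (fd2 f z \<i> \<i> + \<i> * s * Y z * Y z + Y z * t) = 0" (is "?M = 0")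
    proof -
      have "of_real (s\<^sup>2) * ?M = of_real (J z * s\<^sup>2 + (cmod (Y z))\<^sup>2 * s\<^sup>2) * (fd2 f z 1 1 + \<i> * s * X z * X z - Y z * t) - of_real (2 * (Re (X z * cnj (Y z)) * s\<^sup>2)) * (fd2 f z 1 \<i> + \<i> * s * X z * Y z + X z * t)
        + of_real (J z * s\<^sup>2 + (cmod (X z))\<^sup>2 * s\<^sup>2) * (fd2 f z \<i> \<i> + \<i> * s * Y z * Y z + Y z * t)"
        by (simp add: algebra_simps)
      also have "\<dots> = 0"
        unfolding Jst using minimal_equation[OF smooth maps[OF z] min z] Jpos[OF z]
        unfolding J_def X_def Y_def s_def t_def by blast
      finally show ?thesis using st by simp
    qed
    note A = angle_equations[of "X z" "Y z" "fd2 f z 1 1" "fd2 f z 1 \<i>" s "fd2 f z \<i> \<i>" t, folded J_def, OF Jpos[OF z] L1 L2 M, folded a_def c_def]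
    show "Im (Da z 1 * cnj (a z)) = (cmod (a z))\<^sup>2 * (1 / Im z - Re (X z) * (1 / Im (f z)))"
      using A(1) unfolding Da_def s_def t_def .
    show "Im (Da z \<i> * cnj (a z)) = - ((cmod (a z))\<^sup>2 * (Re (Y z) * (1 / Im (f z))))"
      using A(2) unfolding Da_def s_def fd2_commute[OF smooth z, of \<i> 1] .
    show "(cmod (a z))\<^sup>2 = (cmod (c z))\<^sup>2 + J z" using A(3) .
  qed
  have nz: "a z \<noteq> 0" if z: "z \<in> upper_half_plane" for z
  proof
    assume "a z = 0"
    then have "0 = (cmod (c z))\<^sup>2 + J z" using eqs(3)[OF z] by simp
    then show False using Jpos[OF z] by (smt (verit) zero_le_power2)
  qed
  have "continuous_on upper_half_plane a"
    using da has_derivative_continuous continuous_at_imp_continuous_on by blast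
  then obtain g where g: "continuous_on upper_half_plane g" "\<And>z. z \<in> upper_half_plane \<Longrightarrow> a z = exp (g z)"
    by (rule continuous_logarithm_on_contractible[OF _ convex_imp_contractible[OF convex_uhp] nz]) blast+
  define \<theta> where "\<theta> z = (pi - Im (g z)) / 2" for z
  have "conformal_ml f (fd f) \<theta> (\<lambda>z. cmod (a z)) c"
  proof
    fix z v :: complex assume z: "z \<in> upper_half_plane"
    show "f z \<in> upper_half_plane" using maps[OF z] .
    show "(f has_derivative fd f z) (at z)" by (rule smooth_fd[OF smooth z])
    show "(\<lambda>w. fd f w v) differentiable at z" using smooth_fd2[OF smooth z] differentiable_def by blast
    show "cmod (a z) > 0" using nz[OF z] by simp
    show "(cmod (a z))\<^sup>2 = (cmod (c z))\<^sup>2 + (Im (f z) / Im z)\<^sup>2" using eqs(3)[OF z] JJ[OF z] by simp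
    have "a z = of_real (cmod (a z)) * cis (Im (g z))"
      unfolding g(2)[OF z] exp_eq_polar[of "g z"] by (simp add: norm_mult)
    moreover have "cis (- 2 * \<theta> z) = - cis (Im (g z))"
    proof -
      have "- 2 * \<theta> z = Im (g z) - pi" by (simp add: \<theta>_def field_simps)
      then show ?thesis by (simp only: complex_eq_iff cis.sel cos_minus_pi sin_minus_pi uminus_complex.sel)
    qed
    ultimately have az: "a z = - of_real (cmod (a z)) * cis (- 2 * \<theta> z)" by simp
    have "fd f z v = a z * v + c z * cnj v"
      unfolding fd_expand[OF smooth z, of v] a_def c_def X_def Y_def
      by (simp add: complex_eq_iff field_simps)
    then show "fd f z v = - of_real (cmod (a z)) * cis (- 2 * \<theta> z) * v + c z * cnj v" using az by simp
    have dg: "(g has_derivative (\<lambda>v. Da z v / a z)) (at z)"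
      by (rule continuous_logarithm_has_derivative[OF open_uhp z g da[OF z]])
    have "(\<theta> has_derivative (\<lambda>v. - Im (Da z v / a z) / 2)) (at z)"
      unfolding \<theta>_def[abs_def]
      by (rule has_derivative_eq_rhs[OF bounded_linear.has_derivative[OF bounded_linear_divide
            has_derivative_diff[OF has_derivative_const bounded_linear.has_derivative[OF bounded_linear_Im dg]]]]) simp
    moreover have "- Im (Da z v / a z) = Re (fd f z v) / Im (f z) - Re v / Im z" for v
    proof -
      have im: "Im (w / a z) = Im (w * cnj (a z)) / (cmod (a z))\<^sup>2" for w
        by (metis Im_divide_of_real complex_div_cnj of_real_power)
      have lin: "Da z v = Re v *\<^sub>R Da z 1 + Im v *\<^sub>R Da z \<i>"
        using linear_add[OF has_derivative_linear[OF da[OF z]]] linear_scale[OF has_derivative_linear[OF da[OF z]]]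
          complex_expand[OF smooth, of v] by metis
      have "Im (Da z v * cnj (a z)) = Re v * Im (Da z 1 * cnj (a z)) + Im v * Im (Da z \<i> * cnj (a z))"
        unfolding lin by (simp add: algebra_simps)
      also have "\<dots> = (cmod (a z))\<^sup>2 * (Re v / Im z - (Re v * Re (X z) + Im v * Re (Y z)) / Im (f z))"
        unfolding eqs[OF z] by (simp add: algebra_simps diff_divide_distrib add_divide_distrib)
      also have "Re v * Re (X z) + Im v * Re (Y z) = Re (fd f z v)"
        unfolding fd_expand[OF smooth z, of v] X_def Y_def by simp
      finally show ?thesis unfolding im using nz[OF z] by simp
    qed
    ultimately show "(\<theta> has_derivative (\<lambda>v. (Re (fd f z v) / Im (f z) - Re v / Im z) / 2)) (at z)" by simp
  qed
  then show ?thesis by (rule that)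
qed

section \<open>Extensions of power functions\<close>

definition signed_powr :: "real \<Rightarrow> real \<Rightarrow> real" where
  "signed_powr \<alpha> x = (if x \<ge> 0 then x powr \<alpha> else - (\<bar>x\<bar> powr \<alpha>))"

lemma signed_powr_nonneg: "x \<ge> 0 \<Longrightarrow> signed_powr \<alpha> x = x powr \<alpha>"
  and signed_powr_minus: "signed_powr \<alpha> (- x) = - signed_powr \<alpha> x"
  by (auto simp: signed_powr_def)

lemma strict_mono_signed_powr:
  assumes "\<alpha> > 0"
  shows "strict_mono (signed_powr \<alpha>)"
proof (rule strict_monoI)
  fix x y :: real assume xy: "x < y"
  consider "x \<ge> 0" | "x < 0" "y \<ge> 0" | "y < 0" by linarith
  then show "signed_powr \<alpha> x < signed_powr \<alpha> y"
  proof cases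
    case 1 then show ?thesis using powr_less_mono2[of \<alpha> x y] assms xy by (simp add: signed_powr_def)
  next
    case 2
    then have "0 < \<bar>x\<bar> powr \<alpha>" "0 \<le> y powr \<alpha>" by simp_all
    then have "- (\<bar>x\<bar> powr \<alpha>) < y powr \<alpha>" by linarith
    then show ?thesis using 2 by (simp add: signed_powr_def)
  next
    case 3 then show ?thesis using powr_less_mono2[of \<alpha> "\<bar>y\<bar>" "\<bar>x\<bar>"] assms xy by (simp add: signed_powr_def)
  qed
qed

lemma signed_powr_inverse:
  assumes "\<alpha> > 0"
  shows "signed_powr \<alpha> (signed_powr (1 / \<alpha>) x) = x"
proof (cases "x \<ge> 0")
  case True
  then show ?thesis using assms by (simp add: signed_powr_nonneg powr_powr)
next
  case False
  then obtain y where "x = - y" "y \<ge> 0" by (metis linear neg_0_le_iff_le minus_minus)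
  then show ?thesis using assms by (simp add: signed_powr_minus signed_powr_nonneg powr_powr)
qed

lemma surj_signed_powr: "\<alpha> > 0 \<Longrightarrow> surj (signed_powr \<alpha>)"
  by (metis signed_powr_inverse surjI)

lemma continuous_signed_powr:
  assumes "\<alpha> > 0"
  shows "continuous_on UNIV (signed_powr \<alpha>)"
proof -
  have "continuous_on ({0..} \<union> {..0}) (\<lambda>x. if x \<ge> 0 then x powr \<alpha> else - ((-x) powr \<alpha>))"
    using assms
    by (intro continuous_on_If continuous_on_powr' continuous_intros) auto
  moreover have "{0..} \<union> {..0} = (UNIV :: real set)" by auto
  moreover have "signed_powr \<alpha> = (\<lambda>x. if x \<ge> 0 then x powr \<alpha> else - ((-x) powr \<alpha>))"
    by (auto simp: signed_powr_def fun_eq_iff)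
  ultimately show ?thesis by (simp only:)
qed

lemma minimal_lagrangian_boundary:
  assumes \<alpha>: "\<alpha> > 0" and ml: "minimal_lagrangian f" and ext: "extends_continuously f (power_map \<alpha>)"
  obtains \<theta> \<rho> c where "boundary_ml f (fd f) \<theta> \<rho> c (signed_powr \<alpha>)"
proof -
  obtain \<theta> \<rho> c where "conformal_ml f (fd f) \<theta> \<rho> c"
    using minimal_lagrangian_conformal[OF ml] .
  then interpret conformal_ml f "fd f" \<theta> \<rho> c .
  have "boundary_ml f (fd f) \<theta> \<rho> c (signed_powr \<alpha>)"
  proof
    show "bij_betw f upper_half_plane upper_half_plane" using ml by (simp add: minimal_lagrangian_def op_diffeo_def)
    show "strict_mono (signed_powr \<alpha>)" "continuous_on UNIV (signed_powr \<alpha>)" "surj (signed_powr \<alpha>)"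
      using \<alpha> by (simp_all add: strict_mono_signed_powr continuous_signed_powr surj_signed_powr)
    fix b :: real
    have "filterlim f (boundary_filter (power_map \<alpha> (Fin b))) (boundary_filter (Fin b))"
      using ext unfolding extends_continuously_def by blast
    then have "filterlim f (at (of_real (signed_powr \<alpha> b)) within upper_half_plane) (at (of_real b) within upper_half_plane)"
      by (simp add: signed_powr_def)
    then show "(f \<longlongrightarrow> of_real (signed_powr \<alpha> b)) (at (of_real b) within upper_half_plane)"
      by (simp add: filterlim_at)
    have "filterlim f (boundary_filter (power_map \<alpha> Infty)) (boundary_filter Infty)"
      using ext unfolding extends_continuously_def by blast
    then show "filterlim f at_infinity (inf at_infinity (principal upper_half_plane))"
      by (simp add: filterlim_inf)
  qed
  then show ?thesis by (rule that)
qed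

text \<open>Uniqueness, applied to \<open>\<lambda>\<^sup>-\<^sup>\<alpha> f(\<lambda>z)\<close>.\<close>

lemma boundary_ml_homogeneous:
  fixes \<alpha> r :: real
  assumes ml: "boundary_ml f f' \<theta> \<rho> c (signed_powr \<alpha>)" and r: "r > 0" and z: "z \<in> upper_half_plane"
  shows "f (of_real r * z) = of_real (r powr \<alpha>) * f z"
proof -
  interpret boundary_ml f f' \<theta> \<rho> c "signed_powr \<alpha>" by (rule ml)
  define s where "s = r powr - \<alpha>"
  have s: "s > 0" using r by (simp add: s_def)
  define g where "g z = of_real s * f (of_real r * z)" for z
  define g' where "g' z v = of_real s * f' (of_real r * z) (of_real r * v)" for z v
  have rU: "of_real r * z \<in> upper_half_plane" if "z \<in> upper_half_plane" for z using that r by (simp add: uhp_iff)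
  have bijr: "bij_betw ((*) (of_real t)) upper_half_plane upper_half_plane" if t: "t > 0" for t :: real
    by (rule bij_betwI[where g="(*) (of_real (1/t))"]) (use t in \<open>auto simp: uhp_iff field_simps\<close>)
  have tr: "filterlim ((*) (of_real t)) (at (of_real (t * b)) within upper_half_plane) (at (of_real b) within upper_half_plane)"
    if t: "t > 0" for t b :: real
  proof -
    have "((*) (of_real t) \<longlongrightarrow> of_real (t * b)) (at (of_real b :: complex) within upper_half_plane)"
      unfolding of_real_mult by (intro tendsto_intros)
    then show ?thesis using t
      by (auto simp: filterlim_at uhp_iff eventually_at_filter)
  qed
  have ti: "filterlim ((*) (of_real t)) (inf at_infinity (principal upper_half_plane)) (inf at_infinity (principal upper_half_plane))"
    if t: "t > 0" for t :: real
  proof -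
    have "filterlim ((*) (of_real t)) at_infinity (at_infinity :: complex filter)"
      by (rule tendsto_mult_filterlim_at_infinity[OF tendsto_const _ filterlim_ident]) (use t in simp)
    then have "filterlim ((*) (of_real t)) at_infinity (inf at_infinity (principal upper_half_plane))"
      by (rule filterlim_mono[OF _ order_refl inf_le1])
    moreover have "eventually (\<lambda>z. of_real t * z \<in> upper_half_plane) (inf at_infinity (principal upper_half_plane))"
      using t by (auto simp: eventually_inf_principal uhp_iff)
    ultimately show ?thesis by (simp add: filterlim_inf filterlim_principal)
  qed
  \<comment> \<open>Dilations are isometries without rotation, so \<open>\<theta>\<close> is merely
    precomposed, while the coefficients of the differential pick up the factor
    \<open>s * r\<close>.\<close>
  interpret B: boundary_ml g g' "\<lambda>z. \<theta> (of_real r * z)" "\<lambda>z. s * r * \<rho> (of_real r * z)" "\<lambda>z. of_real (s * r) * c (of_real r * z)" "signed_powr \<alpha>"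
  proof
    fix z v :: complex assume z: "z \<in> upper_half_plane"
    note rz = rU[OF z]
    have dr: "((*) (complex_of_real r) has_derivative (*) (of_real r)) (at z)"
      by (rule bounded_linear_imp_has_derivative[OF bounded_linear_mult_right])
    show "g z \<in> upper_half_plane" using maps[OF rz] s by (simp add: g_def uhp_iff)
    show "(g has_derivative g' z) (at z)"
      unfolding g_def[abs_def] g'_def
      by (rule has_derivative_mult_right[OF has_derivative_compose[OF dr deriv[OF rz]]])
    have "((\<lambda>w. f' w (of_real r * v)) \<circ> (*) (of_real r)) differentiable at z"
      using dr deriv2[OF rz] by (intro differentiable_chain_at) (auto simp: differentiable_def)
    then show "(\<lambda>w. g' w v) differentiable at z"
      unfolding g'_def o_def by (intro differentiable_mult differentiable_const)
    have "((\<lambda>w. \<theta> (of_real r * w)) has_derivative (\<lambda>v. (Re (f' (of_real r * z) (of_real r * v)) / Im (f (of_real r * z)) - Re (of_real r * v) / Im (of_real r * z)) / 2)) (at z)"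
      by (rule has_derivative_compose[OF dr angle[OF rz]])
    then show "((\<lambda>z. \<theta> (of_real r * z)) has_derivative (\<lambda>v. (Re (g' z v) / Im (g z) - Re v / Im z) / 2)) (at z)"
      using r s by (simp add: g_def g'_def)
    show "g' z v = - of_real (s * r * \<rho> (of_real r * z)) * cis (- 2 * \<theta> (of_real r * z)) * v + of_real (s * r) * c (of_real r * z) * cnj v"
      unfolding g'_def form[OF rz] by (simp add: algebra_simps)
    show "s * r * \<rho> (of_real r * z) > 0" using s r rho_pos[OF rz] by simp
    show "(s * r * \<rho> (of_real r * z))\<^sup>2 = (cmod (of_real (s * r) * c (of_real r * z)))\<^sup>2 + (Im (g z) / Im z)\<^sup>2"
      unfolding power_mult_distrib rho_sq[OF rz] using r s
      by (simp add: g_def norm_mult power_mult_distrib algebra_simps power_divide)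
  next
    show "bij_betw g upper_half_plane upper_half_plane"
      using bij_betw_trans[OF bij_betw_trans[OF bijr[OF r] bij] bijr[OF s]] by (simp add: g_def[abs_def] o_def)
    show "strict_mono (signed_powr \<alpha>)" "continuous_on UNIV (signed_powr \<alpha>)" "surj (signed_powr \<alpha>)"
      using \<phi>_mono \<phi>_cont \<phi>_surj by auto
    fix b :: real
    have hom: "s * signed_powr \<alpha> (r * b) = signed_powr \<alpha> b"
    proof (cases "b \<ge> 0")
      case True
      then show ?thesis using r by (simp add: s_def signed_powr_nonneg powr_mult powr_minus)
    next
      case False
      then obtain d where "b = - d" "d \<ge> 0" by (metis linear neg_0_le_iff_le minus_minus)
      then show ?thesis using r by (simp add: s_def signed_powr_minus signed_powr_nonneg powr_mult powr_minus)
    qed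
    have "((\<lambda>z. of_real s * f (of_real r * z)) \<longlongrightarrow> of_real s * of_real (signed_powr \<alpha> (r * b))) (at (of_real b) within upper_half_plane)"
      by (intro tendsto_mult tendsto_const filterlim_compose[OF extends_real tr[OF r]])
    then show "(g \<longlongrightarrow> of_real (signed_powr \<alpha> b)) (at (of_real b) within upper_half_plane)"
      unfolding g_def[abs_def] of_real_mult[symmetric] hom .
    show "filterlim g at_infinity (inf at_infinity (principal upper_half_plane))"
      unfolding g_def[abs_def]
      by (rule tendsto_mult_filterlim_at_infinity[OF tendsto_const _ filterlim_compose[OF extends_infty ti[OF r]]]) (use s in simp)
  qed
  interpret two_ml f f' \<theta> \<rho> c g g' "\<lambda>z. \<theta> (of_real r * z)" "\<lambda>z. s * r * \<rho> (of_real r * z)" "\<lambda>z. of_real (s * r) * c (of_real r * z)" "signed_powr \<alpha>" ..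
  have "f z = of_real s * f (of_real r * z)" using uniqueness[OF z] by (simp add: g_def)
  then show ?thesis using r by (simp add: s_def powr_minus field_simps)
qed

section \<open>The dilatation\<close>

lemma cis_cancel:
  assumes "s > 0" "t > 0" "of_real s * cis x = of_real t * cis y"
  shows "cis x = cis y"
proof -
  have "cmod (of_real s * cis x) = cmod (of_real t * cis y)" using assms(3) by simp
  then have "s = t" using assms(1,2) by (simp add: norm_mult)
  then show ?thesis using assms by simp
qed

lemma has_vector_derivative_along_circle:
  assumes "(F has_derivative D) (at (cis t))"
  shows "((\<lambda>t. F (cis t)) has_vector_derivative D (\<i> * cis t)) (at t)"
proof -
  have "(cis has_derivative (\<lambda>s. s *\<^sub>R (\<i> * cis t))) (at t)"
    by (rule has_derivative_eq_rhs[OF has_derivative_cis[OF has_derivative_ident]]) simp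
  from has_derivative_compose[OF this assms]
  show ?thesis unfolding has_vector_derivative_def
    by (simp add: linear_scale[OF has_derivative_linear[OF assms]])
qed

lemma cis_in_uhp: "0 < t \<Longrightarrow> t < pi \<Longrightarrow> cis t \<in> upper_half_plane"
  by (simp add: uhp_iff sin_gt_zero)

lemma uhp_not_real: "z \<in> upper_half_plane \<Longrightarrow> z \<noteq> of_real b"
  by (auto simp: uhp_iff)

locale homogeneous_ml = boundary_ml f f' \<theta> \<rho> c "signed_powr \<alpha>" for f f' \<theta> \<rho> c \<alpha> +
  assumes \<alpha>_ge: "\<alpha> \<ge> 1"
begin

lemma homogeneous: "r > 0 \<Longrightarrow> z \<in> upper_half_plane \<Longrightarrow> f (of_real r * z) = of_real (r powr \<alpha>) * f z"
  by (rule boundary_ml_homogeneous[OF boundary_ml_axioms])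

lemma scale_in_uhp: "r > 0 \<Longrightarrow> z \<in> upper_half_plane \<Longrightarrow> of_real r * z \<in> upper_half_plane" for r :: real
  by (simp add: uhp_iff)

lemma ray_deriv: "((\<lambda>t. of_real t * z) has_derivative (\<lambda>s. s *\<^sub>R z)) (at t)" for z :: complex
  unfolding scaleR_conv_of_real[symmetric]
  by (rule bounded_linear_imp_has_derivative[OF bounded_linear_scaleR_left])

lemma euler:
  assumes z: "z \<in> upper_half_plane"
  shows "f' z z = of_real \<alpha> * f z"
proof -
  have d: "(f has_derivative f' z) (at (of_real 1 * z))" using deriv[OF z] by simp
  have "((\<lambda>t. f (of_real t * z)) has_vector_derivative f' z z) (at 1)"
    using has_derivative_compose[OF ray_deriv d]
    unfolding has_vector_derivative_def by (simp add: linear_scale[OF f'_lin[OF z]])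
  moreover have "((\<lambda>t. f (of_real t * z)) has_vector_derivative of_real \<alpha> * f z) (at 1)"
  proof -
    have "((\<lambda>t. t powr \<alpha>) has_real_derivative \<alpha>) (at 1)"
      by (auto intro!: derivative_eq_intros)
    then have "((\<lambda>t. (t powr \<alpha>) *\<^sub>R f z) has_vector_derivative \<alpha> *\<^sub>R f z) (at 1)"
      unfolding has_real_derivative_iff_has_vector_derivative
      by (auto intro!: derivative_eq_intros)
    then show ?thesis
      unfolding scaleR_conv_of_real
      by (rule has_vector_derivative_transform_within_open[where S="{0<..}"]) (auto simp: homogeneous[OF _ z])
  qed
  ultimately show ?thesis by (rule vector_derivative_unique_at)
qed

lemma derivative_scale:
  assumes r: "r > 0" and z: "z \<in> upper_half_plane"
  shows "of_real r * f' (of_real r * z) v = of_real (r powr \<alpha>) * f' z v"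
proof -
  note rz = scale_in_uhp[OF r z]
  have "((*) (complex_of_real r) has_derivative (*) (of_real r)) (at z)"
    by (rule bounded_linear_imp_has_derivative[OF bounded_linear_mult_right])
  from has_derivative_compose[OF this deriv[OF rz]]
  have 1: "((\<lambda>w. f (of_real r * w)) has_derivative (\<lambda>v. f' (of_real r * z) (of_real r * v))) (at z)" .
  have "((\<lambda>w. of_real (r powr \<alpha>) * f w) has_derivative (\<lambda>v. of_real (r powr \<alpha>) * f' z v)) (at z)"
    by (rule has_derivative_mult_right[OF deriv[OF z]])
  then have 2: "((\<lambda>w. f (of_real r * w)) has_derivative (\<lambda>v. of_real (r powr \<alpha>) * f' z v)) (at z)"
    by (rule has_derivative_transform_within_open[OF _ open_uhp z]) (simp add: homogeneous[OF r])
  have "f' (of_real r * z) (of_real r * v) = of_real (r powr \<alpha>) * f' z v"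
    using has_derivative_unique[OF 1 2] by metis
  then show ?thesis using linear_scale[OF f'_lin[OF rz], of r v] by (simp add: scaleR_conv_of_real)
qed

text \<open>Homogeneity multiplies the complex-linear coefficient of the differential by a positive
  number along a ray. That coefficient determines \<open>cis (- 2 * \<theta>)\<close>, but
  \<open>\<theta>\<close> only up to multiples of pi.\<close>

lemma cis_angle_scale:
  assumes r: "r > 0" and z: "z \<in> upper_half_plane"
  shows "cis (- 2 * \<theta> (of_real r * z)) = cis (- 2 * \<theta> z)"
proof -
  note rz = scale_in_uhp[OF r z]
  have a: "f' w 1 - \<i> * f' w \<i> = - 2 * of_real (\<rho> w) * cis (- 2 * \<theta> w)" if "w \<in> upper_half_plane" for w
    unfolding form[OF that] by (simp add: algebra_simps)
  have "of_real r * (f' (of_real r * z) 1 - \<i> * f' (of_real r * z) \<i>) = of_real (r powr \<alpha>) * (f' z 1 - \<i> * f' z \<i>)"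
    using derivative_scale[OF r z, of 1] derivative_scale[OF r z, of \<i>]
    by (simp add: right_diff_distrib mult.left_commute[of _ \<i>])
  then have "of_real (r * \<rho> (of_real r * z)) * cis (- 2 * \<theta> (of_real r * z)) = of_real (r powr \<alpha> * \<rho> z) * cis (- 2 * \<theta> z)"
    unfolding a[OF z] a[OF rz] by (simp add: algebra_simps)
  then show ?thesis
    by (rule cis_cancel[rotated -1]) (use r rho_pos[OF z] rho_pos[OF rz] in simp_all)
qed

text \<open>The angle is constant along rays, so its radial derivative vanishes.\<close>

lemma radial_angle:
  assumes z: "z \<in> upper_half_plane"
  shows "\<alpha> * Re (f z) * Im z = Re z * Im (f z)"
proof -
  define D where "D = (Re (f' z z) / Im (f z) - Re z / Im z) / 2"
  define h where "h t = \<theta> (of_real t * z)" for t :: real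
  have ang: "(\<theta> has_derivative (\<lambda>v. (Re (f' z v) / Im (f z) - Re v / Im z) / 2)) (at (of_real 1 * z))"
    using angle[OF z] by simp
  have "(h has_derivative (\<lambda>s. s * D)) (at 1)"
    using has_derivative_compose[OF ray_deriv ang] unfolding h_def[abs_def] D_def
    by (simp add: linear_scale[OF f'_lin[OF z]] algebra_simps diff_divide_distrib)
  then have hd: "(h has_real_derivative D) (at 1)"
    by (simp add: has_field_derivative_def mult_commute_abs)
  \<comment> \<open>The sine of the doubled difference vanishes identically even if
    \<open>\<theta>\<close> is known only modulo pi, and its derivative at 1 still detects
    \<open>D\<close>.\<close>
  have "((\<lambda>t. sin (2 * h t - 2 * h 1)) has_real_derivative 2 * D) (at 1)"
    by (auto intro!: derivative_eq_intros hd)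
  moreover have "((\<lambda>t. sin (2 * h t - 2 * h 1)) has_real_derivative 0) (at 1)"
  proof (rule has_field_derivative_transform_within_open[of "\<lambda>_. 0" _ _ "{0<..}"])
    fix t :: real assume "t \<in> {0<..}"
    then have "cis (- 2 * h t) = cis (- 2 * h 1)" using cis_angle_scale[of t z] z by (simp add: h_def)
    then show "0 = sin (2 * h t - 2 * h 1)" by (simp add: complex_eq_iff sin_diff)
  qed auto
  ultimately have "D = 0" using DERIV_unique by fastforce
  then show ?thesis using Im_pos[OF z] euler[OF z] by (simp add: D_def field_simps)
qed

text \<open>Logarithmic derivative of \<open>f\<close> along circles centred at 0: \<open>p\<close>
  is the speed of the argument and \<open>- q\<close> that of the logarithm of the modulus.\<close>

definition p where "p z = Re (f' z (\<i> * z) / (\<i> * f z))"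
definition q where "q z = Im (f' z (\<i> * z) / (\<i> * f z))"

lemma f_nonzero: "z \<in> upper_half_plane \<Longrightarrow> f z \<noteq> 0"
  using Im_pos[of z] by auto

lemma angular_derivative:
  assumes z: "z \<in> upper_half_plane"
  shows "f' z (\<i> * z) = \<i> * Complex (p z) (q z) * f z"
proof -
  have "Complex (p z) (q z) = f' z (\<i> * z) / (\<i> * f z)" by (simp add: p_def q_def complex_eq_iff)
  then show ?thesis using f_nonzero[OF z] by simp
qed

text \<open>\<open>A\<close> and \<open>C\<close> are the complex-linear and antilinear parts of the
  differential applied to \<open>z\<close>. The radial direction gives their sum by Euler's relation
  and the direction \<open>\<i> * z\<close> their difference; the second identity expresses the
  Jacobian through these.\<close>

lemma components:
  assumes z: "z \<in> upper_half_plane"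
  shows "2 * of_real (\<rho> z) * (cis (- 2 * \<theta> z) * z) = - (Complex (\<alpha> + p z) (q z) * f z)"
    and "\<alpha> * p z * (cmod (f z))\<^sup>2 = (cmod z)\<^sup>2 * (Im (f z) / Im z)\<^sup>2"
proof -
  define A C where "A = - of_real (\<rho> z) * cis (- 2 * \<theta> z) * z" and "C = c z * cnj z"
  have AC: "A + C = of_real \<alpha> * f z" using euler[OF z] form[OF z, of z] by (simp add: A_def C_def)
  have "f' z (\<i> * z) = \<i> * (A - C)"
    unfolding form[OF z, of "\<i> * z"] by (simp add: A_def C_def algebra_simps)
  then have "\<i> * (A - C) = \<i> * (Complex (p z) (q z) * f z)"
    using angular_derivative[OF z] by (simp add: mult.assoc)
  then have AC': "A - C = Complex (p z) (q z) * f z" by simp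
  have "2 * A = (A + C) + (A - C)" by simp
  also have "\<dots> = Complex (\<alpha> + p z) (q z) * f z"
    unfolding AC AC' by (simp add: complex_eq_iff algebra_simps)
  finally show "2 * of_real (\<rho> z) * (cis (- 2 * \<theta> z) * z) = - (Complex (\<alpha> + p z) (q z) * f z)"
    by (simp add: A_def algebra_simps minus_equation_iff)
  have "Re ((A + C) * cnj (A - C)) = (cmod A)\<^sup>2 - (cmod C)\<^sup>2"
    unfolding cmod_power2 by (simp add: power2_eq_square algebra_simps)
  also have "\<dots> = (cmod z)\<^sup>2 * (Im (f z) / Im z)\<^sup>2"
    using rho_sq[OF z] by (simp add: A_def C_def norm_mult power_mult_distrib algebra_simps)
  finally show "\<alpha> * p z * (cmod (f z))\<^sup>2 = (cmod z)\<^sup>2 * (Im (f z) / Im z)\<^sup>2"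
    unfolding AC AC' unfolding cmod_power2 by (simp add: power2_eq_square algebra_simps)
qed

text \<open>
  Here \<open>h\<close> is the sine of the angle between \<open>a z\<close> and \<open>f z\<close>, where \<open>a\<close> is the
  \<open>\<complex>\<close>-linear part of the differential, divided by the product of the sines of the arguments of
  \<open>z\<close> and \<open>f z\<close>.
\<close>

definition H where "H z = cis (- 2 * \<theta> z) * z * cnj (f z)"
definition h where "h z = - Im (H z) / (Im z * Im (f z))"

lemma H_components:
  assumes z: "z \<in> upper_half_plane"
  shows "2 * \<rho> z * Re (H z) = - ((\<alpha> + p z) * (cmod (f z))\<^sup>2)" "2 * \<rho> z * Im (H z) = - (q z * (cmod (f z))\<^sup>2)"
proof -
  have "of_real (2 * \<rho> z) * H z = (2 * of_real (\<rho> z) * (cis (- 2 * \<theta> z) * z)) * cnj (f z)"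
    by (simp add: H_def algebra_simps)
  also have "\<dots> = - (Complex (\<alpha> + p z) (q z) * (f z * cnj (f z)))"
    unfolding components(1)[OF z] by (simp add: algebra_simps)
  also have "\<dots> = - (Complex (\<alpha> + p z) (q z) * of_real ((cmod (f z))\<^sup>2))"
    by (simp only: complex_norm_square)
  finally have e: "of_real (2 * \<rho> z) * H z = - (Complex (\<alpha> + p z) (q z) * of_real ((cmod (f z))\<^sup>2))" .
  show "2 * \<rho> z * Re (H z) = - ((\<alpha> + p z) * (cmod (f z))\<^sup>2)" using arg_cong[OF e, of Re] by simp
  show "2 * \<rho> z * Im (H z) = - (q z * (cmod (f z))\<^sup>2)" using arg_cong[OF e, of Im] by simp
qed

lemma h_sign:
  assumes z: "z \<in> upper_half_plane"
  shows "2 * \<rho> z * Im z * Im (f z) * h z = q z * (cmod (f z))\<^sup>2"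
  using H_components(2)[OF z] Im_pos[OF z] by (simp add: h_def field_simps)

text \<open>\<open>h\<close> is a first integral along circles centred at 0. The derivative of
  \<open>\<theta>\<close> comes from \<open>angle\<close> and that of \<open>f\<close> from
  \<open>p\<close> and \<open>q\<close>; with the relation of \<open>radial_angle\<close> the two
  halves of the quotient rule cancel.\<close>

lemma h_angular_derivative:
  assumes z: "z \<in> upper_half_plane"
  obtains D where "(h has_derivative D) (at z)" "D (\<i> * z) = 0"
proof -
  define \<theta>' where "\<theta>' v = (Re (f' z v) / Im (f z) - Re v / Im z) / 2" for v
  define K where "K v = (cis (- 2 * \<theta> z) * v + (- 2 * \<theta>' v) *\<^sub>R (\<i> * cis (- 2 * \<theta> z)) * z) * cnj (f z)" for v
  define H' where "H' v = cis (- 2 * \<theta> z) * z * cnj (f' z v) + K v" for v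
  have t: "((\<lambda>w. - 2 * \<theta> w) has_derivative (\<lambda>v. - 2 * \<theta>' v)) (at z)"
    unfolding \<theta>'_def by (rule has_derivative_mult_right[OF angle[OF z]])
  have dH: "(H has_derivative H') (at z)"
    unfolding H_def[abs_def] H'_def[abs_def] K_def
    by (intro has_derivative_mult has_derivative_cis t has_derivative_ident
        bounded_linear.has_derivative[OF bounded_linear_cnj] deriv[OF z])
  note imf = bounded_linear.has_derivative[OF bounded_linear_Im deriv[OF z]]
  note imz = bounded_linear.has_derivative[OF bounded_linear_Im has_derivative_ident]
  note imH = bounded_linear.has_derivative[OF bounded_linear_Im dH]
  have nz: "Im z * Im (f z) \<noteq> 0" using Im_pos[OF z] by simp
  note hd = has_derivative_divide'[OF has_derivative_minus[OF imH] has_derivative_mult[OF imz imf] nz]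
  define x y u v P Q where "x = Re z" and "y = Im z" and "u = Re (f z)" and "v = Im (f z)" and "P = p z" and "Q = q z"
  have v: "v > 0" and y: "y > 0" using Im_pos[OF z] by (simp_all add: v_def y_def)
  have fi: "Re (f' z (\<i> * z)) = - P * v - Q * u" "Im (f' z (\<i> * z)) = P * u - Q * v"
    unfolding angular_derivative[OF z] by (simp_all add: P_def Q_def u_def v_def algebra_simps)
  have ti: "- 2 * \<theta>' (\<i> * z) = P - 1 + Q * u / v"
    unfolding \<theta>'_def fi v_def[symmetric] using v y by (simp add: y_def[symmetric] field_simps)
  have "H' (\<i> * z) = H z * (\<i> * of_real (1 + - 2 * \<theta>' (\<i> * z)) + cnj (\<i> * Complex (p z) (q z)))"
    unfolding H'_def K_def angular_derivative[OF z] H_def by (simp add: scaleR_conv_of_real algebra_simps)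
  also have "\<dots> = H z * (of_real Q * Complex (- 1) (u / v))"
    unfolding ti by (simp add: complex_eq_iff P_def Q_def)
  finally have H': "Im (H' (\<i> * z)) = Q * (Re (H z) * (u / v) - Im (H z))" by (simp add: algebra_simps)
  have "2 * \<rho> z * (Im (H' (\<i> * z)) * (y * v)) = Q * y * ((2 * \<rho> z * Re (H z)) * u - (2 * \<rho> z * Im (H z)) * v)"
    unfolding H' using v by (simp add: field_simps)
  also have "\<dots> = (cmod (f z))\<^sup>2 * Q * y * (- (\<alpha> + P) * u + Q * v)"
    unfolding H_components[OF z] P_def[symmetric] Q_def[symmetric] by (simp add: algebra_simps)
  also have "\<dots> = - ((cmod (f z))\<^sup>2 * Q) * (\<alpha> * u * y + y * (P * u - Q * v))"
    by (simp add: algebra_simps)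
  also have "\<alpha> * u * y = x * v" using radial_angle[OF z] by (simp add: x_def y_def u_def v_def)
  also have "- ((cmod (f z))\<^sup>2 * Q) = 2 * \<rho> z * Im (H z)"
    unfolding H_components[OF z] Q_def by simp
  finally have "2 * \<rho> z * (Im (H' (\<i> * z)) * (y * v)) = 2 * \<rho> z * (Im (H z) * (x * v + y * (P * u - Q * v)))"
    by (simp add: algebra_simps)
  then have key: "Im (H' (\<i> * z)) * (y * v) = Im (H z) * (x * v + y * (P * u - Q * v))"
    using rho_pos[OF z] by simp
  show ?thesis
  proof (rule that)
    show "(h has_derivative (\<lambda>w. ((- Im (H' w)) * (Im z * Im (f z)) - (- Im (H z)) * (Im z * Im (f' z w) + Im w * Im (f z))) / ((Im z * Im (f z)) * (Im z * Im (f z))))) (at z)"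
      unfolding h_def[abs_def] by (rule hd)
    show "((- Im (H' (\<i> * z))) * (Im z * Im (f z)) - (- Im (H z)) * (Im z * Im (f' z (\<i> * z)) + Im (\<i> * z) * Im (f z))) / ((Im z * Im (f z)) * (Im z * Im (f z))) = 0"
      unfolding fi using key unfolding x_def y_def v_def by (simp add: algebra_simps)
  qed
qed

text \<open>The squared modulus satisfies \<open>M' = - 2 * q * M\<close>, and \<open>q\<close> has
  the sign of \<open>h\<close>, which is constant along the half-circle. So \<open>M\<close> is
  monotone there, and its limits at the end points 1 and -1 both equal 1.\<close>

lemma modulus_on_circle:
  assumes t: "0 < t" "t < pi"
  shows "(cmod (f (cis t)))\<^sup>2 = 1"
proof -
  define M where "M t = (cmod (f (cis t)))\<^sup>2" for t
  have dM: "(M has_real_derivative - 2 * q (cis t) * M t) (at t)" if "0 < t" "t < pi" for t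
  proof -
    note U = cis_in_uhp[OF that]
    note fd = has_vector_derivative_along_circle[OF deriv[OF U]]
    have "((\<lambda>t. f (cis t) \<bullet> f (cis t)) has_vector_derivative f (cis t) \<bullet> f' (cis t) (\<i> * cis t) + f' (cis t) (\<i> * cis t) \<bullet> f (cis t)) (at t)"
      by (rule bounded_bilinear.has_vector_derivative[OF bounded_bilinear_inner fd fd])
    moreover have "f (cis t) \<bullet> f' (cis t) (\<i> * cis t) + f' (cis t) (\<i> * cis t) \<bullet> f (cis t) = - 2 * q (cis t) * M t"
      unfolding angular_derivative[OF U] M_def cmod_power2
      by (simp add: inner_complex_def power2_eq_square algebra_simps)
    ultimately show ?thesis
      by (simp add: has_real_derivative_iff_has_vector_derivative M_def[abs_def] power2_norm_eq_inner)
  qed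
  have dh: "((\<lambda>t. h (cis t)) has_real_derivative 0) (at t)" if t: "0 < t" "t < pi" for t
  proof -
    obtain D where D: "(h has_derivative D) (at (cis t))" "D (\<i> * cis t) = 0"
      using h_angular_derivative[OF cis_in_uhp[OF t]] .
    show ?thesis using has_vector_derivative_along_circle[OF D(1)] D(2)
      by (simp add: has_real_derivative_iff_has_vector_derivative)
  qed
  have hc: "h (cis s) = h (cis t)" if "0 < s" "s < pi" for s
    by (rule DERIV_isconst3[of 0 pi s t "\<lambda>t. h (cis t)"]) (use t that dh in auto)
  have qs: "q (cis s) * M s = 2 * \<rho> (cis s) * Im (cis s) * Im (f (cis s)) * h (cis t)" if "0 < s" "s < pi" for s
    using h_sign[OF cis_in_uhp[OF that]] hc[OF that] by (simp add: M_def)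
  have pos: "2 * \<rho> (cis s) * Im (cis s) * Im (f (cis s)) \<ge> 0" if "0 < s" "s < pi" for s
    using rho_pos[OF cis_in_uhp[OF that]] Im_pos[OF cis_in_uhp[OF that]] by (intro mult_nonneg_nonneg) auto
  have at0: "(M \<longlongrightarrow> 1) (at_right 0)"
  proof -
    have "filterlim cis (at (of_real 1) within upper_half_plane) (at_right 0)"
      unfolding filterlim_at
    proof
      show "(cis \<longlongrightarrow> of_real 1) (at_right 0)"
        by (rule tendsto_eq_rhs[OF tendsto_cis[OF tendsto_ident_at]]) simp
      show "\<forall>\<^sub>F x in at_right 0. cis x \<in> upper_half_plane \<and> cis x \<noteq> of_real 1"
        unfolding eventually_at_right_field
        by (rule exI[of _ pi]) (use cis_in_uhp uhp_not_real in \<open>metis pi_gt_zero\<close>)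
    qed
    from filterlim_compose[OF extends_real this]
    have "((\<lambda>t. f (cis t)) \<longlongrightarrow> of_real (signed_powr \<alpha> 1)) (at_right 0)" .
    from tendsto_power[OF tendsto_norm[OF this], of 2] show ?thesis
      by (simp add: M_def[abs_def] signed_powr_def)
  qed
  have atpi: "(M \<longlongrightarrow> 1) (at_left pi)"
  proof -
    have "filterlim cis (at (of_real (- 1)) within upper_half_plane) (at_left pi)"
      unfolding filterlim_at
    proof
      show "(cis \<longlongrightarrow> of_real (- 1)) (at_left pi)"
        by (rule tendsto_eq_rhs[OF tendsto_cis[OF tendsto_ident_at]]) simp
      show "\<forall>\<^sub>F x in at_left pi. cis x \<in> upper_half_plane \<and> cis x \<noteq> of_real (- 1)"
        unfolding eventually_at_left_field
        by (rule exI[of _ 0]) (use cis_in_uhp uhp_not_real in \<open>metis pi_gt_zero\<close>)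
    qed
    from filterlim_compose[OF extends_real this]
    have "((\<lambda>t. f (cis t)) \<longlongrightarrow> of_real (signed_powr \<alpha> (- 1))) (at_left pi)" .
    from tendsto_power[OF tendsto_norm[OF this], of 2] show ?thesis
      by (simp add: M_def[abs_def] signed_powr_def)
  qed
  have ev0: "\<forall>\<^sub>F s in at_right 0. 0 < s \<and> s < t" unfolding eventually_at_right_field using t by blast
  have evpi: "\<forall>\<^sub>F s in at_left pi. t < s \<and> s < pi" unfolding eventually_at_left_field using t by blast
  show ?thesis
  proof (cases "h (cis t) \<ge> 0")
    case True
    have mono: "M b \<le> M a" if "0 < a" "a \<le> b" "b < pi" for a b
    proof (rule DERIV_nonpos_imp_nonincreasing[OF that(2)])
      fix x assume "a \<le> x" "x \<le> b"
      then have x: "0 < x" "x < pi" using that by auto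
      have "q (cis x) * M x \<ge> 0" unfolding qs[OF x] by (rule mult_nonneg_nonneg[OF pos[OF x] True])
      then have "- 2 * q (cis x) * M x \<le> 0" by (simp add: mult.commute)
      then show "\<exists>y. (M has_real_derivative y) (at x) \<and> y \<le> 0" using dM[OF x] by blast
    qed
    have "M t \<le> 1" by (rule tendsto_lowerbound[OF at0 eventually_mono[OF ev0]]) (use mono t in auto)
    moreover have "M t \<ge> 1" by (rule tendsto_upperbound[OF atpi eventually_mono[OF evpi]]) (use mono t in auto)
    ultimately show ?thesis by (simp add: M_def)
  next
    case False
    have mono: "M a \<le> M b" if "0 < a" "a \<le> b" "b < pi" for a b
    proof (rule DERIV_nonneg_imp_nondecreasing[OF that(2)])
      fix x assume "a \<le> x" "x \<le> b"
      then have x: "0 < x" "x < pi" using that by auto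
      have "q (cis x) * M x \<le> 0" unfolding qs[OF x] by (rule mult_nonneg_nonpos[OF pos[OF x]]) (use False in simp)
      then have "- 2 * q (cis x) * M x \<ge> 0" by (simp add: mult.commute)
      then show "\<exists>y. (M has_real_derivative y) (at x) \<and> y \<ge> 0" using dM[OF x] by blast
    qed
    have "M t \<ge> 1" by (rule tendsto_upperbound[OF at0 eventually_mono[OF ev0]]) (use mono t in auto)
    moreover have "M t \<le> 1" by (rule tendsto_lowerbound[OF atpi eventually_mono[OF evpi]]) (use mono t in auto)
    ultimately show ?thesis by (simp add: M_def)
  qed
qed

section \<open>Singular values of the differential and the dilatation\<close>

lemma modulus:
  assumes z: "z \<in> upper_half_plane"
  shows "(cmod (f z))\<^sup>2 = (cmod z powr \<alpha>)\<^sup>2"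
proof -
  have z0: "z \<noteq> 0" using Im_pos[OF z] by auto
  have "0 < Arg z" "Arg z < pi" using Im_pos[OF z] Arg_lt_pi[of z] by auto
  then have "(cmod (f (cis (Arg z))))\<^sup>2 = 1" "cis (Arg z) \<in> upper_half_plane" using modulus_on_circle cis_in_uhp by auto
  moreover have "z = of_real (cmod z) * cis (Arg z)" using rcis_cmod_Arg[of z] by (simp add: rcis_def)
  ultimately have "(cmod (f z))\<^sup>2 = (cmod z powr \<alpha>)\<^sup>2 * 1"
    using homogeneous[of "cmod z" "cis (Arg z)"] z0 by (metis norm_mult norm_of_real abs_of_nonneg powr_ge_zero power_mult_distrib zero_less_norm_iff)
  then show ?thesis by simp
qed

lemma q_eq_0:
  assumes z: "z \<in> upper_half_plane"
  shows "q z = 0"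
proof -
  have 1: "((\<lambda>w. f w \<bullet> f w) has_derivative (\<lambda>v. f z \<bullet> f' z v + f' z v \<bullet> f z)) (at z)"
    by (rule bounded_bilinear.FDERIV[OF bounded_bilinear_inner deriv[OF z] deriv[OF z]])
  have z0: "z \<bullet> z > 0" using Im_pos[OF z] by auto
  have "((\<lambda>w. (w \<bullet> w) powr \<alpha>) has_derivative (\<lambda>v. (z \<bullet> z) powr \<alpha> * (\<alpha> * (z \<bullet> v + v \<bullet> z) / (z \<bullet> z)))) (at z)"
    using z0 by (auto intro!: derivative_eq_intros)
  then have 2: "((\<lambda>w. f w \<bullet> f w) has_derivative (\<lambda>v. (z \<bullet> z) powr \<alpha> * (\<alpha> * (z \<bullet> v + v \<bullet> z) / (z \<bullet> z)))) (at z)"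
    by (rule has_derivative_transform_within_open[OF _ open_uhp z])
      (simp only: power2_norm_eq_inner[symmetric] modulus, simp add: powr_mult power2_eq_square)
  have 3: "z \<bullet> (\<i> * z) + (\<i> * z) \<bullet> z = 0" by (simp add: inner_complex_def)
  have "f z \<bullet> f' z (\<i> * z) + f' z (\<i> * z) \<bullet> f z = 0"
    unfolding fun_cong[OF has_derivative_unique[OF 1 2], of "\<i> * z"] 3 by simp
  moreover have "f z \<bullet> f' z (\<i> * z) + f' z (\<i> * z) \<bullet> f z = - 2 * q z * (cmod (f z))\<^sup>2"
    unfolding angular_derivative[OF z] cmod_power2
    by (simp add: inner_complex_def power2_eq_square algebra_simps)
  ultimately have "q z * (cmod (f z))\<^sup>2 = 0" by simp
  then show ?thesis using f_nonzero[OF z] by simp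
qed

text \<open>With \<open>\<alpha> * u * y = x * v\<close> the second identity of
  \<open>components\<close> becomes \<open>\<alpha> * p z * (u\<^sup>2 + v\<^sup>2) =
  \<alpha>\<^sup>2 * u\<^sup>2 + v\<^sup>2\<close>, so \<open>\<alpha> * p z\<close> is a weighted
  mean of 1 and \<open>\<alpha>\<^sup>2\<close>.\<close>

lemma p_bounds:
  assumes z: "z \<in> upper_half_plane"
  shows "1 / \<alpha> \<le> p z" "p z \<le> \<alpha>"
proof -
  define x y u v where "x = Re z" and "y = Im z" and "u = Re (f z)" and "v = Im (f z)"
  have v: "v > 0" and y: "y > 0" using Im_pos[OF z] by (simp_all add: v_def y_def)
  have e: "\<alpha> * u * y = x * v" using radial_angle[OF z] by (simp add: x_def y_def u_def v_def)
  have "\<alpha> * p z * (u\<^sup>2 + v\<^sup>2) = (x\<^sup>2 + y\<^sup>2) * (v / y)\<^sup>2"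
    using components(2)[OF z] by (simp add: cmod_power2 x_def y_def u_def v_def)
  also have "\<dots> = ((x * v)\<^sup>2 + (y * v)\<^sup>2) / y\<^sup>2"
    using y by (simp add: field_simps)
  also have "\<dots> = \<alpha>\<^sup>2 * u\<^sup>2 + v\<^sup>2"
    unfolding e[symmetric] using y by (simp add: field_simps)
  finally have p: "\<alpha> * p z * (u\<^sup>2 + v\<^sup>2) = \<alpha>\<^sup>2 * u\<^sup>2 + v\<^sup>2" .
  have a: "\<alpha>\<^sup>2 \<ge> 1" "\<alpha> > 0" using \<alpha>_ge by simp_all
  have pos: "u\<^sup>2 + v\<^sup>2 > 0" using v by (simp add: add_nonneg_pos)
  have "1 * (u\<^sup>2 + v\<^sup>2) \<le> \<alpha> * p z * (u\<^sup>2 + v\<^sup>2)"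
    unfolding p using mult_right_mono[OF a(1), of "u\<^sup>2"] by simp
  then have "1 \<le> \<alpha> * p z" using pos mult_le_cancel_right_pos by blast
  then show "1 / \<alpha> \<le> p z" using a by (simp add: field_simps)
  have "\<alpha> * p z * (u\<^sup>2 + v\<^sup>2) \<le> \<alpha>\<^sup>2 * (u\<^sup>2 + v\<^sup>2)"
    unfolding p using mult_right_mono[OF a(1), of "v\<^sup>2"] by (simp add: algebra_simps)
  then have "\<alpha> * p z \<le> \<alpha>\<^sup>2" using pos mult_le_cancel_right_pos by blast
  then show "p z \<le> \<alpha>" using a by (simp add: power2_eq_square)
qed

text \<open>Since \<open>q = 0\<close>, the differential is diagonal in the orthogonal bases
  \<open>z, \<i> * z\<close> and \<open>f z, \<i> * f z\<close>, with factors
  \<open>\<alpha>\<close> and \<open>p z\<close>, both between \<open>1 / \<alpha>\<close> and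
  \<open>\<alpha>\<close>; \<open>k\<close> accounts for the lengths of the basis vectors.\<close>

lemma derivative_bounds:
  assumes z: "z \<in> upper_half_plane"
  defines "k \<equiv> cmod (f z) / cmod z"
  shows "cmod (f' z w) \<le> \<alpha> * k * cmod w" "k / \<alpha> * cmod w \<le> cmod (f' z w)"
proof -
  have z0: "z \<noteq> 0" using Im_pos[OF z] by auto
  define s t where "s = Re (w / z)" and "t = Im (w / z)"
  have w: "w = s *\<^sub>R z + t *\<^sub>R (\<i> * z)"
  proof -
    have "w = (w / z) * z" using z0 by simp
    also have "w / z = of_real s + of_real t * \<i>" by (simp add: s_def t_def complex_eq_iff)
    finally show ?thesis by (simp add: scaleR_conv_of_real algebra_simps)
  qed
  have "f' z w = s *\<^sub>R f' z z + t *\<^sub>R f' z (\<i> * z)"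
    unfolding w by (simp only: linear_add[OF f'_lin[OF z]] linear_scale[OF f'_lin[OF z]])
  also have "\<dots> = Complex (\<alpha> * s) (p z * t) * f z"
    unfolding euler[OF z] angular_derivative[OF z] q_eq_0[OF z] by (simp add: complex_eq_iff algebra_simps)
  finally have fw: "(cmod (f' z w))\<^sup>2 = ((\<alpha> * s)\<^sup>2 + (p z * t)\<^sup>2) * (cmod (f z))\<^sup>2"
    by (simp add: norm_mult power_mult_distrib cmod_power2[of "Complex _ _"])
  have "(cmod (w / z))\<^sup>2 = s\<^sup>2 + t\<^sup>2" by (simp add: cmod_power2 s_def t_def)
  then have "(cmod (w / z) * cmod (f z))\<^sup>2 = (s\<^sup>2 + t\<^sup>2) * (cmod (f z))\<^sup>2"
    by (simp add: power_mult_distrib)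
  moreover have "cmod (w / z) * cmod (f z) = k * cmod w" by (simp add: k_def norm_divide)
  ultimately have kw: "(k * cmod w)\<^sup>2 = (s\<^sup>2 + t\<^sup>2) * (cmod (f z))\<^sup>2" by simp
  have a1: "\<alpha> > 0" using \<alpha>_ge by simp
  have "1 / \<alpha> \<le> 1" using \<alpha>_ge by simp
  then have a: "\<alpha> \<ge> 1" "1 / \<alpha> > 0" "1 / \<alpha> \<le> \<alpha>" using \<alpha>_ge a1 by (simp_all only: order_trans zero_less_divide_1_iff)
  have p: "1 / \<alpha> \<le> p z" "p z \<le> \<alpha>" "p z > 0" using p_bounds[OF z] less_le_trans[OF a(2)] by auto
  have k0: "k \<ge> 0" by (simp add: k_def)
  have "(\<alpha> * s)\<^sup>2 + (p z * t)\<^sup>2 \<le> \<alpha>\<^sup>2 * (s\<^sup>2 + t\<^sup>2)"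
    using mult_right_mono[OF power_mono[OF p(2), of 2], of "t\<^sup>2"] p(3) by (simp add: power_mult_distrib algebra_simps)
  from mult_right_mono[OF this, of "(cmod (f z))\<^sup>2"] have "(cmod (f' z w))\<^sup>2 \<le> (\<alpha> * (k * cmod w))\<^sup>2"
    unfolding fw power_mult_distrib[of \<alpha> "k * cmod w"] kw by (simp add: mult.assoc)
  then have "cmod (f' z w) \<le> \<alpha> * (k * cmod w)" by (rule power2_le_imp_le) (use a k0 in simp)
  then show "cmod (f' z w) \<le> \<alpha> * k * cmod w" by (simp only: mult.assoc)
  have "(1 / \<alpha>)\<^sup>2 * (s\<^sup>2 + t\<^sup>2) \<le> (\<alpha> * s)\<^sup>2 + (p z * t)\<^sup>2"
    using mult_right_mono[OF power_mono[OF a(3), of 2], of "s\<^sup>2"] mult_right_mono[OF power_mono[OF p(1), of 2], of "t\<^sup>2"] a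
    unfolding power_mult_distrib distrib_left by simp
  from mult_right_mono[OF this, of "(cmod (f z))\<^sup>2"] have "(1 / \<alpha> * (k * cmod w))\<^sup>2 \<le> (cmod (f' z w))\<^sup>2"
    unfolding fw power_mult_distrib[of "1 / \<alpha>"] kw by (simp add: mult.assoc)
  then have "1 / \<alpha> * (k * cmod w) \<le> cmod (f' z w)" by (rule power2_le_imp_le) simp
  then show "k / \<alpha> * cmod w \<le> cmod (f' z w)" by simp
qed

lemma dilatation_bounds:
  assumes z: "z \<in> upper_half_plane"
  shows "1 \<le> dilatation_at f z" "dilatation_at f z \<le> \<alpha>\<^sup>2"
proof -
  have fd: "frechet_derivative f (at z) = f' z" using frechet_derivative_at[OF deriv[OF z]] by simp
  define k where "k = cmod (f z) / cmod z"
  have "z \<noteq> 0" using Im_pos[OF z] by auto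
  then have k: "k > 0" using f_nonzero[OF z] by (simp add: k_def)
  have a: "\<alpha> \<ge> 1" using \<alpha>_ge .
  have b: "cmod (f' z v) \<le> \<alpha> * k" "k / \<alpha> \<le> cmod (f' z v)" if "v \<in> sphere 0 1" for v
    using derivative_bounds[OF z, of v, folded k_def] that by auto
  define M m where "M = (SUP v\<in>sphere 0 1. norm (f' z v))" and "m = (INF v\<in>sphere 0 1. norm (f' z v))"
  have one: "(1::complex) \<in> sphere 0 1" by simp
  have ne: "sphere (0::complex) 1 \<noteq> {}" using one by blast
  have M: "M \<le> \<alpha> * k" unfolding M_def by (rule cSUP_least[OF ne b(1)])
  have m: "k / \<alpha> \<le> m" unfolding m_def by (rule cINF_greatest[OF ne b(2)])
  have "m \<le> norm (f' z 1)" unfolding m_def by (rule cINF_lower[OF _ one]) (auto intro: bdd_belowI2[of _ 0])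
  also have "\<dots> \<le> M" unfolding M_def by (rule cSUP_upper[OF one]) (auto intro!: bdd_aboveI2[of _ _ "\<alpha> * k"] b(1))
  finally have mM: "m \<le> M" .
  have m0: "m > 0" using m k a by (smt (verit) divide_pos_pos)
  have d: "dilatation_at f z = M / m" by (simp add: dilatation_at_def fd M_def m_def)
  show "1 \<le> dilatation_at f z" unfolding d using m0 mM by simp
  have "M \<le> \<alpha>\<^sup>2 * (k / \<alpha>)" using M a by (simp add: power2_eq_square)
  also have "\<dots> \<le> \<alpha>\<^sup>2 * m" using m by (intro mult_left_mono) auto
  finally show "dilatation_at f z \<le> \<alpha>\<^sup>2" unfolding d using m0 by (simp add: divide_le_eq)
qed

text \<open>The supremum lies between 1 and \<open>\<alpha>\<^sup>2\<close>, so
  \<open>ereal_ln\<close> is evaluated in its finite branch.\<close>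

lemma ereal_ln_max_dilatation:
  obtains L where "ereal_ln (max_dilatation f) = ereal L" "0 \<le> L" "L \<le> 2 * ln \<alpha>"
proof -
  have "\<i> \<in> upper_half_plane" by (simp add: uhp_iff)
  then have "ereal 1 \<le> max_dilatation f" unfolding max_dilatation_def
    by (rule SUP_upper2) (use dilatation_bounds(1) in \<open>simp add: uhp_iff\<close>)
  moreover have "max_dilatation f \<le> ereal (\<alpha>\<^sup>2)" unfolding max_dilatation_def
    by (rule SUP_least) (use dilatation_bounds(2) in simp)
  ultimately obtain K where K: "max_dilatation f = ereal K" "1 \<le> K" "K \<le> \<alpha>\<^sup>2"
    by (cases "max_dilatation f") auto
  have "ln K \<le> ln (\<alpha>\<^sup>2)" using K by (intro ln_mono) auto
  also have "\<dots> = 2 * ln \<alpha>" using \<alpha>_ge by (simp add: ln_realpow)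
  finally show ?thesis using that[of "ln K"] K by (simp add: ereal_ln_def)
qed

end

section \<open>The cross-ratio norm\<close>

text \<open>The parameter for which the symmetric quadruple of \<open>cross_ratio_symmetric\<close>
  has cross-ratio -1.\<close>

definition \<kappa> :: real where "\<kappa> = ln (1 + sqrt 2)"

lemma \<kappa>_pos: "\<kappa> > 0"
  unfolding \<kappa>_def by (intro ln_gt_zero) simp

lemma exp_\<kappa>: "exp \<kappa> = 1 + sqrt 2" "exp (- \<kappa>) = sqrt 2 - 1"
proof -
  show "exp \<kappa> = 1 + sqrt 2" unfolding \<kappa>_def by (intro exp_ln) (simp add: add_pos_nonneg)
  moreover have "(1 + sqrt 2) * (sqrt 2 - 1) = 1" by (simp add: algebra_simps)
  ultimately show "exp (- \<kappa>) = sqrt 2 - 1"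
    by (metis exp_minus inverse_unique)
qed

lemma sinh_\<kappa>: "sinh \<kappa> = 1" and cosh_\<kappa>: "cosh \<kappa> = sqrt 2"
  by (simp_all add: sinh_def cosh_def exp_\<kappa>)

lemma two_\<kappa>: "ln (3 + 2 * sqrt 2) = 2 * \<kappa>"
proof -
  have "3 + 2 * sqrt 2 = exp \<kappa> * exp \<kappa>" unfolding exp_\<kappa> by (simp add: algebra_simps)
  also have "\<dots> = exp (2 * \<kappa>)" by (simp add: exp_double power2_eq_square)
  finally show ?thesis by simp
qed

lemma sinh_gt_1: "\<alpha> > 1 \<Longrightarrow> sinh (\<alpha> * \<kappa>) > 1"
  using sinh_real_strict_mono[THEN strict_monoD, of \<kappa> "\<alpha> * \<kappa>"] \<kappa>_pos sinh_\<kappa> by simp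

lemma cross_ratio_symmetric:
  "cross_ratio (Fin (- exp s)) (Fin (- exp (- s))) (Fin (exp (- s))) (Fin (exp s)) = - 1 / (sinh s)\<^sup>2"
proof -
  have e: "exp s * exp (- s) = 1" by (simp add: exp_minus)
  have "exp s - exp (- s) = 2 * sinh s" by (simp add: sinh_def)
  then have d: "- exp (- s) - - exp s = 2 * sinh s" "exp (- s) - exp s = - (2 * sinh s)" by simp_all
  have n: "(exp s - - exp s) * (exp (- s) - - exp (- s)) = 4"
    using e by simp
  show ?thesis unfolding cross_ratio_simps d n by (simp add: power2_eq_square)
qed

text \<open>The power map sends the symmetric quadruple with parameter \<open>s\<close> to the one
  with parameter \<open>\<alpha> * s\<close>, so one formula gives the cross-ratio before and
  after.\<close>

lemma cr_norm_power_map_ge: "ereal (2 * ln (sinh (\<alpha> * \<kappa>))) \<le> cr_norm (power_map \<alpha>)" if "\<alpha> > 1"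
proof -
  let ?Q = "(Fin (- exp \<kappa>), Fin (- exp (- \<kappa>)), Fin (exp (- \<kappa>)), Fin (exp \<kappa>))"
  have pm: "power_map \<alpha> (Fin (exp s)) = Fin (exp (\<alpha> * s))" "power_map \<alpha> (Fin (- exp s)) = Fin (- exp (\<alpha> * s))" for s
    using not_less[of "exp s" 0] exp_gt_zero[of s] by (simp_all add: powr_def not_le)
  have cr: "cross_ratio (power_map \<alpha> (Fin (- exp \<kappa>))) (power_map \<alpha> (Fin (- exp (- \<kappa>)))) (power_map \<alpha> (Fin (exp (- \<kappa>)))) (power_map \<alpha> (Fin (exp \<kappa>)))
      = - 1 / (sinh (\<alpha> * \<kappa>))\<^sup>2"
    unfolding pm mult_minus_right by (rule cross_ratio_symmetric)
  have s: "sinh (\<alpha> * \<kappa>) > 1" using sinh_gt_1[OF that] .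
  have "cross_ratio (Fin (- exp \<kappa>)) (Fin (- exp (- \<kappa>))) (Fin (exp (- \<kappa>))) (Fin (exp \<kappa>)) = - 1"
    unfolding cross_ratio_symmetric sinh_\<kappa> by simp
  then have "?Q \<in> {(x1, x2, x3, x4). cross_ratio x1 x2 x3 x4 = - 1}" by simp
  then have "(case ?Q of (x1, x2, x3, x4) \<Rightarrow> ereal \<bar>ln \<bar>cross_ratio (power_map \<alpha> x1) (power_map \<alpha> x2) (power_map \<alpha> x3) (power_map \<alpha> x4)\<bar>\<bar>) \<le> cr_norm (power_map \<alpha>)"
    unfolding cr_norm_def by (rule SUP_upper)
  then have "ereal \<bar>ln \<bar>- 1 / (sinh (\<alpha> * \<kappa>))\<^sup>2\<bar>\<bar> \<le> cr_norm (power_map \<alpha>)" unfolding prod.case cr .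
  moreover have "ln \<bar>- 1 / (sinh (\<alpha> * \<kappa>))\<^sup>2\<bar> = - (2 * ln (sinh (\<alpha> * \<kappa>)))"
    using s by (simp add: ln_div ln_realpow)
  ultimately show ?thesis using s by simp
qed

text \<open>Both logarithms vanish at 1, so the limit is the quotient of their derivatives, 1 and
  \<open>\<kappa> * cosh \<kappa> / sinh \<kappa> = \<kappa> * sqrt 2\<close>; and
  \<open>1 / (\<kappa> * sqrt 2) = sqrt 2 / (2 * \<kappa>)\<close>.\<close>

lemma ratio_at_1:
  "((\<lambda>\<alpha>. ln \<alpha> / ln (sinh (\<alpha> * \<kappa>))) \<longlongrightarrow> sqrt 2 / ln (3 + 2 * sqrt 2)) (at_right 1)"
proof -
  have "((\<lambda>\<alpha>. ln (sinh (\<alpha> * \<kappa>))) has_real_derivative \<kappa> * sqrt 2) (at 1)"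
    by (auto intro!: derivative_eq_intros simp: sinh_\<kappa> cosh_\<kappa>)
  then have 1: "((\<lambda>\<alpha>. ln (sinh (\<alpha> * \<kappa>)) / (\<alpha> - 1)) \<longlongrightarrow> \<kappa> * sqrt 2) (at 1)"
    by (simp add: has_field_derivative_iff sinh_\<kappa>)
  have "(ln has_real_derivative 1) (at 1)" by (auto intro!: derivative_eq_intros)
  then have 2: "((\<lambda>\<alpha>. ln \<alpha> / (\<alpha> - 1)) \<longlongrightarrow> 1) (at (1::real))"
    by (simp add: has_field_derivative_iff)
  have "((\<lambda>\<alpha>. (ln \<alpha> / (\<alpha> - 1)) / (ln (sinh (\<alpha> * \<kappa>)) / (\<alpha> - 1))) \<longlongrightarrow> 1 / (\<kappa> * sqrt 2)) (at 1)"
    using \<kappa>_pos by (intro tendsto_divide 1 2) simp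
  moreover have "1 / (\<kappa> * sqrt 2) = sqrt 2 / ln (3 + 2 * sqrt 2)"
    unfolding two_\<kappa> using \<kappa>_pos real_sqrt_mult_self[of 2] by (simp add: divide_simps mult_ac)
  ultimately have "((\<lambda>\<alpha>. (ln \<alpha> / (\<alpha> - 1)) / (ln (sinh (\<alpha> * \<kappa>)) / (\<alpha> - 1))) \<longlongrightarrow> sqrt 2 / ln (3 + 2 * sqrt 2)) (at_right 1)"
    by (simp only: filterlim_at_split)
  then show ?thesis
    by (rule Lim_transform_eventually)
      (auto simp: eventually_at_right_field intro!: exI[of _ 2])
qed

lemma ratio_at_top: "((\<lambda>\<alpha>. ln \<alpha> / ln (sinh (\<alpha> * \<kappa>))) \<longlongrightarrow> 0) at_top"
proof -
  have "((\<lambda>\<alpha>. ln \<alpha> / ln ((exp (\<alpha> * \<kappa>) - exp (- (\<alpha> * \<kappa>))) / 2)) \<longlongrightarrow> 0) at_top"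
    using \<kappa>_pos by real_asymp
  then show ?thesis by (simp add: sinh_field_def)
qed

theorem theorem2:
  fixes f :: "real \<Rightarrow> complex \<Rightarrow> complex"
  assumes "\<And>\<alpha>. \<alpha> \<ge> 1 \<Longrightarrow> minimal_lagrangian (f \<alpha>)"
    and "\<And>\<alpha>. \<alpha> \<ge> 1 \<Longrightarrow> extends_continuously (f \<alpha>) (power_map \<alpha>)"
  shows "Limsup (at_right 1)
           (\<lambda>\<alpha>. ereal_ln (max_dilatation (f \<alpha>)) / cr_norm (power_map \<alpha>))
           \<le> ereal (sqrt 2 / ln (3 + 2 * sqrt 2))
         \<and> ((\<lambda>\<alpha>. ereal_ln (max_dilatation (f \<alpha>)) / cr_norm (power_map \<alpha>)) \<longlongrightarrow> 0) at_top"
proof -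
  define R where "R \<alpha> = ereal_ln (max_dilatation (f \<alpha>)) / cr_norm (power_map \<alpha>)" for \<alpha>
  define r where "r \<alpha> = ln \<alpha> / ln (sinh (\<alpha> * \<kappa>))" for \<alpha>
  \<comment> \<open>The factors 2 in \<open>2 * ln \<alpha>\<close> and in the lower bound of the
    norm cancel in \<open>r\<close>; nonnegativity is the lower half of the sandwich at
    infinity.\<close>
  have R: "0 \<le> R \<alpha> \<and> R \<alpha> \<le> ereal (r \<alpha>)" if \<alpha>: "\<alpha> > 1" for \<alpha>
  proof -
    obtain \<theta> \<rho> c where "boundary_ml (f \<alpha>) (fd (f \<alpha>)) \<theta> \<rho> c (signed_powr \<alpha>)"
      using minimal_lagrangian_boundary[OF _ assms(1) assms(2)] \<alpha>
      by (metis less_imp_le zero_less_one less_trans)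
    then interpret boundary_ml "f \<alpha>" "fd (f \<alpha>)" \<theta> \<rho> c "signed_powr \<alpha>" .
    interpret homogeneous_ml "f \<alpha>" "fd (f \<alpha>)" \<theta> \<rho> c \<alpha>
      by standard (use \<alpha> in simp)
    obtain L where L: "ereal_ln (max_dilatation (f \<alpha>)) = ereal L" "0 \<le> L" "L \<le> 2 * ln \<alpha>"
      using ereal_ln_max_dilatation .
    define B where "B = 2 * ln (sinh (\<alpha> * \<kappa>))"
    have B: "B > 0" unfolding B_def using ln_gt_zero[OF sinh_gt_1[OF \<alpha>]] by simp
    have cr: "ereal B \<le> cr_norm (power_map \<alpha>)" unfolding B_def by (rule cr_norm_power_map_ge[OF \<alpha>])
    show ?thesis
    proof (cases "cr_norm (power_map \<alpha>)")
      case (real b)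
      then have b: "B \<le> b" using cr by simp
      have "L / b \<le> (2 * ln \<alpha>) / B" using L B b \<alpha> by (intro frac_le) auto
      also have "\<dots> = r \<alpha>" by (simp add: B_def r_def)
      finally show ?thesis using L B b by (simp add: R_def real)
    next
      \<comment> \<open>An infinite norm makes the quotient 0, which lies between the two
        bounds.\<close>
      case PInf
      then show ?thesis using L B \<alpha> by (simp add: R_def r_def B_def)
    next
      case MInf
      then show ?thesis using cr by simp
    qed
  qed
  have "Limsup (at_right 1) R \<le> Limsup (at_right 1) (\<lambda>\<alpha>. ereal (r \<alpha>))"
    by (rule Limsup_mono) (use R in \<open>auto simp: eventually_at_right_field intro: exI[of _ 2]\<close>)
  also have "\<dots> = ereal (sqrt 2 / ln (3 + 2 * sqrt 2))"
    by (rule lim_imp_Limsup) (use ratio_at_1 in \<open>simp_all add: r_def[abs_def]\<close>)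
  finally have "Limsup (at_right 1) R \<le> ereal (sqrt 2 / ln (3 + 2 * sqrt 2))" .
  moreover have "(R \<longlongrightarrow> 0) at_top"
  proof (rule tendsto_sandwich[OF _ _ tendsto_const])
    show "\<forall>\<^sub>F \<alpha> in at_top. 0 \<le> R \<alpha>" "\<forall>\<^sub>F \<alpha> in at_top. R \<alpha> \<le> ereal (r \<alpha>)"
      using eventually_gt_at_top[of 1] by (eventually_elim, simp add: R)+
    show "((\<lambda>\<alpha>. ereal (r \<alpha>)) \<longlongrightarrow> 0) at_top"
      using ratio_at_top by (simp add: r_def[abs_def] zero_ereal_def)
  qed
  ultimately show ?thesis unfolding R_def[abs_def] by blast
qed

end
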